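(* Let $\Gamma$ be a limit cycle of $\dot u=F(u)$ at a strong resonance 1:3 (R3) bifurcation, with the critical center manifold near $\Gamma$ parametrized by $(\tau,\xi)$ as in the context, so that the restricted dynamics has the R3 periodic normal form with coefficients $\alpha_1,b,c$. Let $v,\varphi^*,v^*$ be as in the context. Then $$b=\frac12\int_0^T\langle v^*,B(\tau;\bar v,\bar v)\rangle d\tau,\qquad\alpha_1=\int_0^T\langle\varphi^*,B(\tau;v,\bar v)\rangle d\tau,$$ $h_{20}$ is the unique solution on $[0,T]$ of $$\dot h_{20}-Ah_{20}-B(\tau;v,v)+2\bar b\bar v=0,\quad h_{20}(T)-e^{i4\pi/3}h_{20}(0)=0,\quad\int_0^T\langle\bar v^*,h_{20}\rangle d\tau=0,$$ $h_{11}$ is the unique solution on $[0,T]$ of $$\dot h_{11}-Ah_{11}-B(\tau;v,\bar v)+\alpha_1\dot u_0=0,\quad h_{11}(T)-h_{11}(0)=0,\quad\int_0^T\langle\varphi^*,h_{11}\rangle d\tau=0,$$ and $$c=\frac12\int_0^T\langle v^*,C(\tau;v,v,\bar v)+2B(\tau;v,h_{11})+B(\tau;\bar v,h_{20})-2\alpha_1A(\tau)v\rangle d\tau .$$ If $v$ is replaced by $\gamma v$ with $\gamma\in\mathbb C$, $|\gamma|=1$, then $c$ is unchanged and $b$ is replaced by $\bar\gamma^3b$.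
   Context: Setting. $F:\mathbb R^n\to\mathbb R^n$ is sufficiently smooth and $u_0$ is a nonconstant periodic solution of $\dot u=F(u)$ with minimal period $T>0$; $\Gamma$ is its orbit. $A(\tau)=F_u(u_0(\tau))$, and $B(\tau;\cdot,\cdot)$, $C(\tau;\cdot,\cdot,\cdot)$ are the symmetric multilinear forms of second and third derivatives of $F$ at $u_0(\tau)$, extended $\mathbb C$-multilinearly. Dots over functions of $\tau$ denote $d/d\tau$; $\langle a,b\rangle=a^{\rm H}b$ (conjugate-linear in the first argument). Let $Y$ solve $\dot Y=A(\tau)Y$, $Y(0)=I_n$; the eigenvalues of $Y(T)$ are the multipliers, critical if of modulus 1. R3 bifurcation: the multiplier $1$ is simple and the only other critical multipliers are $e^{\pm i2\pi/3}$, both simple. The three-dimensional critical center manifold near $\Gamma$ is parametrized as $u(\tau,\xi,\bar\xi)=u_0(\tau)+\xi v(\tau)+\bar\xi\bar v(\tau)+H(\tau,\xi,\bar\xi)$, $\xi\in\mathbb C$ small, $H$ real, smooth, $3T$-periodic in $\tau$, $$H=\sum_{2\le k+l\le3}\frac1{k!\,l!}h_{kl}(\tau)\xi^k\bar\xi^l+O(|\xi|^4),\qquad h_{kl}=\bar h_{lk},$$ with $u(\tau,\xi,\bar\xi)=u(\tau+T,e^{-i2\pi/3}\xi,e^{i2\pi/3}\bar\xi)$, and with the remaining freedom fixed by $\int_0^T\langle\bar v^*,h_{20}\rangle d\tau=0$ and $\int_0^T\langle\varphi^*,h_{11}\rangle d\tau=0$. The dynamics restricted to it is $$\frac{d\tau}{dt}=1+\alpha_1|\xi|^2+\alpha_2\xi^3+\alpha_3\bar\xi^3+\dots,\qquad\frac{d\xi}{dt}=b\bar\xi^2+c\,\xi|\xi|^2+\dots,$$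 with $\alpha_1\in\mathbb R$, $\alpha_2,\alpha_3,b,c\in\mathbb C$, $\alpha_3=\bar\alpha_2$, and dots denoting $O(|\xi|^4)$ terms $3T$-periodic in $\tau$; that is, if $(\tau(t),\xi(t))$ solves this system then $u(\tau(t),\xi(t),\bar\xi(t))$ solves $\dot u=F(u)$. The following are on $[0,T]$: $\dot v-Av=0$, $v(T)=e^{i2\pi/3}v(0)$, $\int_0^T\langle v,v\rangle d\tau=1$ (extended by $v(\tau+T)=e^{i2\pi/3}v(\tau)$); $\dot\varphi^*+A^{\rm T}\varphi^*=0$, $\varphi^*(T)=\varphi^*(0)$, $\int_0^T\langle\varphi^*,F(u_0)\rangle d\tau=1$ ($\varphi^*$ real); $\dot v^*+A^{\rm T}v^*=0$, $v^*(T)=e^{i2\pi/3}v^*(0)$, $\int_0^T\langle v^*,v\rangle d\tau=1$. $\bar v^*$ is the complex conjugate of $v^*$. *)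

theory Defs
  imports "HOL-Analysis.Analysis" "HOL-Computational_Algebra.Polynomial"
begin

section \<open>Differentiability of finite order\<close>

text \<open>C^k on an open set.\<close>

primrec Ck_on :: "nat \<Rightarrow> 'a::real_normed_vector set \<Rightarrow> ('a \<Rightarrow> 'b::real_normed_vector) \<Rightarrow> bool" where
  "Ck_on 0 S f \<longleftrightarrow> continuous_on S f"
| "Ck_on (Suc k) S f \<longleftrightarrow>
     (\<forall>x\<in>S. f differentiable (at x)) \<and> (\<forall>w. Ck_on k S (\<lambda>x. frechet_derivative f (at x) w))"

definition partial :: "'n \<Rightarrow> (real^'n \<Rightarrow> real^'m) \<Rightarrow> real^'n \<Rightarrow> real^'m" where
  "partial j f x = frechet_derivative f (at x) (axis j 1)"

section \<open>Complexification\<close>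

definition cvec :: "real^'n \<Rightarrow> complex^'n" where
  "cvec x = (\<chi> i. complex_of_real (x $ i))"

definition Re_vec :: "complex^'n \<Rightarrow> real^'n" where
  "Re_vec x = (\<chi> i. Re (x $ i))"

definition cnj_vec :: "complex^'n \<Rightarrow> complex^'n" where
  "cnj_vec x = (\<chi> i. cnj (x $ i))"

definition cmat :: "real^'n^'m \<Rightarrow> complex^'n^'m" where
  "cmat M = map_matrix complex_of_real M"

definition herm :: "complex^'n \<Rightarrow> complex^'n \<Rightarrow> complex" where
  "herm a b = (\<Sum>i\<in>UNIV. cnj (a $ i) * b $ i)"

text \<open>
  The derivatives of \<open>F\<close> at a point \<open>x\<close>, as complex multilinear maps.  The double and triple
  sums over the real partial derivatives are the complex multilinear extensions of the
  second and third derivatives of \<open>F\<close>.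
\<close>

definition formA :: "(real^'n \<Rightarrow> real^'n) \<Rightarrow> real^'n \<Rightarrow> complex^'n^'n" where
  "formA F x = cmat (jacobian F (at x))"

definition formB :: "(real^'n \<Rightarrow> real^'n) \<Rightarrow> real^'n \<Rightarrow> complex^'n \<Rightarrow> complex^'n \<Rightarrow> complex^'n" where
  "formB F x p q = (\<Sum>j\<in>UNIV. \<Sum>k\<in>UNIV. (p $ j * q $ k) *s cvec (partial j (partial k F) x))"

definition formC ::
  "(real^'n \<Rightarrow> real^'n) \<Rightarrow> real^'n \<Rightarrow> complex^'n \<Rightarrow> complex^'n \<Rightarrow> complex^'n \<Rightarrow> complex^'n" where
  "formC F x p q s = (\<Sum>j\<in>UNIV. \<Sum>k\<in>UNIV. \<Sum>l\<in>UNIV.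
      (p $ j * q $ k * s $ l) *s cvec (partial j (partial k (partial l F)) x))"

section \<open>Limit cycles and multipliers\<close>

definition periodic_solution :: "(real^'n \<Rightarrow> real^'n) \<Rightarrow> (real \<Rightarrow> real^'n) \<Rightarrow> real \<Rightarrow> bool" where
  "periodic_solution F u0 T \<longleftrightarrow>
     (\<forall>t. (u0 has_vector_derivative F (u0 t)) (at t)) \<and>
     (\<exists>s t. u0 s \<noteq> u0 t) \<and>
     T > 0 \<and> (\<forall>t. u0 (t + T) = u0 t) \<and>
     (\<forall>S. 0 < S \<and> S < T \<longrightarrow> (\<exists>t. u0 (t + S) \<noteq> u0 t))"

definition fundamental_matrix ::
  "(real^'n \<Rightarrow> real^'n) \<Rightarrow> (real \<Rightarrow> real^'n) \<Rightarrow> (real \<Rightarrow> real^'n^'n) \<Rightarrow> bool" where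
  "fundamental_matrix F u0 Y \<longleftrightarrow>
     Y 0 = mat 1 \<and>
     (\<forall>t. (Y has_vector_derivative (jacobian F (at (u0 t)) ** Y t)) (at t))"

definition eigval :: "complex^'n^'n \<Rightarrow> complex \<Rightarrow> bool" where
  "eigval M \<mu> \<longleftrightarrow> (\<exists>x. x \<noteq> 0 \<and> M *v x = \<mu> *s x)"

definition charpoly :: "complex^'n^'n \<Rightarrow> complex poly" where
  "charpoly M = det (mat [:0, 1:] - map_matrix (\<lambda>a. [:a:]) M)"

definition simple_eigval :: "complex^'n^'n \<Rightarrow> complex \<Rightarrow> bool" where
  "simple_eigval M \<mu> \<longleftrightarrow> eigval M \<mu> \<and> order \<mu> (charpoly M) = 1"

definition R3_multipliers :: "real^'n^'n \<Rightarrow> bool" where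
  "R3_multipliers M \<longleftrightarrow>
     simple_eigval (cmat M) 1 \<and>
     simple_eigval (cmat M) (cis (2 * pi / 3)) \<and>
     simple_eigval (cmat M) (cis (- (2 * pi / 3))) \<and>
     (\<forall>\<mu>. eigval (cmat M) \<mu> \<and> norm \<mu> = 1 \<longrightarrow> \<mu> \<in> {1, cis (2 * pi / 3), cis (- (2 * pi / 3))})"

section \<open>Critical and adjoint eigenfunctions\<close>

definition eigfun_v ::
  "(real^'n \<Rightarrow> real^'n) \<Rightarrow> (real \<Rightarrow> real^'n) \<Rightarrow> real \<Rightarrow> (real \<Rightarrow> complex^'n) \<Rightarrow> bool" where
  "eigfun_v F u0 T v \<longleftrightarrow>
     (\<forall>\<tau>\<in>{0..T}. (v has_vector_derivative formA F (u0 \<tau>) *v v \<tau>) (at \<tau> within {0..T})) \<and>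
     (\<forall>\<tau>. v (\<tau> + T) = cis (2 * pi / 3) *s v \<tau>) \<and>
     integral {0..T} (\<lambda>\<tau>. herm (v \<tau>) (v \<tau>)) = 1"

definition adjoint_phi ::
  "(real^'n \<Rightarrow> real^'n) \<Rightarrow> (real \<Rightarrow> real^'n) \<Rightarrow> real \<Rightarrow> (real \<Rightarrow> real^'n) \<Rightarrow> bool" where
  "adjoint_phi F u0 T \<phi> \<longleftrightarrow>
     (\<forall>\<tau>\<in>{0..T}. (\<phi> has_vector_derivative - (transpose (jacobian F (at (u0 \<tau>))) *v \<phi> \<tau>))
        (at \<tau> within {0..T})) \<and>
     \<phi> T = \<phi> 0 \<and>
     integral {0..T} (\<lambda>\<tau>. herm (cvec (\<phi> \<tau>)) (cvec (F (u0 \<tau>)))) = 1"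

definition adjoint_v ::
  "(real^'n \<Rightarrow> real^'n) \<Rightarrow> (real \<Rightarrow> real^'n) \<Rightarrow> real \<Rightarrow> (real \<Rightarrow> complex^'n) \<Rightarrow>
   (real \<Rightarrow> complex^'n) \<Rightarrow> bool" where
  "adjoint_v F u0 T v vs \<longleftrightarrow>
     (\<forall>\<tau>\<in>{0..T}. (vs has_vector_derivative - (transpose (formA F (u0 \<tau>)) *v vs \<tau>))
        (at \<tau> within {0..T})) \<and>
     vs T = cis (2 * pi / 3) *s vs 0 \<and>
     integral {0..T} (\<lambda>\<tau>. herm (vs \<tau>) (v \<tau>)) = 1"

section \<open>The critical center manifold and its R3 normal form\<close>

definition bigO4 :: "(real \<times> complex \<Rightarrow> 'b::real_normed_vector) \<Rightarrow> bool" where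
  "bigO4 R \<longleftrightarrow> (\<exists>K. \<exists>\<delta>>0. \<forall>\<tau> \<xi>. norm \<xi> < \<delta> \<longrightarrow> norm (R (\<tau>, \<xi>)) \<le> K * norm \<xi> ^ 4)"

text \<open>\<open>u0 + \<xi> v + cnj \<xi> cnj v\<close> is already real; \<open>Re_vec\<close> only changes its type.\<close>

definition cm_param ::
  "(real \<Rightarrow> real^'n) \<Rightarrow> (real \<Rightarrow> complex^'n) \<Rightarrow> (real \<times> complex \<Rightarrow> real^'n) \<Rightarrow>
   real \<Rightarrow> complex \<Rightarrow> real^'n" where
  "cm_param u0 v H \<tau> \<xi> =
     Re_vec (cvec (u0 \<tau>) + \<xi> *s v \<tau> + cnj \<xi> *s cnj_vec (v \<tau>)) + H (\<tau>, \<xi>)"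

definition cm_expansion ::
  "(real \<times> complex \<Rightarrow> real^'n) \<Rightarrow> (nat \<Rightarrow> nat \<Rightarrow> real \<Rightarrow> complex^'n) \<Rightarrow> bool" where
  "cm_expansion H h \<longleftrightarrow>
     (\<forall>k l \<tau>. h k l \<tau> = cnj_vec (h l k \<tau>)) \<and>
     bigO4 (\<lambda>(\<tau>, \<xi>). cvec (H (\<tau>, \<xi>)) -
       (\<Sum>(k, l) | 2 \<le> k + l \<and> k + l \<le> 3. (\<xi> ^ k * cnj \<xi> ^ l / (fact k * fact l)) *s h k l \<tau>))"

text \<open>
  The restricted dynamics on an open time interval \<open>J\<close>; \<open>p\<close> and \<open>q\<close> are the higher-order
  terms.  For \<open>\<alpha>3 = cnj \<alpha>2\<close> the argument of \<open>Re\<close> is real.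
\<close>

definition R3_flow ::
  "real \<Rightarrow> complex \<Rightarrow> complex \<Rightarrow> complex \<Rightarrow> complex \<Rightarrow>
   (real \<times> complex \<Rightarrow> real) \<Rightarrow> (real \<times> complex \<Rightarrow> complex) \<Rightarrow>
   real set \<Rightarrow> (real \<Rightarrow> real) \<Rightarrow> (real \<Rightarrow> complex) \<Rightarrow> bool" where
  "R3_flow \<alpha>1 \<alpha>2 \<alpha>3 b c p q J \<theta> \<xi> \<longleftrightarrow>
     (\<forall>t\<in>J.
        (\<theta> has_real_derivative
           Re (1 + of_real \<alpha>1 * of_real ((norm (\<xi> t))\<^sup>2) + \<alpha>2 * \<xi> t ^ 3 + \<alpha>3 * cnj (\<xi> t) ^ 3)
             + p (\<theta> t, \<xi> t)) (at t) \<and>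
        (\<xi> has_vector_derivative
           b * (cnj (\<xi> t))\<^sup>2 + c * \<xi> t * of_real ((norm (\<xi> t))\<^sup>2) + q (\<theta> t, \<xi> t)) (at t))"

text \<open>
  \<open>r\<close> is the size of the neighbourhood of \<open>\<xi> = 0\<close> on which the manifold is parametrized.
  The last clause says that the parametrization maps solutions of the normal form to
  solutions of \<open>u' = F u\<close>.  Differentiability of the higher-order terms guarantees that the
  normal form has a solution through every point, so that this clause has its intended
  strength.
\<close>

definition R3_center_manifold ::
  "(real^'n \<Rightarrow> real^'n) \<Rightarrow> (real \<Rightarrow> real^'n) \<Rightarrow> real \<Rightarrow>
   (real \<Rightarrow> complex^'n) \<Rightarrow> (real \<Rightarrow> real^'n) \<Rightarrow> (real \<Rightarrow> complex^'n) \<Rightarrow>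
   (real \<times> complex \<Rightarrow> real^'n) \<Rightarrow> (nat \<Rightarrow> nat \<Rightarrow> real \<Rightarrow> complex^'n) \<Rightarrow>
   real \<Rightarrow> complex \<Rightarrow> complex \<Rightarrow> complex \<Rightarrow> complex \<Rightarrow> bool" where
  "R3_center_manifold F u0 T v \<phi> vs H h \<alpha>1 \<alpha>2 \<alpha>3 b c \<longleftrightarrow>
     \<alpha>3 = cnj \<alpha>2 \<and>
     cm_expansion H h \<and>
     integral {0..T} (\<lambda>\<tau>. herm (cnj_vec (vs \<tau>)) (h 2 0 \<tau>)) = 0 \<and>
     integral {0..T} (\<lambda>\<tau>. herm (cvec (\<phi> \<tau>)) (h 1 1 \<tau>)) = 0 \<and>
     (\<exists>r>0. \<exists>p q.
        Ck_on 4 (UNIV \<times> ball 0 r) H \<and>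
        (\<forall>\<tau>. \<forall>\<xi>\<in>ball 0 r. H (\<tau> + 3 * T, \<xi>) = H (\<tau>, \<xi>)) \<and>
        (\<forall>\<tau>. \<forall>\<xi>\<in>ball 0 r.
           cm_param u0 v H \<tau> \<xi> = cm_param u0 v H (\<tau> + T) (cis (- (2 * pi / 3)) * \<xi>)) \<and>
        Ck_on 1 (UNIV \<times> ball 0 r) p \<and> Ck_on 1 (UNIV \<times> ball 0 r) q \<and>
        (\<forall>\<tau>. \<forall>\<xi>\<in>ball 0 r. p (\<tau> + 3 * T, \<xi>) = p (\<tau>, \<xi>) \<and> q (\<tau> + 3 * T, \<xi>) = q (\<tau>, \<xi>)) \<and>
        bigO4 p \<and> bigO4 q \<and>
        (\<forall>J \<theta> \<xi>. open J \<and> is_interval J \<and> \<xi> ` J \<subseteq> ball 0 r \<and> R3_flow \<alpha>1 \<alpha>2 \<alpha>3 b c p q J \<theta> \<xi> \<longrightarrow>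
           (\<forall>t\<in>J. ((\<lambda>s. cm_param u0 v H (\<theta> s) (\<xi> s)) has_vector_derivative
                     F (cm_param u0 v H (\<theta> t) (\<xi> t))) (at t))))"

section \<open>The boundary value problems for \<open>h20\<close> and \<open>h11\<close>\<close>

definition h20_bvp ::
  "(real^'n \<Rightarrow> real^'n) \<Rightarrow> (real \<Rightarrow> real^'n) \<Rightarrow> real \<Rightarrow> (real \<Rightarrow> complex^'n) \<Rightarrow>
   (real \<Rightarrow> complex^'n) \<Rightarrow> complex \<Rightarrow> (real \<Rightarrow> complex^'n) \<Rightarrow> bool" where
  "h20_bvp F u0 T v vs b w \<longleftrightarrow>
     (\<forall>\<tau>\<in>{0..T}. (w has_vector_derivative
        formA F (u0 \<tau>) *v w \<tau> + formB F (u0 \<tau>) (v \<tau>) (v \<tau>) - (2 * cnj b) *s cnj_vec (v \<tau>))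
        (at \<tau> within {0..T})) \<and>
     w T - cis (4 * pi / 3) *s w 0 = 0 \<and>
     integral {0..T} (\<lambda>\<tau>. herm (cnj_vec (vs \<tau>)) (w \<tau>)) = 0"

definition h11_bvp ::
  "(real^'n \<Rightarrow> real^'n) \<Rightarrow> (real \<Rightarrow> real^'n) \<Rightarrow> real \<Rightarrow> (real \<Rightarrow> complex^'n) \<Rightarrow>
   (real \<Rightarrow> real^'n) \<Rightarrow> real \<Rightarrow> (real \<Rightarrow> complex^'n) \<Rightarrow> bool" where
  "h11_bvp F u0 T v \<phi> \<alpha>1 w \<longleftrightarrow>
     (\<forall>\<tau>\<in>{0..T}. (w has_vector_derivative
        formA F (u0 \<tau>) *v w \<tau> + formB F (u0 \<tau>) (v \<tau>) (cnj_vec (v \<tau>))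
          - of_real \<alpha>1 *s cvec (vector_derivative u0 (at \<tau>)))
        (at \<tau> within {0..T})) \<and>
     w T - w 0 = 0 \<and>
     integral {0..T} (\<lambda>\<tau>. herm (cvec (\<phi> \<tau>)) (w \<tau>)) = 0"

end

theory Submission
  imports Defs
begin

text \<open>
  Put \<open>\<xi> = \<epsilon> w\<close> with \<open>w\<close> fixed.  Writing the normal form as \<open>\<tau>' = 1 + a\<close>, \<open>\<xi>' = g\<close>, the parametrization \<open>u\<close>
  satisfies the invariance equation \<open>(1 + a) u\<^sub>\<tau> + D\<^sub>\<xi>u g = F u\<close> at every point, because a solution of the normal
  form passes through every point.  As \<open>g = O(\<epsilon>\<^sup>2)\<close>, the term \<open>D\<^sub>\<xi>H g\<close> equals \<open>H(\<tau>, \<xi> + g) - H(\<tau>, \<xi>)\<close> up to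
  \<open>O(\<epsilon>\<^sup>4)\<close>.  The equation can therefore be solved for \<open>u\<^sub>\<tau>\<close>, expanded in \<open>\<epsilon>\<close> uniformly in \<open>\<tau>\<close> and integrated over
  \<open>\<tau>\<close>, and no expansion of a \<open>\<tau>\<close>-derivative of \<open>H\<close> is needed.  Comparing powers of \<open>\<epsilon>\<close> and varying \<open>w\<close> yields linear
  differential equations for \<open>h 2 0\<close>, \<open>h 1 1\<close> and \<open>h 2 1\<close>.  Their solvability conditions, obtained by pairing with the
  adjoint eigenfunctions, are the formulas for \<open>b\<close>, \<open>\<alpha>1\<close> and \<open>c\<close>; simplicity of the multipliers gives uniqueness.
  Replacing \<open>v\<close> by \<open>\<gamma> v\<close> amounts to the substitution \<open>\<xi> \<mapsto> \<gamma> \<xi>\<close>.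
\<close>

section \<open>Functions of class $C^k$\<close>

text \<open>The coefficients \<open>h k l\<close> are known only through a remainder of order four
  that is uniform in \<tau>. Nothing is assumed about their continuity or differentiability, and a
  bound on \<open>H\<close> minus a polynomial says nothing about the derivatives of the difference.
  Both properties have to be derived: continuity by uniform limits, differentiability by comparing
  integrals. Uniformity in \<tau> is what makes both possible. Order four is the natural cutoff:
  \<open>c\<close> first appears at \<epsilon>^3, and as \<open>g\<close> and \<open>a\<close> start
  at \<epsilon>^2, their squares fall into the remainder. The resonance enters through the boundary
  conditions. Over one period \<open>h k l\<close> acquires the factor exp(2 \<pi> i (k - l) / 3),
  so \<open>h 0 2\<close> and \<open>h 2 1\<close> both have the multiplier of \<open>v\<close>.
  Hence \<open>b\<close> is a solvability constant of a quadratic equation, and the equation for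
  \<open>h 2 1\<close> contains a resonant multiple of \<open>h 0 2\<close>, which the normalization
  of \<open>h 2 0\<close> removes from the formula for \<open>c\<close>.\<close>

lemma differentiable_transform_open:
  assumes "f differentiable (at x)" "open S" "x \<in> S" "\<And>y. y \<in> S \<Longrightarrow> f y = g y"
  shows "g differentiable (at x)"
  using assms has_derivative_transform_within_open unfolding differentiable_def by blast

lemma Ck_on_cong:
  assumes "open S" "\<And>x. x \<in> S \<Longrightarrow> f x = g x" "Ck_on k S f"
  shows "Ck_on k S g"
  using assms(2,3)
proof (induction k arbitrary: f g)
  case 0
  then show ?case by (simp cong: continuous_on_cong)
next
  case (Suc k)
  have d: "frechet_derivative f (at x) = frechet_derivative g (at x)" if "x \<in> S" for x
    using frechet_derivative_transform_within_open[of f x S g] Suc.prems assms(1) that by auto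
  have "g differentiable (at x)" if "x \<in> S" for x
    by (metis Ck_on.simps(2) Suc.prems assms(1) differentiable_transform_open that)
  moreover have "Ck_on k S (\<lambda>x. frechet_derivative g (at x) w)" for w
    by (rule Suc.IH[of "\<lambda>x. frechet_derivative f (at x) w"]) (use d Suc.prems in auto)
  ultimately show ?case by simp
qed

text \<open>The derivative of \<open>f (L x)\<close> in direction \<open>w\<close> is that of
  \<open>f\<close> at \<open>L x\<close> in the fixed direction \<open>L w\<close>: again a function
  composed with \<open>L\<close>, so the induction closes. The instance needed is the rotation of
  \<xi> by \<gamma>.\<close>

lemma Ck_on_compose_linear:
  assumes "open S'" "bounded_linear L" "L ` S' \<subseteq> S" "Ck_on k S f"
  shows "Ck_on k S' (\<lambda>x. f (L x))"
  using assms(4)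
proof (induction k arbitrary: f)
  case 0
  have "continuous_on S' L"
    using assms(2) by (simp add: linear_continuous_on)
  then show ?case using 0 assms(3) continuous_on_compose2[of S f S' L] by simp
next
  case (Suc k)
  have L: "(L has_derivative L) (at x)" for x
    using assms(2) by (rule bounded_linear_imp_has_derivative)
  have f: "(f has_derivative frechet_derivative f (at (L x))) (at (L x))" if "x \<in> S'" for x
    using Suc.prems assms(3) that frechet_derivative_works by (metis Ck_on.simps(2) image_subset_iff)
  have fL: "((\<lambda>x. f (L x)) has_derivative (\<lambda>w. frechet_derivative f (at (L x)) (L w))) (at x)" if "x \<in> S'" for x
    using diff_chain_at[OF L f[OF that]] by (simp add: o_def)
  have "(\<lambda>x. f (L x)) differentiable (at x)" if "x \<in> S'" for x
    using fL[OF that] unfolding differentiable_def by blast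
  moreover have "Ck_on k S' (\<lambda>x. frechet_derivative (\<lambda>x. f (L x)) (at x) w)" for w
  proof (rule Ck_on_cong[OF assms(1)])
    show "Ck_on k S' (\<lambda>x. frechet_derivative f (at (L x)) (L w))"
      using Suc.IH[of "\<lambda>y. frechet_derivative f (at y) (L w)"] Suc.prems by simp
    show "frechet_derivative f (at (L x)) (L w) = frechet_derivative (\<lambda>x. f (L x)) (at x) w"
      if "x \<in> S'" for x
      using frechet_derivative_at[OF fL[OF that]] by metis
  qed
  ultimately show ?case by simp
qed

lemma Ck_on_linear_compose:
  assumes "open S" "bounded_linear L" "Ck_on k S f"
  shows "Ck_on k S (\<lambda>x. L (f x))"
  using assms(3)
proof (induction k arbitrary: f)
  case 0
  then show ?case using assms(2) by (auto intro: bounded_linear.continuous_on)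
next
  case (Suc k)
  have fL: "((\<lambda>x. L (f x)) has_derivative (\<lambda>w. L (frechet_derivative f (at x) w))) (at x)" if "x \<in> S" for x
    using Suc.prems that assms(2) bounded_linear.has_derivative frechet_derivative_works
    by (metis Ck_on.simps(2))
  have "(\<lambda>x. L (f x)) differentiable (at x)" if "x \<in> S" for x
    using fL[OF that] unfolding differentiable_def by blast
  moreover have "Ck_on k S (\<lambda>x. frechet_derivative (\<lambda>x. L (f x)) (at x) w)" for w
  proof (rule Ck_on_cong[OF assms(1)])
    show "Ck_on k S (\<lambda>x. L (frechet_derivative f (at x) w))"
      using Suc.IH[of "\<lambda>y. frechet_derivative f (at y) w"] Suc.prems by simp
    show "L (frechet_derivative f (at x) w) = frechet_derivative (\<lambda>x. L (f x)) (at x) w"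
      if "x \<in> S" for x
      using frechet_derivative_at[OF fL[OF that]] by metis
  qed
  ultimately show ?case by simp
qed

lemma Ck_on_Suc_imp: "Ck_on (Suc k) S f \<Longrightarrow> Ck_on k S f"
proof (induction k arbitrary: f)
  case 0
  then show ?case by (auto intro!: continuous_at_imp_continuous_on differentiable_imp_continuous_within)
next
  case (Suc k)
  then show ?case by (metis Ck_on.simps(2))
qed

lemma Ck_on_imp_continuous_on: "Ck_on k S f \<Longrightarrow> continuous_on S f"
proof (induction k)
  case (Suc k)
  then show ?case using Ck_on_Suc_imp by blast
qed simp

lemma Ck_on_mono: "k \<le> m \<Longrightarrow> Ck_on m S f \<Longrightarrow> Ck_on k S f"
  by (induction m rule: dec_induct) (auto dest: Ck_on_Suc_imp simp del: Ck_on.simps)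

text \<open>\<open>Ck_on\<close> gives continuity of the derivative for one direction at a time, not
  in operator norm. Bounding the finitely many basis directions on \<open>K\<close> bounds the
  operator norm, and the mean value inequality on the convex set does the rest.\<close>

lemma C1_lipschitz_on_compact_convex:
  fixes f :: "'a::euclidean_space \<Rightarrow> 'b::real_normed_vector"
  assumes "Ck_on 1 S f" "compact K" "convex K" "K \<subseteq> S"
  obtains L where "L-lipschitz_on K f"
proof -
  let ?D = "\<lambda>x. frechet_derivative f (at x)"
  have D: "(f has_derivative ?D x) (at x)" if "x \<in> K" for x
    using assms that frechet_derivative_works by auto
  have "\<exists>M. \<forall>x\<in>K. norm (?D x e) \<le> M" for e
  proof -
    have "continuous_on K (\<lambda>x. ?D x e)"
      using assms(1,4) by (auto intro: continuous_on_subset)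
    then have "bounded ((\<lambda>x. ?D x e) ` K)"
      using assms(2) compact_continuous_image compact_imp_bounded by blast
    then show ?thesis by (auto simp: bounded_iff)
  qed
  then obtain M where M: "\<And>e x. x \<in> K \<Longrightarrow> norm (?D x e) \<le> M e" by metis
  have "onorm (?D x) \<le> (\<Sum>e\<in>Basis. \<bar>M e\<bar>)" if x: "x \<in> K" for x
  proof (rule onorm_le)
    fix y
    have lin: "linear (?D x)" using D[OF x] has_derivative_linear by blast
    have "?D x y = ?D x (\<Sum>e\<in>Basis. (y \<bullet> e) *\<^sub>R e)" by (simp add: euclidean_representation)
    also have "\<dots> = (\<Sum>e\<in>Basis. (y \<bullet> e) *\<^sub>R ?D x e)"
      by (simp add: linear_sum[OF lin] linear_cmul[OF lin])
    also have "norm \<dots> \<le> (\<Sum>e\<in>Basis. norm y * \<bar>M e\<bar>)"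
    proof (rule sum_norm_le)
      fix e :: 'a assume "e \<in> Basis"
      then show "norm ((y \<bullet> e) *\<^sub>R ?D x e) \<le> norm y * \<bar>M e\<bar>"
        using M[OF x, of e] Basis_le_norm[of e y] by (auto intro!: mult_mono)
    qed
    finally show "norm (?D x y) \<le> (\<Sum>e\<in>Basis. \<bar>M e\<bar>) * norm y"
      by (simp add: sum_distrib_left mult.commute)
  qed
  then have "(\<Sum>e\<in>Basis. \<bar>M e\<bar>)-lipschitz_on K f"
    by (intro bounded_derivative_imp_lipschitz[OF has_derivative_at_withinI[OF D] assms(3)])
       (auto intro: sum_nonneg)
  then show ?thesis by (rule that)
qed

text \<open>The product rule needs bounds on both factors, which compactness supplies. It builds the
  monomials of the normal form from \<xi> and its conjugate.\<close>

lemma lipschitz_on_mult_compact: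
  fixes f g :: "'a::metric_space \<Rightarrow> 'b::real_normed_algebra"
  assumes "C-lipschitz_on K f" "D-lipschitz_on K g" "compact K"
  obtains L where "L-lipschitz_on K (\<lambda>x. f x * g x)"
proof -
  have "bounded (f ` K)" "bounded (g ` K)"
    using assms by (auto intro!: compact_imp_bounded compact_continuous_image lipschitz_on_continuous_on)
  then obtain A B where A: "\<And>x. x \<in> K \<Longrightarrow> norm (f x) \<le> A" and B: "\<And>x. x \<in> K \<Longrightarrow> norm (g x) \<le> B"
    by (auto simp: bounded_iff)
  have "(\<bar>A\<bar> * D + C * \<bar>B\<bar>)-lipschitz_on K (\<lambda>x. f x * g x)"
  proof (rule lipschitz_onI)
    fix x y assume xy: "x \<in> K" "y \<in> K"
    have "f x * g x - f y * g y = f x * (g x - g y) + (f x - f y) * g y"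
      by (simp add: algebra_simps)
    then have "dist (f x * g x) (f y * g y) \<le> norm (f x) * dist (g x) (g y) + dist (f x) (f y) * norm (g y)"
      unfolding dist_norm by (metis norm_triangle_mono norm_mult_ineq)
    also have "\<dots> \<le> \<bar>A\<bar> * (D * dist x y) + (C * dist x y) * \<bar>B\<bar>"
      using A[OF xy(1)] B[OF xy(2)] lipschitz_onD[OF assms(1) xy] lipschitz_onD[OF assms(2) xy]
        lipschitz_on_nonneg[OF assms(1)]
      by (intro add_mono mult_mono) (auto intro: order_trans)
    finally show "dist (f x * g x) (f y * g y) \<le> (\<bar>A\<bar> * D + C * \<bar>B\<bar>) * dist x y"
      by (simp add: algebra_simps)
  qed (use lipschitz_on_nonneg[OF assms(1)] lipschitz_on_nonneg[OF assms(2)] in auto)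
  then show ?thesis by (rule that)
qed

section \<open>Local solutions of differential equations\<close>

text \<open>Composing with the nearest-point projection onto the ball makes the field globally Lipschitz,
  so that Picard iteration is a contraction of all bounded continuous functions.\<close>

lemma local_solution_exists:
  fixes f :: "'a::euclidean_space \<Rightarrow> 'a"
  assumes "\<rho> > 0" and lip: "L-lipschitz_on (cball x0 \<rho>) f"
  obtains \<delta> x where "\<delta> > 0" "x 0 = x0"
    "\<And>t. \<bar>t\<bar> < \<delta> \<Longrightarrow> x t \<in> cball x0 \<rho> \<and> (x has_vector_derivative f (x t)) (at t)"
proof -
  let ?K = "cball x0 \<rho>"
  define g where "g = (\<lambda>x. f (closest_point ?K x))"
  have cp: "closest_point ?K x \<in> ?K" for x
    using assms(1) by (intro closest_point_in_set) auto
  have L0: "L \<ge> 0" using lip lipschitz_on_nonneg by blast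
  have gl: "dist (g x) (g y) \<le> L * dist x y" for x y
  proof -
    have "dist (g x) (g y) \<le> L * dist (closest_point ?K x) (closest_point ?K y)"
      unfolding g_def by (rule lipschitz_onD[OF lip cp cp])
    also have "\<dots> \<le> L * dist x y"
      using L0 assms(1) by (intro mult_left_mono closest_point_lipschitz) auto
    finally show ?thesis .
  qed
  have gcont: "continuous_on UNIV g"
    using lipschitz_on_continuous_on[of L UNIV g] gl L0 by (auto simp: lipschitz_on_def)
  have "compact (f ` ?K)"
    using lip by (intro compact_continuous_image lipschitz_on_continuous_on) auto
  then obtain M0 where M0: "\<And>x. x \<in> ?K \<Longrightarrow> norm (f x) \<le> M0"
    using compact_imp_bounded bounded_iff by (metis imageI)
  define M where "M = max M0 0"
  have gM: "norm (g x) \<le> M" and Mp: "M \<ge> 0" for x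
    using M0[OF cp[of x]] unfolding g_def M_def by auto
  \<comment> \<open>The two integrals in the Picard map below run over intervals of length at most
    2\<delta> and \<delta>, whence the factor 3. The first entry gives contraction constant 1/2, the
    second keeps the image within distance \<rho> of \<open>x0\<close>.\<close>
  define \<delta> where "\<delta> = min (1 / (6 * (L + 1))) (\<rho> / (3 * (M + 1)))"
  have \<delta>: "\<delta> > 0" "3 * \<delta> * L \<le> 1/2" "3 * \<delta> * M \<le> \<rho>"
  proof -
    show "\<delta> > 0" using L0 Mp assms(1) by (auto simp: \<delta>_def)
    have "\<delta> \<le> 1 / (6 * (L + 1))" by (simp add: \<delta>_def)
    then have "\<delta> * (6 * (L + 1)) \<le> 1" using L0 by (simp add: field_simps)
    then show "3 * \<delta> * L \<le> 1/2" using \<open>\<delta> > 0\<close> by (simp add: algebra_simps)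
    have "\<delta> \<le> \<rho> / (3 * (M + 1))" by (simp add: \<delta>_def)
    then have "\<delta> * (3 * (M + 1)) \<le> \<rho>" using Mp by (simp add: field_simps)
    then show "3 * \<delta> * M \<le> \<rho>" using \<open>\<delta> > 0\<close> by (simp add: algebra_simps)
  qed
  \<comment> \<open>Time is clamped to [-\<delta>, \<delta>], so that the iteration acts on bounded
    continuous functions on the whole line.\<close>
  define c where "c = (\<lambda>t. max (-\<delta>) (min \<delta> t))"
  have c: "c t \<in> {-\<delta>..\<delta>}" for t using \<delta>(1) by (auto simp: c_def)
  have ccont: "continuous_on UNIV c" unfolding c_def by (intro continuous_intros)
  \<comment> \<open>The difference of two integrals starting at -\<delta> is the oriented integral
    from 0 to \<open>c t\<close>, for either sign of \<open>t\<close>.\<close>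
  define P where "P = (\<lambda>x t. x0 + (integral {-\<delta>..c t} (\<lambda>s. g (x s)) - integral {-\<delta>..0} (\<lambda>s. g (x s))))"
  have xc: "continuous_on A (\<lambda>s. g (apply_bcontfun x s))" for x :: "real \<Rightarrow>\<^sub>C 'a" and A
    by (rule continuous_on_compose2[OF gcont]) auto
  have ib: "norm (integral {-\<delta>..c t} h - integral {-\<delta>..0} h) \<le> 3 * \<delta> * B"
    if h: "continuous_on {-\<delta>..\<delta>} h" and B: "\<And>s. norm (h s) \<le> B" for h :: "real \<Rightarrow> 'a" and B t
  proof -
    have B0: "B \<ge> 0" using B norm_ge_zero order_trans by blast
    have 1: "norm (integral {-\<delta>..s} h) \<le> B * (s + \<delta>)" if "s \<in> {-\<delta>..\<delta>}" for s
    proof -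
      have "continuous_on {-\<delta>..s} h" using h by (rule continuous_on_subset) (use that in auto)
      then show ?thesis using integral_bound[of "-\<delta>" s h B] that B by auto
    qed
    have "norm (integral {-\<delta>..c t} h - integral {-\<delta>..0} h) \<le> B * (c t + \<delta>) + B * (0 + \<delta>)"
      using norm_triangle_le_diff 1[OF c[of t]] 1[of 0] \<delta>(1) 
      by (smt (verit) atLeastAtMost_iff norm_triangle_ineq4)
    also have "\<dots> \<le> B * (2 * \<delta>) + B * \<delta>"
      using c[of t] B0 by (intro add_mono mult_left_mono) auto
    finally show ?thesis by (simp add: algebra_simps)
  qed
  have "P (apply_bcontfun x) \<in> bcontfun" for x
  proof (rule bcontfun_normI)
    have "continuous_on {-\<delta>..\<delta>} (\<lambda>t. integral {-\<delta>..t} (\<lambda>s. g (apply_bcontfun x s)))"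
      by (rule indefinite_integral_continuous_1) (rule integrable_continuous_real[OF xc])
    then have "continuous_on UNIV (\<lambda>t. integral {-\<delta>..c t} (\<lambda>s. g (apply_bcontfun x s)))"
      by (rule continuous_on_compose2[OF _ ccont]) (use c in auto)
    then show "continuous_on UNIV (P (apply_bcontfun x))"
      unfolding P_def by (intro continuous_intros)
    show "norm (P (apply_bcontfun x) t) \<le> norm x0 + 3 * \<delta> * M" for t
      unfolding P_def by (intro norm_triangle_mono order_refl ib xc gM)
  qed
  then have PB: "apply_bcontfun (Bcontfun (P (apply_bcontfun x))) = P (apply_bcontfun x)" for x
    by (simp add: Bcontfun_inverse)
  have "dist (Bcontfun (P (apply_bcontfun x))) (Bcontfun (P (apply_bcontfun y))) \<le> 1/2 * dist x y" for x y
  proof (rule dist_bound)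
    fix t
    let ?h = "\<lambda>s. g (apply_bcontfun x s) - g (apply_bcontfun y s)"
    have i: "(\<lambda>s. g (apply_bcontfun z s)) integrable_on {-\<delta>..u}" for u z
      by (rule integrable_continuous_real[OF xc])
    have "P (apply_bcontfun x) t - P (apply_bcontfun y) t = integral {-\<delta>..c t} ?h - integral {-\<delta>..0} ?h"
      unfolding P_def by (simp add: integral_diff[OF i i])
    also have "norm \<dots> \<le> 3 * \<delta> * (L * dist x y)"
    proof (rule ib)
      show "continuous_on {-\<delta>..\<delta>} ?h" by (intro continuous_intros xc)
      show "norm (?h s) \<le> L * dist x y" for s
        using order_trans[OF gl[of "apply_bcontfun x s" "apply_bcontfun y s"] mult_left_mono[OF dist_bounded[of x s y] L0]]
        by (simp add: dist_norm)
    qed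
    also have "\<dots> = (3 * \<delta> * L) * dist x y" by simp
    also have "\<dots> \<le> 1/2 * dist x y" using \<delta>(2) by (intro mult_right_mono) auto
    finally show "dist (apply_bcontfun (Bcontfun (P (apply_bcontfun x))) t)
        (apply_bcontfun (Bcontfun (P (apply_bcontfun y))) t) \<le> 1/2 * dist x y"
      by (simp add: PB dist_norm)
  qed
  then obtain z :: "real \<Rightarrow>\<^sub>C 'a" where "Bcontfun (P (apply_bcontfun z)) = z"
    using banach_fix_type[of "1/2" "\<lambda>x :: real \<Rightarrow>\<^sub>C 'a. Bcontfun (P (apply_bcontfun x))"] by auto
  then have z: "apply_bcontfun z = P (apply_bcontfun z)" using PB by metis
  define x where "x = apply_bcontfun z"
  have xP: "x t = x0 + (integral {-\<delta>..c t} (\<lambda>s. g (x s)) - integral {-\<delta>..0} (\<lambda>s. g (x s)))" for t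
    using fun_cong[OF z, of t] unfolding P_def x_def .
  have xK: "x t \<in> ?K" for t
  proof -
    have "norm (x t - x0) \<le> 3 * \<delta> * M"
    proof -
      have "x t - x0 = integral {-\<delta>..c t} (\<lambda>s. g (x s)) - integral {-\<delta>..0} (\<lambda>s. g (x s))"
        using xP[of t] by (simp add: algebra_simps)
      then show ?thesis using ib[OF xc gM, of t z] by (simp add: x_def)
    qed
    then show ?thesis using \<delta>(3) by (simp add: dist_norm norm_minus_commute)
  qed
  have "(x has_vector_derivative f (x t)) (at t)" if t: "\<bar>t\<bar> < \<delta>" for t
  proof -
    have "((\<lambda>u. integral {-\<delta>..u} (\<lambda>s. g (x s))) has_vector_derivative g (x t)) (at t within {-\<delta>..\<delta>})"
      using t by (intro integral_has_vector_derivative) (auto simp: x_def xc)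
    then have "((\<lambda>u. integral {-\<delta>..u} (\<lambda>s. g (x s))) has_vector_derivative g (x t)) (at t)"
      using t at_within_Icc_at[of "-\<delta>" t \<delta>] by auto
    then have d: "((\<lambda>u. x0 + (integral {-\<delta>..u} (\<lambda>s. g (x s)) - integral {-\<delta>..0} (\<lambda>s. g (x s))))
       has_vector_derivative g (x t)) (at t)"
      by (auto intro!: derivative_eq_intros)
    have "(x has_vector_derivative g (x t)) (at t)"
    proof (rule has_vector_derivative_transform_within_open[OF d, of "{-\<delta><..<\<delta>}"])
      show "x0 + (integral {-\<delta>..u} (\<lambda>s. g (x s)) - integral {-\<delta>..0} (\<lambda>s. g (x s))) = x u"
        if "u \<in> {-\<delta><..<\<delta>}" for u
      proof -
        have "c u = u" using that by (auto simp: c_def)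
        then show ?thesis using xP[of u] by simp
      qed
    qed (use t in auto)
    moreover have "g (x t) = f (x t)" unfolding g_def by (simp add: closest_point_self[OF xK])
    ultimately show ?thesis by simp
  qed
  moreover have "x 0 = x0" using xP[of 0] \<delta>(1) by (simp add: c_def)
  ultimately show ?thesis using that[of \<delta> x] \<delta>(1) xK by blast
qed

section \<open>Simple roots of the characteristic polynomial\<close>

lemma det_map_matrix_pCons:
  fixes P :: "complex^'n^'n"
  shows "det (map_matrix (\<lambda>a. [:a:]) P) = [:det P:]"
proof -
  have p: "(\<Prod>i\<in>A. [:f i:]) = [:\<Prod>i\<in>A. f i:]" for A :: "'n set" and f :: "'n \<Rightarrow> complex"
    by (induction A rule: infinite_finite_induct) (auto simp: one_pCons)
  have s: "(\<Sum>i\<in>A. [:f i:]) = [:\<Sum>i\<in>A. f i:]" for A :: "('n \<Rightarrow> 'n) set" and f :: "('n \<Rightarrow> 'n) \<Rightarrow> complex"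
    by (induction A rule: infinite_finite_induct) auto
  have "of_int k * [:a:] = [:of_int k * a:]" for k and a :: complex
    by (simp add: of_int_poly)
  then show ?thesis unfolding det_def map_matrix_def by (simp add: p s)
qed

text \<open>Every term of the Leibniz expansion takes one factor from each of the two columns. The
  matrix is transposed because the product in \<open>det_def\<close> runs over rows.\<close>

lemma det_dvd_columns:
  fixes N :: "complex poly^'n^'n"
  assumes "i \<noteq> j" "\<And>r. q dvd N $ r $ i" "\<And>r. q dvd N $ r $ j"
  shows "q\<^sup>2 dvd det N"
proof -
  have "q\<^sup>2 dvd det (transpose N)"
    unfolding det_def
  proof (intro dvd_sum dvd_mult)
    fix p
    have "(\<Prod>k\<in>UNIV. transpose N $ k $ p k) =
        transpose N $ i $ p i * (transpose N $ j $ p j * (\<Prod>k\<in>UNIV - {i} - {j}. transpose N $ k $ p k))"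
      using assms(1) by (subst prod.remove[of _ i]) (auto simp: prod.remove[of _ j])
    then show "q\<^sup>2 dvd (\<Prod>k\<in>UNIV. transpose N $ k $ p k)"
      using assms(2,3) by (auto simp: transpose_def power2_eq_square intro!: mult_dvd_mono)
  qed
  then show ?thesis by simp
qed

lemma poly_charpoly: "poly (charpoly M) x = det (mat x - M)"
proof -
  have "poly (of_int k) x = of_int k" for k
    by (simp add: of_int_poly)
  then show ?thesis
    unfolding charpoly_def det_def
    by (simp add: poly_sum poly_prod map_matrix_def mat_def if_distrib[of "\<lambda>p. poly p x"] cong: if_cong)
qed

text \<open>A zero polynomial would make every number an eigenvalue. Comparing the largest component
  of an eigenvector bounds eigenvalues by the sum \<open>S\<close> of the norms of all entries, so
  \<open>S + 1\<close> is none. Nonvanishing is what ties the order of a root to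
  divisibility.\<close>

lemma charpoly_nonzero: "charpoly (M :: complex^'n^'n) \<noteq> 0"
proof
  assume 0: "charpoly M = 0"
  define S where "S = (\<Sum>i\<in>UNIV. \<Sum>k\<in>UNIV. norm (M $ i $ k))"
  let ?x = "complex_of_real (S + 1)"
  have "det (mat ?x - M) = 0" using poly_charpoly[of M ?x] 0 by simp
  then obtain w where w: "w \<noteq> 0" "(mat ?x - M) *v w = 0"
    by (metis invertible_det_nz invertible_left_inverse matrix_left_invertible_ker)
  define m where "m = Max (range (\<lambda>i. norm (w $ i)))"
  have m: "norm (w $ k) \<le> m" for k unfolding m_def by (rule Max_ge) auto
  have "m \<in> range (\<lambda>i. norm (w $ i))" unfolding m_def by (rule Max_in) auto
  then obtain i where i: "norm (w $ i) = m" by auto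
  have mp: "m > 0"
  proof -
    obtain k where "w $ k \<noteq> 0" using w(1) by (auto simp: vec_eq_iff)
    then show ?thesis using m[of k] by (smt (verit) zero_less_norm_iff)
  qed
  have "(mat ?x *v w) $ i = ?x * w $ i"
    by (simp add: matrix_vector_mult_def mat_def if_distrib[of "\<lambda>a. a * _"] cong: if_cong)
  then have "?x * w $ i = (M *v w) $ i" using w(2)
    by (simp add: matrix_vector_mult_diff_rdistrib vec_eq_iff)
  then have "norm (?x * w $ i) = norm ((M *v w) $ i)" by (rule arg_cong)
  then have "norm ?x * m = norm (\<Sum>k\<in>UNIV. M $ i $ k * w $ k)"
    by (simp only: norm_mult i matrix_vector_mult_def vec_lambda_beta)
  also have "\<dots> \<le> (\<Sum>k\<in>UNIV. norm (M $ i $ k) * m)"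
    by (rule sum_norm_le) (auto simp: norm_mult m mult_left_mono)
  also have "\<dots> = (\<Sum>k\<in>UNIV. norm (M $ i $ k)) * m" by (simp add: sum_distrib_right)
  also have "\<dots> \<le> S * m"
    unfolding S_def by (intro mult_right_mono member_le_sum) (use mp in \<open>auto intro: sum_nonneg\<close>)
  finally have "norm ?x \<le> S" using mp by simp
  then show False using norm_of_real[of "S + 1", where 'a=complex] by simp
qed

text \<open>If \<open>x\<close> and \<open>y\<close> span a plane of eigenvectors, replacing two columns of the identity matrix by them
  gives an invertible \<open>P\<close>, and two columns of \<open>(X I - M) P\<close> are divisible by \<open>X - \<mu>\<close>.\<close>

lemma simple_root_imp_eigenspace_1dim:
  fixes M :: "complex^'n^'n"
  assumes ord: "order \<mu> (charpoly M) = 1"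
    and x: "M *v x = \<mu> *s x" "x \<noteq> 0" and y: "M *v y = \<mu> *s y"
  obtains k where "y = k *s x"
proof -
  obtain i where i: "x $ i \<noteq> 0" using x(2) by (auto simp: vec_eq_iff)
  define k where "k = y $ i / x $ i"
  \<comment> \<open>Subtracting this multiple of \<open>x\<close> clears coordinate
    \<open>i\<close>, so a nonzero coordinate \<open>j\<close> of \<open>z\<close> must differ from
    \<open>i\<close>, and two distinct columns can be replaced.\<close>
  define z where "z = y - k *s x"
  have Mz: "M *v z = \<mu> *s z"
    unfolding z_def by (simp add: matrix_vector_mult_diff_distrib vector_scalar_commute x y vector_ssub_ldistrib)
  have zi: "z $ i = 0" using i by (simp add: z_def k_def)
  have "z = 0"
  proof (rule ccontr)
    assume "z \<noteq> 0"
    then obtain j where j: "z $ j \<noteq> 0" by (auto simp: vec_eq_iff)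
    have ij: "i \<noteq> j" using j zi by auto
    define P :: "complex^'n^'n" where
      "P = (\<chi> r c. if c = i then x $ r else if c = j then z $ r else if r = c then 1 else 0)"
    have Pc: "(P *v w) $ r = w $ i * x $ r + w $ j * z $ r + (if r = i \<or> r = j then 0 else w $ r)" for w r
    proof -
      have "(P *v w) $ r = (\<Sum>c\<in>UNIV. (if c = i then x $ r * w $ i else 0) + (if c = j then z $ r * w $ j else 0)
          + (if c = r then (if r = i \<or> r = j then 0 else w $ r) else 0))"
        unfolding matrix_vector_mult_def P_def using ij by (auto intro!: sum.cong)
      then show ?thesis by (simp add: sum.distrib mult.commute)
    qed
    \<comment> \<open>The system is triangular: row \<open>i\<close> involves only
      \<open>w $ i\<close> since \<open>z $ i = 0\<close>, then row \<open>j\<close> determines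
      \<open>w $ j\<close>, and the other rows determine the rest.\<close>
    have "w = 0" if "P *v w = 0" for w
    proof -
      have "w $ i = 0" using Pc[of w i] that zi i by simp
      moreover then have "w $ j = 0" using Pc[of w j] that j by simp
      ultimately have "w $ r = 0" for r using Pc[of w r] that by (cases "r = i \<or> r = j") auto
      then show ?thesis by (simp add: vec_eq_iff)
    qed
    then have "invertible P"
      by (metis invertible_left_inverse matrix_left_invertible_ker)
    then have dP: "det P \<noteq> 0" by (simp add: invertible_det_nz)
    let ?C = "mat [:0, 1:] - map_matrix (\<lambda>a. [:a:]) M :: complex poly^'n^'n"
    let ?P = "map_matrix (\<lambda>a. [:a:]) P :: complex poly^'n^'n"
    have col: "[:- \<mu>, 1:] dvd (?C ** ?P) $ r $ c"
      if w: "M *v w = \<mu> *s w" "\<And>r. P $ r $ c = w $ r" for r c w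
    proof -
      have s: "(\<Sum>i\<in>A. [:f i:]) = [:\<Sum>i\<in>A. f i:]" for A :: "'n set" and f :: "'n \<Rightarrow> complex"
        by (induction A rule: infinite_finite_induct) auto
      have "(?C ** ?P) $ r $ c = (\<Sum>k\<in>UNIV. (if k = r then [:0, 1:] * [:w $ r:] else 0) - [:M $ r $ k * w $ k:])"
        unfolding matrix_matrix_mult_def map_matrix_def mat_def
        by (auto simp: w intro!: sum.cong simp: algebra_simps)
      also have "\<dots> = [:0, 1:] * [:w $ r:] - [:(M *v w) $ r:]"
        by (simp add: sum_subtractf s matrix_vector_mult_def)
      also have "\<dots> = [:- \<mu>, 1:] * [:w $ r:]"
        by (simp add: w)
      finally show ?thesis by (rule dvdI)
    qed
    have "[:- \<mu>, 1:]\<^sup>2 dvd det (?C ** ?P)"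
      by (rule det_dvd_columns[OF ij]) (rule col[OF x(1)] col[OF Mz]; use ij in \<open>simp add: P_def\<close>)+
    then have "[:- \<mu>, 1:]\<^sup>2 dvd charpoly M * [:det P:]"
      by (simp add: det_mul charpoly_def det_map_matrix_pCons)
    moreover have "[:det P:] dvd 1" using dP by (simp add: is_unit_const_poly_iff dvd_field_iff)
    ultimately have "[:- \<mu>, 1:]\<^sup>2 dvd charpoly M"
      using dvd_mult_unit_iff by blast
    then show False using ord charpoly_nonzero[of M] order_divides[of \<mu> 2 "charpoly M"] by simp
  qed
  then show ?thesis using that[of k] by (simp add: z_def)
qed

lemma charpoly_transpose: "charpoly (transpose M) = charpoly M"
proof -
  have "mat [:0, 1:] - map_matrix (\<lambda>a. [:a:]) (transpose M)
      = transpose (mat [:0, 1:] - map_matrix (\<lambda>a. [:a:]) M)"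
    by (simp add: vec_eq_iff transpose_def mat_def map_matrix_def)
  then show ?thesis unfolding charpoly_def by (metis det_transpose)
qed

section \<open>Linear differential inequalities and symmetry of second derivatives\<close>

text \<open>Gronwall's argument: exp(-2 L t) |x|^2 is nonincreasing and starts at 0. It provides
  uniqueness for all linear initial value problems below.\<close>

lemma zero_if_vector_derivative_le_linear:
  fixes x :: "real \<Rightarrow> 'a::real_inner"
  assumes "\<And>t. t \<in> {0..T} \<Longrightarrow> (x has_vector_derivative x' t) (at t within {0..T})"
    and "\<And>t. t \<in> {0..T} \<Longrightarrow> norm (x' t) \<le> L * norm (x t)"
    and "x 0 = 0" and "t \<in> {0..T}"
  shows "x t = 0"
proof -
  let ?f = "\<lambda>s. exp (- 2 * L * s) * (x s \<bullet> x s)"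
  have d: "(?f has_real_derivative (exp (- 2 * L * s) * (2 * (x s \<bullet> x' s)) - 2 * L * exp (- 2 * L * s) * (x s \<bullet> x s)))
      (at s within {0..t})" if "s \<in> {0..t}" for s
  proof -
    have "(x has_vector_derivative x' s) (at s within {0..t})"
      using assms(1)[of s] assms(4) that by (auto intro: has_vector_derivative_within_subset)
    then have "((\<lambda>s. x s \<bullet> x s) has_real_derivative (2 * (x s \<bullet> x' s))) (at s within {0..t})"
      unfolding has_vector_derivative_def has_field_derivative_def
      by (auto intro!: derivative_eq_intros simp: inner_commute fun_eq_iff)
    then show ?thesis by (auto intro!: derivative_eq_intros simp: algebra_simps)
  qed
  let ?f' = "\<lambda>s. exp (- 2 * L * s) * (2 * (x s \<bullet> x' s)) - 2 * L * exp (- 2 * L * s) * (x s \<bullet> x s)"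
  have neg: "?f' s \<le> 0" if s: "s \<in> {0..t}" for s
  proof -
    have "x s \<bullet> x' s \<le> norm (x s) * norm (x' s)" by (rule norm_cauchy_schwarz)
    also have "\<dots> \<le> norm (x s) * (L * norm (x s))"
      using assms(2)[of s] assms(4) s by (intro mult_left_mono) auto
    also have "\<dots> = L * (x s \<bullet> x s)" by (simp add: power2_norm_eq_inner[symmetric] power2_eq_square)
    finally have "exp (- 2 * L * s) * (2 * (x s \<bullet> x' s)) \<le> exp (- 2 * L * s) * (2 * (L * (x s \<bullet> x s)))"
      by (intro mult_left_mono) auto
    then show ?thesis by (simp add: algebra_simps)
  qed
  have "\<exists>s\<in>{0..t}. ?f t - ?f 0 = ?f' s * (t - 0)"
    using assms(4) d by (intro mvt_very_simple) (auto simp: has_field_derivative_def)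
  then have "?f t \<le> ?f 0"
    using neg assms(4) by (smt (verit) atLeastAtMost_iff mult_nonpos_nonneg)
  then have "x t \<bullet> x t \<le> 0" using assms(3) by (simp add: mult_le_0_iff)
  then show ?thesis by (metis inner_eq_zero_iff inner_ge_zero order_antisym)
qed

text \<open>Both iterated derivatives are limits of the second difference quotient at \<open>x\<close> in the directions
  \<open>u\<close> and \<open>w\<close>, which is symmetric in \<open>u\<close> and \<open>w\<close>.\<close>

lemma C2_second_difference:
  fixes f :: "'a::real_normed_vector \<Rightarrow> real"
  assumes "Ck_on 2 UNIV f" "s > 0"
  obtains a b where "0 \<le> a" "a \<le> s" "0 \<le> b" "b \<le> s"
    "(f (x + s *\<^sub>R u + s *\<^sub>R w) - f (x + s *\<^sub>R u) - f (x + s *\<^sub>R w) + f x) / s\<^sup>2 =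
     frechet_derivative (\<lambda>y. frechet_derivative f (at y) u) (at (x + a *\<^sub>R u + b *\<^sub>R w)) w"
proof -
  let ?D = "\<lambda>g z. frechet_derivative g (at z)"
  let ?g = "\<lambda>y. ?D f y u"
  have f: "(f has_derivative ?D f z) (at z)" and g: "(?g has_derivative ?D ?g z) (at z)" for z
    using assms(1) by (auto simp: eval_nat_numeral frechet_derivative_works[symmetric])
  have lin: "linear (?D f z)" "linear (?D ?g z)" for z
    using f g has_derivative_linear by blast+
  let ?\<phi> = "\<lambda>t. f (x + s *\<^sub>R w + t *\<^sub>R u) - f (x + t *\<^sub>R u)"
  have d1: "((\<lambda>t. f (z + t *\<^sub>R u)) has_derivative (\<lambda>h. ?D f (z + t *\<^sub>R u) (h *\<^sub>R u))) (at t)" for z t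
    by (rule has_derivative_compose[where f="\<lambda>t. z + t *\<^sub>R u", OF _ f]) (auto intro!: derivative_eq_intros)
  have d2: "((\<lambda>t. ?g (z + t *\<^sub>R w)) has_derivative (\<lambda>h. ?D ?g (z + t *\<^sub>R w) (h *\<^sub>R w))) (at t)" for z t
    by (rule has_derivative_compose[where f="\<lambda>t. z + t *\<^sub>R w", OF _ g]) (auto intro!: derivative_eq_intros)
  \<comment> \<open>The second difference is an increment of \<open>?\<phi>\<close> in direction
    \<open>u\<close>. A mean value step for it produces an increment of the derivative in direction
    \<open>w\<close>, to which a second mean value step applies.\<close>
  have "\<exists>a\<in>{0..s}. ?\<phi> s - ?\<phi> 0 = ?D f (x + s *\<^sub>R w + a *\<^sub>R u) ((s - 0) *\<^sub>R u) - ?D f (x + a *\<^sub>R u) ((s - 0) *\<^sub>R u)"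
  proof (rule mvt_very_simple[of 0 s ?\<phi> "\<lambda>t h. ?D f (x + s *\<^sub>R w + t *\<^sub>R u) (h *\<^sub>R u) - ?D f (x + t *\<^sub>R u) (h *\<^sub>R u)"])
    show "(?\<phi> has_derivative (\<lambda>h. ?D f (x + s *\<^sub>R w + t *\<^sub>R u) (h *\<^sub>R u) - ?D f (x + t *\<^sub>R u) (h *\<^sub>R u)))
        (at t within {0..s})" for t
      by (rule has_derivative_at_withinI[OF has_derivative_diff[OF d1 d1]])
  qed (use assms(2) in simp)
  then obtain a where a: "a \<in> {0..s}"
    and a0: "?\<phi> s - ?\<phi> 0 = ?D f (x + s *\<^sub>R w + a *\<^sub>R u) (s *\<^sub>R u) - ?D f (x + a *\<^sub>R u) (s *\<^sub>R u)"
    by (simp only: diff_0_right) blast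
  have sw: "x + s *\<^sub>R w + a *\<^sub>R u = x + a *\<^sub>R u + s *\<^sub>R w" "x + s *\<^sub>R w + s *\<^sub>R u = x + s *\<^sub>R u + s *\<^sub>R w"
    by (simp_all only: ac_simps)
  have a': "?\<phi> s - ?\<phi> 0 = s * (?g (x + a *\<^sub>R u + s *\<^sub>R w) - ?g (x + a *\<^sub>R u))"
    using a0 unfolding linear_cmul[OF lin(1)] sw(1) by (simp only: real_scaleR_def right_diff_distrib)
  have "\<exists>b\<in>{0..s}. ?g (x + a *\<^sub>R u + s *\<^sub>R w) - ?g (x + a *\<^sub>R u + 0 *\<^sub>R w) = ?D ?g (x + a *\<^sub>R u + b *\<^sub>R w) ((s - 0) *\<^sub>R w)"
    using assms(2)
    by (intro mvt_very_simple[of 0 s "\<lambda>t. ?g (x + a *\<^sub>R u + t *\<^sub>R w)"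
          "\<lambda>t h. ?D ?g (x + a *\<^sub>R u + t *\<^sub>R w) (h *\<^sub>R w)"] has_derivative_at_withinI[OF d2]) auto
  then obtain b where b: "b \<in> {0..s}"
    and b0: "?g (x + a *\<^sub>R u + s *\<^sub>R w) - ?g (x + a *\<^sub>R u) = ?D ?g (x + a *\<^sub>R u + b *\<^sub>R w) (s *\<^sub>R w)"
    by (simp only: diff_0_right scaleR_zero_left add_0_right) blast
  have b': "?g (x + a *\<^sub>R u + s *\<^sub>R w) - ?g (x + a *\<^sub>R u) = s * ?D ?g (x + a *\<^sub>R u + b *\<^sub>R w) w"
    using b0 unfolding linear_cmul[OF lin(2)] by (simp only: real_scaleR_def)
  have "f (x + s *\<^sub>R u + s *\<^sub>R w) - f (x + s *\<^sub>R u) - f (x + s *\<^sub>R w) + f x = ?\<phi> s - ?\<phi> 0"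
    unfolding sw(2) by simp
  also have "\<dots> = s\<^sup>2 * ?D ?g (x + a *\<^sub>R u + b *\<^sub>R w) w"
    unfolding a' b' by (simp add: power2_eq_square)
  finally have eq: "f (x + s *\<^sub>R u + s *\<^sub>R w) - f (x + s *\<^sub>R u) - f (x + s *\<^sub>R w) + f x
      = s\<^sup>2 * ?D ?g (x + a *\<^sub>R u + b *\<^sub>R w) w" .
  have "s\<^sup>2 \<noteq> 0" using assms(2) by simp
  then have "(f (x + s *\<^sub>R u + s *\<^sub>R w) - f (x + s *\<^sub>R u) - f (x + s *\<^sub>R w) + f x) / s\<^sup>2 = ?D ?g (x + a *\<^sub>R u + b *\<^sub>R w) w"
    unfolding eq by (rule nonzero_mult_div_cancel_left)
  then show ?thesis using that[of a b] a b by simp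
qed

lemma frechet_derivative_commute_real:
  fixes f :: "'a::real_normed_vector \<Rightarrow> real"
  assumes f: "Ck_on 2 UNIV f"
  shows "frechet_derivative (\<lambda>y. frechet_derivative f (at y) u) (at x) w =
         frechet_derivative (\<lambda>y. frechet_derivative f (at y) w) (at x) u"
proof -
  let ?E = "\<lambda>u w z. frechet_derivative (\<lambda>y. frechet_derivative f (at y) u) (at z) w"
  let ?s = "\<lambda>n. inverse (real (Suc n))"
  let ?Q = "\<lambda>n. (f (x + ?s n *\<^sub>R u + ?s n *\<^sub>R w) - f (x + ?s n *\<^sub>R u) - f (x + ?s n *\<^sub>R w) + f x) / (?s n)\<^sup>2"
  have lim: "(\<lambda>n. (f (x + ?s n *\<^sub>R u + ?s n *\<^sub>R w) - f (x + ?s n *\<^sub>R u) - f (x + ?s n *\<^sub>R w) + f x) / (?s n)\<^sup>2)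
      \<longlonglongrightarrow> ?E u w x" for u w
  proof -
    have cont: "continuous_on UNIV (?E u w)"
      using f by (simp add: eval_nat_numeral)
    have "\<exists>a b. 0 \<le> a \<and> a \<le> ?s n \<and> 0 \<le> b \<and> b \<le> ?s n \<and>
        (f (x + ?s n *\<^sub>R u + ?s n *\<^sub>R w) - f (x + ?s n *\<^sub>R u) - f (x + ?s n *\<^sub>R w) + f x) / (?s n)\<^sup>2 = ?E u w (x + a *\<^sub>R u + b *\<^sub>R w)" for n
      by (rule C2_second_difference[OF f, of "?s n" x u w], simp only: inverse_positive_iff_positive of_nat_0_less_iff zero_less_Suc) blast
    then obtain a b where ab: "\<And>n. 0 \<le> a n \<and> a n \<le> ?s n \<and> 0 \<le> b n \<and> b n \<le> ?s n"
      and eq: "\<And>n. (f (x + ?s n *\<^sub>R u + ?s n *\<^sub>R w) - f (x + ?s n *\<^sub>R u) - f (x + ?s n *\<^sub>R w) + f x) / (?s n)\<^sup>2 = ?E u w (x + a n *\<^sub>R u + b n *\<^sub>R w)"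
      by metis
    have "a \<longlonglongrightarrow> 0"
      by (rule tendsto_sandwich[OF _ _ tendsto_const LIMSEQ_inverse_real_of_nat]) (intro always_eventually allI conjunct1[OF ab] conjunct1[OF conjunct2[OF ab]])+
    moreover have "b \<longlonglongrightarrow> 0"
      by (rule tendsto_sandwich[OF _ _ tendsto_const LIMSEQ_inverse_real_of_nat])
        (intro always_eventually allI conjunct1[OF conjunct2[OF conjunct2[OF ab]]] conjunct2[OF conjunct2[OF conjunct2[OF ab]]])+
    ultimately have "(\<lambda>n. x + a n *\<^sub>R u + b n *\<^sub>R w) \<longlonglongrightarrow> x + 0 *\<^sub>R u + 0 *\<^sub>R w"
      by (intro tendsto_intros)
    then have "(\<lambda>n. ?E u w (x + a n *\<^sub>R u + b n *\<^sub>R w)) \<longlonglongrightarrow> ?E u w x"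
      using continuous_on_tendsto_compose[OF cont] by simp
    then show ?thesis unfolding eq .
  qed
  have "(\<lambda>n. (f (x + ?s n *\<^sub>R w + ?s n *\<^sub>R u) - f (x + ?s n *\<^sub>R w) - f (x + ?s n *\<^sub>R u) + f x) / (?s n)\<^sup>2) = ?Q"
  proof (rule ext)
    fix n
    have e: "x + ?s n *\<^sub>R w + ?s n *\<^sub>R u = x + ?s n *\<^sub>R u + ?s n *\<^sub>R w"
      by (simp only: ac_simps)
    have "f (x + ?s n *\<^sub>R w + ?s n *\<^sub>R u) - f (x + ?s n *\<^sub>R w) - f (x + ?s n *\<^sub>R u) + f x =
        f (x + ?s n *\<^sub>R u + ?s n *\<^sub>R w) - f (x + ?s n *\<^sub>R u) - f (x + ?s n *\<^sub>R w) + f x"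
      unfolding e by linarith
    then show "(f (x + ?s n *\<^sub>R w + ?s n *\<^sub>R u) - f (x + ?s n *\<^sub>R w) - f (x + ?s n *\<^sub>R u) + f x) / (?s n)\<^sup>2 = ?Q n"
      by (rule arg_cong)
  qed
  then have "?Q \<longlonglongrightarrow> ?E w u x" using lim[of w u] by (simp only:)
  then show ?thesis using LIMSEQ_unique[OF lim[of u w]] by blast
qed

lemma frechet_derivative_component:
  fixes f :: "'a::real_normed_vector \<Rightarrow> real^'m"
  assumes "f differentiable (at x)"
  shows "frechet_derivative (\<lambda>y. f y $ i) (at x) w = frechet_derivative f (at x) w $ i"
proof -
  have "((\<lambda>y. f y $ i) has_derivative (\<lambda>w. frechet_derivative f (at x) w $ i)) (at x)"
    using assms bounded_linear.has_derivative[OF bounded_linear_vec_nth] frechet_derivative_works by blast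
  then show ?thesis using frechet_derivative_at by metis
qed

text \<open>The symmetry is transferred one component at a time, because exact mean value points
  exist only for real-valued functions.\<close>

lemma partial_commute:
  fixes G :: "real^'n \<Rightarrow> real^'m"
  assumes "Ck_on 2 UNIV G"
  shows "partial j (partial k G) = partial k (partial j G)"
proof -
  have d: "G differentiable (at x)" "(\<lambda>y. frechet_derivative G (at y) u) differentiable (at x)" for x u
    using assms by (auto simp: eval_nat_numeral)
  have "partial j (partial k G) x $ i = partial k (partial j G) x $ i" for x i
  proof -
    have C: "Ck_on 2 UNIV (\<lambda>y. G y $ i)"
      by (rule Ck_on_linear_compose[OF _ bounded_linear_vec_nth assms]) auto
    have "partial j' (partial k' G) x $ i =
        frechet_derivative (\<lambda>y. frechet_derivative (\<lambda>y. G y $ i) (at y) (axis k' 1)) (at x) (axis j' 1)" for j' k'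
      unfolding partial_def by (simp add: frechet_derivative_component d)
    then show ?thesis using frechet_derivative_commute_real[OF C] by simp
  qed
  then show ?thesis by (auto simp: vec_eq_iff)
qed

section \<open>Complexified derivatives and Taylor expansion\<close>

lemma norm_vector_smult: "norm (c *s (x :: complex^'n)) = norm c * norm x"
  by (simp add: norm_vec_def L2_set_def norm_mult power_mult_distrib sum_distrib_left[symmetric] real_sqrt_mult)

lemma scaleR_eq_smult: "r *\<^sub>R (x :: complex^'n) = of_real r *s x"
  by (simp add: vec_eq_iff) (simp add: scaleR_conv_of_real)

lemma bounded_bilinear_smult: "bounded_bilinear ((*s) :: complex \<Rightarrow> complex^'n \<Rightarrow> complex^'n)"
  by standard (auto simp: scaleR_eq_smult scaleR_conv_of_real[where 'a=complex] algebra_simps norm_vector_smult vector_add_ldistrib vector_sadd_rdistrib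
      intro!: exI[of _ 1])

lemma norm_cvec: "norm (cvec x) = norm x"
  by (simp add: cvec_def norm_vec_def)

lemma norm_cnj_vec: "norm (cnj_vec x) = norm x"
  by (simp add: cnj_vec_def norm_vec_def)

lemma bounded_linear_cvec: "bounded_linear cvec"
  by (rule bounded_linear_intro[of _ 1]) (auto simp: norm_cvec, auto simp: cvec_def vec_eq_iff scaleR_conv_of_real[where 'a=complex])

lemma bounded_linear_cnj_vec: "bounded_linear cnj_vec"
  by (rule bounded_linear_intro[of _ 1]) (auto simp: norm_cnj_vec, auto simp: cnj_vec_def vec_eq_iff)

lemma bounded_linear_Re_vec: "bounded_linear Re_vec"
proof (rule bounded_linear_intro[of _ 1])
  show "norm (Re_vec x) \<le> norm x * 1" for x :: "complex^'n"
    unfolding norm_vec_def by (auto simp: Re_vec_def intro!: L2_set_mono abs_Re_le_cmod)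
qed (auto simp: Re_vec_def vec_eq_iff)

lemma cnj_vec_smult: "cnj_vec (c *s x) = cnj c *s cnj_vec x"
  by (simp add: cnj_vec_def vec_eq_iff)

lemma cnj_vec_cnj_vec [simp]: "cnj_vec (cnj_vec x) = x"
  by (simp add: cnj_vec_def vec_eq_iff)

lemma cnj_vec_add: "cnj_vec (x + y) = cnj_vec x + cnj_vec y"
  and cnj_vec_diff: "cnj_vec (x - y) = cnj_vec x - cnj_vec y"
  by (simp_all add: cnj_vec_def vec_eq_iff)

lemma cnj_vec_cvec [simp]: "cnj_vec (cvec x) = cvec x"
  by (simp add: cnj_vec_def cvec_def vec_eq_iff)

lemma cvec_Re_vec: "cnj_vec z = z \<Longrightarrow> cvec (Re_vec z) = z"
  by (simp add: cnj_vec_def cvec_def Re_vec_def vec_eq_iff complex_eq_iff)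

section \<open>Multilinearity, symmetry and size of the derivative forms\<close>

lemma formB_add_left: "formB F x (p + p') q = formB F x p q + formB F x p' q"
  and formB_add_right: "formB F x p (q + q') = formB F x p q + formB F x p q'"
  by (simp_all add: formB_def sum.distrib algebra_simps vector_sadd_rdistrib)

lemma formB_diff_left: "formB F x (p - p') q = formB F x p q - formB F x p' q"
  and formB_diff_right: "formB F x p (q - q') = formB F x p q - formB F x p q'"
  by (simp_all add: formB_def sum_subtractf algebra_simps vector_ssub_ldistrib vector_sub_rdistrib)

lemma smult_sum_right: "c *s (\<Sum>i\<in>A. f i) = (\<Sum>i\<in>A. c *s f i)"
  for f :: "'i \<Rightarrow> complex^'n"
  by (induction A rule: infinite_finite_induct) (auto simp: vector_add_ldistrib)

lemma formB_smult_left: "formB F x (a *s p) q = a *s formB F x p q"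
  and formB_smult_right: "formB F x p (a *s q) = a *s formB F x p q"
  by (simp_all add: formB_def smult_sum_right vector_smult_assoc ac_simps)

lemma formC_add1: "formC F x (p + p') q s = formC F x p q s + formC F x p' q s"
  and formC_add2: "formC F x p (q + q') s = formC F x p q s + formC F x p q' s"
  and formC_add3: "formC F x p q (s + s') = formC F x p q s + formC F x p q s'"
  by (simp_all add: formC_def sum.distrib algebra_simps vector_sadd_rdistrib)

lemma formC_smult1: "formC F x (a *s p) q s = a *s formC F x p q s"
  and formC_smult2: "formC F x p (a *s q) s = a *s formC F x p q s"
  and formC_smult3: "formC F x p q (a *s s) = a *s formC F x p q s"
  by (simp_all add: formC_def smult_sum_right vector_smult_assoc ac_simps)

lemma formB_commute:
  assumes "Ck_on 2 UNIV F"
  shows "formB F x p q = formB F x q p"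
  unfolding formB_def partial_commute[OF assms]
  by (subst sum.swap) (simp add: mult.commute partial_commute[OF assms])

lemma Ck_on_partial: "Ck_on (Suc k) UNIV F \<Longrightarrow> Ck_on k UNIV (partial j F)"
  by (simp add: partial_def[abs_def])

text \<open>The two outer derivatives act on \<open>partial l F\<close>, which is still of class
  C^2. Together with the exchange of the two inner ones this generates all permutations of the
  arguments.\<close>

lemma formC_commute12:
  assumes "Ck_on 3 UNIV F"
  shows "formC F x p q s = formC F x q p s"
proof -
  have "Ck_on 2 UNIV (partial l F)" for l
    by (rule Ck_on_partial) (use assms in \<open>simp add: eval_nat_numeral\<close>)
  then have c: "partial j (partial k (partial l F)) = partial k (partial j (partial l F))" for j k l
    by (rule partial_commute)
  show ?thesis unfolding formC_def
    by (subst sum.swap) (simp add: ac_simps c)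
qed

lemma formC_commute23:
  assumes "Ck_on 3 UNIV F"
  shows "formC F x p q s = formC F x p s q"
proof -
  have "Ck_on 2 UNIV F" by (rule Ck_on_mono[OF _ assms]) simp
  then have c: "partial k (partial l F) = partial l (partial k F)" for k l
    by (rule partial_commute)
  have "(\<Sum>k\<in>UNIV. \<Sum>l\<in>UNIV. (p $ j * q $ k * s $ l) *s cvec (partial j (partial k (partial l F)) x)) =
      (\<Sum>k\<in>UNIV. \<Sum>l\<in>UNIV. (p $ j * s $ k * q $ l) *s cvec (partial j (partial k (partial l F)) x))" for j
    by (subst sum.swap) (simp add: ac_simps c)
  then show ?thesis unfolding formC_def by simp
qed

lemma norm_formB_le:
  "norm (formB F x p q) \<le> (\<Sum>j\<in>UNIV. \<Sum>k\<in>UNIV. norm (partial j (partial k F) x)) * (norm p * norm q)"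
  unfolding formB_def sum_distrib_right
proof (intro sum_norm_le)
  fix j k
  have "norm ((p $ j * q $ k) *s cvec (partial j (partial k F) x))
      = norm (partial j (partial k F) x) * (norm (p $ j) * norm (q $ k))"
    by (simp add: norm_vector_smult norm_mult norm_cvec)
  also have "\<dots> \<le> norm (partial j (partial k F) x) * (norm p * norm q)"
    by (intro mult_left_mono mult_mono Finite_Cartesian_Product.norm_nth_le) auto
  finally show "norm ((p $ j * q $ k) *s cvec (partial j (partial k F) x))
      \<le> norm (partial j (partial k F) x) * (norm p * norm q)" .
qed

lemma norm_formC_le:
  "norm (formC F x p q s) \<le>
    (\<Sum>j\<in>UNIV. \<Sum>k\<in>UNIV. \<Sum>l\<in>UNIV. norm (partial j (partial k (partial l F)) x)) * (norm p * norm q * norm s)"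
  unfolding formC_def sum_distrib_right
proof (intro sum_norm_le)
  fix j k l
  have "norm ((p $ j * q $ k * s $ l) *s cvec (partial j (partial k (partial l F)) x))
      = norm (partial j (partial k (partial l F)) x) * (norm (p $ j) * norm (q $ k) * norm (s $ l))"
    by (simp add: norm_vector_smult norm_mult norm_cvec)
  also have "\<dots> \<le> norm (partial j (partial k (partial l F)) x) * (norm p * norm q * norm s)"
    by (intro mult_left_mono mult_mono Finite_Cartesian_Product.norm_nth_le) auto
  finally show "norm ((p $ j * q $ k * s $ l) *s cvec (partial j (partial k (partial l F)) x))
      \<le> norm (partial j (partial k (partial l F)) x) * (norm p * norm q * norm s)" .
qed

lemma norm_matrix_vector_le:
  fixes M :: "complex^'n^'n"
  shows "norm (M *v x) \<le> (\<Sum>i\<in>UNIV. \<Sum>j\<in>UNIV. norm (M $ i $ j)) * norm x"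
proof -
  have "norm (M *v x) \<le> (\<Sum>i\<in>UNIV. norm ((M *v x) $ i))"
    unfolding norm_vec_def by (rule L2_set_le_sum) simp
  also have "\<dots> \<le> (\<Sum>i\<in>UNIV. \<Sum>j\<in>UNIV. norm (M $ i $ j) * norm x)"
    unfolding matrix_vector_mult_def
    by (auto intro!: sum_mono sum_norm_le mult_left_mono Finite_Cartesian_Product.norm_nth_le simp: norm_mult)
  finally show ?thesis by (simp add: sum_distrib_right)
qed

lemma formA_cvec:
  assumes "F differentiable (at x)"
  shows "formA F x *v cvec y = cvec (frechet_derivative F (at x) y)"
proof -
  have "formA F x *v cvec y = cvec (jacobian F (at x) *v y)"
    by (simp add: formA_def cmat_def map_matrix_def cvec_def matrix_vector_mult_def vec_eq_iff)
  also have "jacobian F (at x) *v y = frechet_derivative F (at x) y"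
    using assms frechet_derivative_at jacobian_works by metis
  finally show ?thesis .
qed

section \<open>Iterated directional derivatives and Taylor's formula\<close>

definition dird :: "'a::real_normed_vector \<Rightarrow> ('a \<Rightarrow> 'b::real_normed_vector) \<Rightarrow> 'a \<Rightarrow> 'b" where
  "dird y f x = frechet_derivative f (at x) y"

lemma Ck_on_dird: "Ck_on (Suc k) S f \<Longrightarrow> Ck_on k S (dird y f)"
  by (simp add: dird_def[abs_def])

lemma Ck_on_dird_pow: "Ck_on (m + k) S f \<Longrightarrow> Ck_on k S ((dird y ^^ m) f)"
proof (induction m arbitrary: k)
  case (Suc m)
  then have "Ck_on (Suc k) S ((dird y ^^ m) f)" by (simp only: add_Suc add_Suc_right)
  then show ?case by (simp only: funpow.simps o_apply) (rule Ck_on_dird)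
qed simp

lemma Ck_on_Suc_differentiable: "Ck_on (Suc k) S f \<Longrightarrow> x \<in> S \<Longrightarrow> f differentiable (at x)"
  by simp

lemma dird_sum:
  assumes "\<And>k. k \<in> A \<Longrightarrow> G k differentiable (at x)"
  shows "dird y (\<lambda>x. \<Sum>k\<in>A. a k *\<^sub>R G k x) x = (\<Sum>k\<in>A. a k *\<^sub>R dird y (G k) x)"
proof -
  have "((\<lambda>x. \<Sum>k\<in>A. a k *\<^sub>R G k x) has_derivative (\<lambda>w. \<Sum>k\<in>A. a k *\<^sub>R frechet_derivative (G k) (at x) w)) (at x)"
    using assms frechet_derivative_works by (intro has_derivative_sum has_derivative_scaleR_right) blast
  from fun_cong[OF frechet_derivative_at[OF this], of y] show ?thesis unfolding dird_def by (rule sym)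
qed

lemma dird_pow_sum:
  assumes "\<And>k. k \<in> A \<Longrightarrow> Ck_on m UNIV (G k)"
  shows "(dird y ^^ m) (\<lambda>x. \<Sum>k\<in>A. a k *\<^sub>R G k x) = (\<lambda>x. \<Sum>k\<in>A. a k *\<^sub>R (dird y ^^ m) (G k) x)"
  using assms
proof (induction m arbitrary: G)
  case (Suc m)
  have "dird y (\<lambda>x. \<Sum>k\<in>A. a k *\<^sub>R G k x) = (\<lambda>x. \<Sum>k\<in>A. a k *\<^sub>R dird y (G k) x)"
    using Suc.prems by (intro ext dird_sum) auto
  moreover have "Ck_on m UNIV (dird y (G k))" if "k \<in> A" for k
    using Suc.prems that by (blast intro: Ck_on_dird)
  ultimately show ?case using Suc.IH[of "\<lambda>k. dird y (G k)"] by (simp add: funpow_swap1)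
qed simp

lemma dird_eq_sum_partial:
  fixes F :: "real^'n \<Rightarrow> real^'m"
  assumes "F differentiable (at x)"
  shows "dird y F x = (\<Sum>k\<in>UNIV. y $ k *\<^sub>R partial k F x)"
proof -
  have lin: "linear (frechet_derivative F (at x))" using assms by (rule linear_frechet_derivative)
  have "frechet_derivative F (at x) y = frechet_derivative F (at x) (\<Sum>k\<in>UNIV. y $ k *\<^sub>R axis k 1)"
    by (simp only: basis_expansion[of y, unfolded scalar_mult_eq_scaleR])
  then show ?thesis unfolding dird_def partial_def by (simp add: linear_sum[OF lin] linear_cmul[OF lin])
qed

text \<open>The innermost derivative is expanded in partial derivatives. Its coefficients
  \<open>y $ k\<close> do not depend on the point, so the outer iterates pass through the sum; this
  recursion links iterated directional derivatives to \<open>formB\<close> and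
  \<open>formC\<close>.\<close>

lemma dird_pow_Suc:
  fixes F :: "real^'n \<Rightarrow> real^'m"
  assumes "Ck_on (Suc m) UNIV F"
  shows "(dird y ^^ Suc m) F x = (\<Sum>k\<in>UNIV. y $ k *\<^sub>R (dird y ^^ m) (partial k F) x)"
proof -
  have "dird y F = (\<lambda>x. \<Sum>k\<in>UNIV. y $ k *\<^sub>R partial k F x)"
    using assms by (intro ext dird_eq_sum_partial) auto
  then have "(dird y ^^ Suc m) F = (dird y ^^ m) (\<lambda>x. \<Sum>k\<in>UNIV. y $ k *\<^sub>R partial k F x)"
    by (simp add: funpow_swap1)
  then show ?thesis using dird_pow_sum[of UNIV m "\<lambda>k. partial k F" y "\<lambda>k. y $ k"] Ck_on_partial[OF assms] by simp
qed

text \<open>Each peeled-off partial derivative costs one factor \<open>norm y\<close>, so the bound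
  is homogeneous in \<open>y\<close> and holds for all directions at once.\<close>

lemma dird_pow_bound:
  fixes F :: "real^'n \<Rightarrow> real^'m"
  assumes "Ck_on m UNIV F" "compact K"
  shows "\<exists>M. \<forall>x\<in>K. \<forall>y. norm ((dird y ^^ m) F x) \<le> M * norm y ^ m"
  using assms(1)
proof (induction m arbitrary: F)
  case 0
  then have "compact (F ` K)"
    using assms(2) by (intro compact_continuous_image) (auto intro: continuous_on_subset)
  then have "bounded (F ` K)" by (rule compact_imp_bounded)
  then show ?case by (auto simp: bounded_iff)
next
  case (Suc m)
  have "\<exists>M. \<forall>x\<in>K. \<forall>y. norm ((dird y ^^ m) (partial k F) x) \<le> M * norm y ^ m" for k
    using Suc.IH Ck_on_partial[OF Suc.prems] by blast
  then obtain M where M: "\<And>k x y. x \<in> K \<Longrightarrow> norm ((dird y ^^ m) (partial k F) x) \<le> M k * norm y ^ m" by metis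
  have "norm ((dird y ^^ Suc m) F x) \<le> (\<Sum>k\<in>UNIV. M k) * norm y ^ Suc m" if "x \<in> K" for x y
  proof -
    have "norm ((dird y ^^ Suc m) F x) \<le> (\<Sum>k\<in>UNIV. norm y * (M k * norm y ^ m))"
      unfolding dird_pow_Suc[OF Suc.prems]
    proof (rule sum_norm_le)
      fix k
      show "norm (y $ k *\<^sub>R (dird y ^^ m) (partial k F) x) \<le> norm y * (M k * norm y ^ m)"
        unfolding norm_scaleR
        by (intro mult_mono M that component_le_norm_cart) auto
    qed
    then show ?thesis by (simp add: sum_distrib_left sum_distrib_right ac_simps)
  qed
  then show ?case by blast
qed

text \<open>Iterating this, the powers of \<open>dird y\<close> are the successive derivatives of
  the one-variable function s \<mapsto> F (x + s y), as the Maclaurin formula requires.\<close>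

lemma has_real_derivative_dird_component:
  fixes F :: "real^'n \<Rightarrow> real^'m"
  assumes "\<And>x. F differentiable (at x)"
  shows "((\<lambda>s. F (x + s *\<^sub>R y) $ i) has_real_derivative dird y F (x + s *\<^sub>R y) $ i) (at s)"
proof -
  let ?D = "frechet_derivative F (at (x + s *\<^sub>R y))"
  have F: "(F has_derivative ?D) (at (x + s *\<^sub>R y))"
    using assms frechet_derivative_works by blast
  have "((\<lambda>s. F (x + s *\<^sub>R y)) has_derivative (\<lambda>h. ?D (h *\<^sub>R y))) (at s)"
    by (rule has_derivative_compose[where f="\<lambda>s. x + s *\<^sub>R y", OF _ F]) (auto intro!: derivative_eq_intros)
  then have "((\<lambda>s. F (x + s *\<^sub>R y) $ i) has_derivative (\<lambda>h. ?D (h *\<^sub>R y) $ i)) (at s)"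
    by (rule bounded_linear.has_derivative[OF bounded_linear_vec_nth])
  moreover have "(\<lambda>h. ?D (h *\<^sub>R y) $ i) = (*) (?D y $ i)"
    by (auto simp: linear_cmul[OF has_derivative_linear[OF F]])
  ultimately show ?thesis by (simp add: has_field_derivative_def dird_def)
qed

text \<open>Maclaurin's formula with Lagrange remainder is applied to each component along the
  segment from \<open>x\<close> to \<open>x + y\<close>; the constant is uniform because the fourth
  directional derivatives are bounded on a compact set containing all these segments.\<close>

lemma taylor3:
  fixes F :: "real^'n \<Rightarrow> real^'n"
  assumes F: "Ck_on 4 UNIV F" and K: "compact K"
  obtains M where "M \<ge> 0" "\<And>x y. x \<in> K \<Longrightarrow> norm y \<le> 1 \<Longrightarrow>
    norm (cvec (F (x + y)) - (cvec (F x) + formA F x *v cvec y + (1/2) *\<^sub>R formB F x (cvec y) (cvec y)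
      + (1/6) *\<^sub>R formC F x (cvec y) (cvec y) (cvec y))) \<le> M * norm y ^ 4"
proof -
  \<comment> \<open>Thickening by the closed unit ball keeps the intermediate points
    \<open>x + t y\<close> of the Lagrange remainder in a compact set.\<close>
  let ?K = "{x + y |x y. x \<in> K \<and> y \<in> cball 0 1}"
  have "compact ?K" by (rule compact_sums[OF K]) simp
  from dird_pow_bound[OF F this] obtain M where "\<forall>x\<in>?K. \<forall>y. norm ((dird y ^^ 4) F x) \<le> M * norm y ^ 4" ..
  then have M: "norm ((dird y ^^ 4) F x) \<le> M * norm y ^ 4" if "x \<in> ?K" for x y using that by blast
  have four: "(4::nat) = Suc (Suc (Suc (Suc 0)))" by simp
  have C: "Ck_on (Suc (Suc (Suc (Suc 0)))) UNIV F" using F by (subst (asm) four)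
  note C3 = Ck_on_Suc_imp[OF C]
  note C2 = Ck_on_Suc_imp[OF C3]
  have d1: "formA F x *v cvec y = cvec ((dird y ^^ 1) F x)" for x y
    using formA_cvec[OF Ck_on_Suc_differentiable[OF C UNIV_I]] by (simp add: dird_def)
  have bl: "bounded_linear cvec" by (rule bounded_linear_cvec)
  have cs: "cvec (\<Sum>i\<in>A. f i) = (\<Sum>i\<in>A. cvec (f i))" for A and f :: "'n \<Rightarrow> real^'n"
    using bl linear_sum bounded_linear.linear by blast
  have cr: "cvec (r *\<^sub>R z) = of_real r *s cvec z" for r and z :: "real^'n"
    by (simp add: cvec_def vec_eq_iff scaleR_conv_of_real[where 'a=complex])
  have d2: "formB F x (cvec y) (cvec y) = cvec ((dird y ^^ 2) F x)" for x y
  proof -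
    have "(dird y ^^ 2) F x = (\<Sum>k\<in>UNIV. \<Sum>j\<in>UNIV. (y $ j * y $ k) *\<^sub>R partial j (partial k F) x)"
      unfolding numeral_2_eq_2 dird_pow_Suc[OF C2]
      by (simp add: dird_eq_sum_partial[OF Ck_on_Suc_differentiable[OF Ck_on_partial[OF C2] UNIV_I]] scaleR_sum_right mult.commute)
    also have "\<dots> = (\<Sum>j\<in>UNIV. \<Sum>k\<in>UNIV. (y $ j * y $ k) *\<^sub>R partial j (partial k F) x)"
      by (rule sum.swap)
    finally show ?thesis unfolding formB_def by (simp add: cs cr) (simp add: cvec_def)
  qed
  have d3: "formC F x (cvec y) (cvec y) (cvec y) = cvec ((dird y ^^ 3) F x)" for x y
  proof -
    have "(dird y ^^ 3) F x = (\<Sum>l\<in>UNIV. \<Sum>k\<in>UNIV. \<Sum>j\<in>UNIV. (y $ j * y $ k * y $ l) *\<^sub>R partial j (partial k (partial l F)) x)"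
      unfolding numeral_3_eq_3 dird_pow_Suc[OF C3] dird_pow_Suc[OF Ck_on_partial[OF C3]]
      by (simp add: dird_eq_sum_partial[OF Ck_on_Suc_differentiable[OF Ck_on_partial[OF Ck_on_partial[OF C3]] UNIV_I]] scaleR_sum_right ac_simps)
    also have "\<dots> = (\<Sum>l\<in>UNIV. \<Sum>j\<in>UNIV. \<Sum>k\<in>UNIV. (y $ j * y $ k * y $ l) *\<^sub>R partial j (partial k (partial l F)) x)"
      by (intro sum.cong refl sum.swap)
    also have "\<dots> = (\<Sum>j\<in>UNIV. \<Sum>l\<in>UNIV. \<Sum>k\<in>UNIV. (y $ j * y $ k * y $ l) *\<^sub>R partial j (partial k (partial l F)) x)"
      by (rule sum.swap)
    also have "\<dots> = (\<Sum>j\<in>UNIV. \<Sum>k\<in>UNIV. \<Sum>l\<in>UNIV. (y $ j * y $ k * y $ l) *\<^sub>R partial j (partial k (partial l F)) x)"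
      by (intro sum.cong refl sum.swap)
    finally show ?thesis unfolding formC_def by (simp add: cs cr) (simp add: cvec_def)
  qed
  have diff: "(dird y ^^ m) F differentiable (at x)" if "m < 4" for m x y
  proof -
    have "m + Suc (3 - m) = 4" using that by simp
    then have "Ck_on (Suc (3 - m)) UNIV ((dird y ^^ m) F)"
      using F by (intro Ck_on_dird_pow) (simp only:)
    then show ?thesis by simp
  qed
  have "norm (cvec (F (x + y)) - (cvec (F x) + formA F x *v cvec y + (1/2) *\<^sub>R formB F x (cvec y) (cvec y)
      + (1/6) *\<^sub>R formC F x (cvec y) (cvec y) (cvec y))) \<le> (real CARD('n) * \<bar>M\<bar>) * norm y ^ 4"
    if x: "x \<in> K" and y: "norm y \<le> 1" for x y
  proof -
    let ?R = "F (x + y) - (F x + (dird y ^^ 1) F x + (1/2) *\<^sub>R (dird y ^^ 2) F x + (1/6) *\<^sub>R (dird y ^^ 3) F x)"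
    have sum4: "(\<Sum>m<4. f m) = f 0 + f 1 + f 2 + f 3" for f :: "nat \<Rightarrow> real"
      by (simp add: eval_nat_numeral)
    have f: "fact 2 = (2::real)" "fact 3 = (6::real)" "fact 4 = (24::real)"
      by (simp_all add: fact_numeral)
    have "\<bar>?R $ i\<bar> \<le> \<bar>M\<bar> * norm y ^ 4" for i
    proof -
      have D: "\<forall>m t. m < 4 \<and> 0 \<le> t \<and> t \<le> 1 \<longrightarrow>
          ((\<lambda>s. (dird y ^^ m) F (x + s *\<^sub>R y) $ i) has_real_derivative (dird y ^^ Suc m) F (x + t *\<^sub>R y) $ i) (at t)"
        using has_real_derivative_dird_component[OF diff] by simp
      obtain t where t: "0 < t" "t < 1" and eq: "F (x + 1 *\<^sub>R y) $ i =
          (\<Sum>m<4. (dird y ^^ m) F (x + 0 *\<^sub>R y) $ i / fact m * 1 ^ m) + (dird y ^^ 4) F (x + t *\<^sub>R y) $ i / fact 4 * 1 ^ 4"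
        using Maclaurin[OF _ _ _ D, of "\<lambda>s. F (x + s *\<^sub>R y) $ i"] by auto
      have "norm (t *\<^sub>R y) \<le> 1" using t y mult_mono[of t 1 "norm y" 1] by simp
      then have "x + t *\<^sub>R y \<in> ?K" using x by force
      then have "\<bar>(dird y ^^ 4) F (x + t *\<^sub>R y) $ i\<bar> \<le> \<bar>M\<bar> * norm y ^ 4"
        using M[of "x + t *\<^sub>R y" y] component_le_norm_cart[of "(dird y ^^ 4) F (x + t *\<^sub>R y)" i]
          mult_right_mono[OF abs_ge_self[of M] zero_le_power[OF norm_ge_zero[of y], of 4]] by linarith
      moreover have "?R $ i = (dird y ^^ 4) F (x + t *\<^sub>R y) $ i / 24"
        using eq unfolding sum4 f vector_minus_component vector_add_component vector_scaleR_component
          scaleR_zero_left scaleR_one add_0_right funpow_0 power_one fact_0 fact_1 real_scaleR_def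
        by linarith
      ultimately show ?thesis by simp
    qed
    \<comment> \<open>The intermediate point depends on the component, so the component bounds are
      added up; this is the factor \<open>CARD('n)\<close>.\<close>
    then have "norm ?R \<le> (\<Sum>i\<in>(UNIV::'n set). \<bar>M\<bar> * norm y ^ 4)"
      by (intro order_trans[OF norm_le_l1_cart] sum_mono) auto
    moreover have "cvec (F (x + y)) - (cvec (F x) + formA F x *v cvec y + (1/2) *\<^sub>R formB F x (cvec y) (cvec y)
      + (1/6) *\<^sub>R formC F x (cvec y) (cvec y) (cvec y)) = cvec ?R"
      unfolding d1 d2 d3 by (simp only: linear_simps[OF bl])
    ultimately show ?thesis by (simp add: norm_cvec)
  qed
  then show ?thesis using that[of "real CARD('n) * \<bar>M\<bar>"] by simp
qed

section \<open>Uniform expansions in a small parameter\<close>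

text \<open>The Landau symbol for \<epsilon> tending to 0 from above, uniformly over \<tau> in
  \<open>S\<close>. Uniformity allows expansions to be integrated over \<tau> and continuity to pass
  to the limit; positivity of \<epsilon> allows division by it.\<close>

definition Oe :: "real set \<Rightarrow> nat \<Rightarrow> (real \<Rightarrow> real \<Rightarrow> 'b::real_normed_vector) \<Rightarrow> bool" where
  "Oe S m f \<longleftrightarrow> (\<exists>K. \<exists>\<delta>>0. \<forall>\<tau>\<in>S. \<forall>\<epsilon>. 0 < \<epsilon> \<and> \<epsilon> < \<delta> \<longrightarrow> norm (f \<tau> \<epsilon>) \<le> K * \<epsilon> ^ m)"

lemma OeI:
  assumes "\<delta> > 0" "\<And>\<tau> \<epsilon>. \<tau> \<in> S \<Longrightarrow> 0 < \<epsilon> \<Longrightarrow> \<epsilon> < \<delta> \<Longrightarrow> norm (f \<tau> \<epsilon>) \<le> K * \<epsilon> ^ m"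
  shows "Oe S m f"
  using assms unfolding Oe_def by blast

lemma OeE:
  assumes "Oe S m f"
  obtains K \<delta> where "K \<ge> 0" "\<delta> > 0" "\<delta> \<le> 1"
    "\<And>\<tau> \<epsilon>. \<tau> \<in> S \<Longrightarrow> 0 < \<epsilon> \<Longrightarrow> \<epsilon> < \<delta> \<Longrightarrow> norm (f \<tau> \<epsilon>) \<le> K * \<epsilon> ^ m"
proof -
  obtain K \<delta> where *: "\<delta> > 0" "\<And>\<tau> \<epsilon>. \<tau> \<in> S \<Longrightarrow> 0 < \<epsilon> \<Longrightarrow> \<epsilon> < \<delta> \<Longrightarrow> norm (f \<tau> \<epsilon>) \<le> K * \<epsilon> ^ m"
    using assms unfolding Oe_def by blast
  show ?thesis
  proof (rule that[of "\<bar>K\<bar>" "min \<delta> 1"])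
    fix \<tau> \<epsilon> assume "\<tau> \<in> S" "0 < \<epsilon>" "\<epsilon> < min \<delta> 1"
    then show "norm (f \<tau> \<epsilon>) \<le> \<bar>K\<bar> * \<epsilon> ^ m"
      using *(2)[of \<tau> \<epsilon>] mult_right_mono[OF abs_ge_self[of K], of "\<epsilon> ^ m"] by (auto intro: order_trans)
  qed (use *(1) in auto)
qed

lemma Oe_dominated:
  assumes "Oe S m f" "\<delta> > 0"
    "\<And>\<tau> \<epsilon>. \<tau> \<in> S \<Longrightarrow> 0 < \<epsilon> \<Longrightarrow> \<epsilon> < \<delta> \<Longrightarrow> norm (g \<tau> \<epsilon>) \<le> C * norm (f \<tau> \<epsilon>)"
  shows "Oe S m g"
proof -
  obtain K \<delta>' where K: "K \<ge> 0" "\<delta>' > 0" "\<And>\<tau> \<epsilon>. \<tau> \<in> S \<Longrightarrow> 0 < \<epsilon> \<Longrightarrow> \<epsilon> < \<delta>' \<Longrightarrow> norm (f \<tau> \<epsilon>) \<le> K * \<epsilon> ^ m"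
    using OeE[OF assms(1)] by metis
  show ?thesis
  proof (rule OeI[of "min \<delta> \<delta>'"])
    fix \<tau> \<epsilon> assume *: "\<tau> \<in> S" "0 < \<epsilon>" "\<epsilon> < min \<delta> \<delta>'"
    have "norm (g \<tau> \<epsilon>) \<le> C * norm (f \<tau> \<epsilon>)" using assms(3) * by simp
    also have "\<dots> \<le> \<bar>C\<bar> * norm (f \<tau> \<epsilon>)" by (intro mult_right_mono) auto
    also have "\<dots> \<le> \<bar>C\<bar> * (K * \<epsilon> ^ m)" using K(3) * by (intro mult_left_mono) auto
    finally show "norm (g \<tau> \<epsilon>) \<le> (\<bar>C\<bar> * K) * \<epsilon> ^ m" by simp
  qed (use assms(2) K in auto)
qed

lemma Oe_cong:
  assumes "Oe S m f" "\<delta> > 0" "\<And>\<tau> \<epsilon>. \<tau> \<in> S \<Longrightarrow> 0 < \<epsilon> \<Longrightarrow> \<epsilon> < \<delta> \<Longrightarrow> g \<tau> \<epsilon> = f \<tau> \<epsilon>"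
  shows "Oe S m g"
  by (rule Oe_dominated[OF assms(1,2), where C=1]) (simp add: assms(3))

lemma Oe_eq:
  assumes "Oe S m f" "\<And>\<tau> \<epsilon>. \<tau> \<in> S \<Longrightarrow> g \<tau> \<epsilon> = f \<tau> \<epsilon>"
  shows "Oe S m g"
  by (rule Oe_cong[OF assms(1), of 1]) (auto simp: assms(2))

lemma Oe_mono:
  assumes "Oe S m f" "k \<le> m"
  shows "Oe S k f"
proof -
  obtain K \<delta> where K: "K \<ge> 0" "\<delta> > 0" "\<delta> \<le> 1" "\<And>\<tau> \<epsilon>. \<tau> \<in> S \<Longrightarrow> 0 < \<epsilon> \<Longrightarrow> \<epsilon> < \<delta> \<Longrightarrow> norm (f \<tau> \<epsilon>) \<le> K * \<epsilon> ^ m"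
    using OeE[OF assms(1)] by metis
  show ?thesis
  proof (rule OeI[of \<delta>])
    fix \<tau> \<epsilon> assume *: "\<tau> \<in> S" "0 < \<epsilon>" "\<epsilon> < \<delta>"
    have "norm (f \<tau> \<epsilon>) \<le> K * \<epsilon> ^ m" using K(4) * by simp
    also have "\<dots> \<le> K * \<epsilon> ^ k" using K * assms(2) by (intro mult_left_mono power_decreasing) auto
    finally show "norm (f \<tau> \<epsilon>) \<le> K * \<epsilon> ^ k" .
  qed (use K in auto)
qed

lemma Oe_add:
  assumes "Oe S m f" "Oe S m g"
  shows "Oe S m (\<lambda>\<tau> \<epsilon>. f \<tau> \<epsilon> + g \<tau> \<epsilon>)"
proof -
  obtain K \<delta> where K: "\<delta> > 0" "\<And>\<tau> \<epsilon>. \<tau> \<in> S \<Longrightarrow> 0 < \<epsilon> \<Longrightarrow> \<epsilon> < \<delta> \<Longrightarrow> norm (f \<tau> \<epsilon>) \<le> K * \<epsilon> ^ m"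
    using OeE[OF assms(1)] by metis
  obtain K' \<delta>' where K': "\<delta>' > 0" "\<And>\<tau> \<epsilon>. \<tau> \<in> S \<Longrightarrow> 0 < \<epsilon> \<Longrightarrow> \<epsilon> < \<delta>' \<Longrightarrow> norm (g \<tau> \<epsilon>) \<le> K' * \<epsilon> ^ m"
    using OeE[OF assms(2)] by metis
  show ?thesis
  proof (rule OeI[of "min \<delta> \<delta>'"])
    fix \<tau> \<epsilon> assume *: "\<tau> \<in> S" "0 < \<epsilon>" "\<epsilon> < min \<delta> \<delta>'"
    then show "norm (f \<tau> \<epsilon> + g \<tau> \<epsilon>) \<le> (K + K') * \<epsilon> ^ m"
      using norm_triangle_mono[OF K(2)[of \<tau> \<epsilon>] K'(2)[of \<tau> \<epsilon>]] by (simp add: distrib_right)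
  qed (use K K' in auto)
qed

lemma Oe_minus: "Oe S m f \<Longrightarrow> Oe S m (\<lambda>\<tau> \<epsilon>. - f \<tau> \<epsilon>)"
  by (rule Oe_dominated[where \<delta>=1 and C=1]) auto

lemma Oe_diff: "Oe S m f \<Longrightarrow> Oe S m g \<Longrightarrow> Oe S m (\<lambda>\<tau> \<epsilon>. f \<tau> \<epsilon> - g \<tau> \<epsilon>)"
  using Oe_add[OF _ Oe_minus, of S m f g] by simp

text \<open>Only a bilinear norm estimate is asked of \<open>P\<close>, so the same argument serves
  scalar products, scalings and the derivative forms.\<close>

lemma Oe_product:
  assumes "Oe S m f" "Oe S k g"
    and "\<And>\<tau> \<epsilon>. \<tau> \<in> S \<Longrightarrow> norm (P \<tau> \<epsilon>) \<le> C * (norm (f \<tau> \<epsilon>) * norm (g \<tau> \<epsilon>))"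
  shows "Oe S (m + k) P"
proof -
  obtain K \<delta> where K: "K \<ge> 0" "\<delta> > 0" "\<And>\<tau> \<epsilon>. \<tau> \<in> S \<Longrightarrow> 0 < \<epsilon> \<Longrightarrow> \<epsilon> < \<delta> \<Longrightarrow> norm (f \<tau> \<epsilon>) \<le> K * \<epsilon> ^ m"
    using OeE[OF assms(1)] by metis
  obtain K' \<delta>' where K': "K' \<ge> 0" "\<delta>' > 0" "\<And>\<tau> \<epsilon>. \<tau> \<in> S \<Longrightarrow> 0 < \<epsilon> \<Longrightarrow> \<epsilon> < \<delta>' \<Longrightarrow> norm (g \<tau> \<epsilon>) \<le> K' * \<epsilon> ^ k"
    using OeE[OF assms(2)] by metis
  show ?thesis
  proof (rule OeI[of "min \<delta> \<delta>'"])
    fix \<tau> \<epsilon> assume *: "\<tau> \<in> S" "0 < \<epsilon>" "\<epsilon> < min \<delta> \<delta>'"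
    have "norm (P \<tau> \<epsilon>) \<le> C * (norm (f \<tau> \<epsilon>) * norm (g \<tau> \<epsilon>))" using assms(3) * by simp
    also have "\<dots> \<le> \<bar>C\<bar> * (norm (f \<tau> \<epsilon>) * norm (g \<tau> \<epsilon>))" by (intro mult_right_mono) auto
    also have "\<dots> \<le> \<bar>C\<bar> * ((K * \<epsilon> ^ m) * (K' * \<epsilon> ^ k))"
      using K K' * by (intro mult_left_mono mult_mono) auto
    finally show "norm (P \<tau> \<epsilon>) \<le> (\<bar>C\<bar> * K * K') * \<epsilon> ^ (m + k)"
      by (simp add: power_add ac_simps)
  qed (use K K' in auto)
qed

lemma Oe_mult:
  fixes f g :: "real \<Rightarrow> real \<Rightarrow> 'b::real_normed_algebra"
  shows "Oe S m f \<Longrightarrow> Oe S k g \<Longrightarrow> Oe S (m + k) (\<lambda>\<tau> \<epsilon>. f \<tau> \<epsilon> * g \<tau> \<epsilon>)"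
  by (rule Oe_product[of S m f k g _ 1]) (simp_all add: norm_mult_ineq)

lemma Oe_scaleR: "Oe S m f \<Longrightarrow> Oe S k g \<Longrightarrow> Oe S (m + k) (\<lambda>\<tau> \<epsilon>. f \<tau> \<epsilon> *\<^sub>R g \<tau> \<epsilon>)"
  by (rule Oe_product[of S m f k g _ 1]) simp_all

lemma Oe_smult:
  "Oe S m f \<Longrightarrow> Oe S k g \<Longrightarrow> Oe S (m + k) (\<lambda>\<tau> \<epsilon>. f \<tau> \<epsilon> *s (g \<tau> \<epsilon> :: complex^'n))"
  by (rule Oe_product[of S m f k g _ 1]) (simp_all add: norm_vector_smult)

lemma Oe_linear:
  assumes "bounded_linear L" "Oe S m f"
  shows "Oe S m (\<lambda>\<tau> \<epsilon>. L (f \<tau> \<epsilon>))"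
proof -
  obtain C where "\<And>x. norm (L x) \<le> norm x * C" using bounded_linear.bounded[OF assms(1)] by blast
  then show ?thesis by (intro Oe_dominated[OF assms(2), where \<delta>=1 and C=C]) (auto simp: mult.commute)
qed

lemma Oe_power: "Oe S m (\<lambda>\<tau> \<epsilon>. \<epsilon> ^ m)"
  by (rule OeI[where \<delta>=1 and K=1]) auto

lemma Oe_id: "Oe S 1 (\<lambda>\<tau> \<epsilon>. \<epsilon>)"
  using Oe_power[of S 1] by simp

lemma Oe_continuous: "continuous_on S a \<Longrightarrow> compact S \<Longrightarrow> Oe S 0 (\<lambda>\<tau> \<epsilon>. a \<tau>)"
proof -
  assume "continuous_on S a" "compact S"
  then have "bounded (a ` S)" by (intro compact_imp_bounded compact_continuous_image)
  then obtain K where "\<And>\<tau>. \<tau> \<in> S \<Longrightarrow> norm (a \<tau>) \<le> K" by (auto simp: bounded_iff)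
  then show ?thesis by (intro OeI[where \<delta>=1 and K=K]) auto
qed

lemma Oe_const: "Oe S 0 (\<lambda>\<tau> \<epsilon>. a)"
  by (rule OeI[where \<delta>=1 and K="norm a"]) auto

lemma Oe_pow_scaleR:
  assumes "Oe S 0 f" "k \<le> m"
  shows "Oe S k (\<lambda>\<tau> \<epsilon>. \<epsilon> ^ m *\<^sub>R f \<tau> \<epsilon>)"
  using Oe_mono[OF Oe_scaleR[OF Oe_power[of S m] assms(1)]] assms(2) by simp

lemma Oe_scaleR_cancel:
  assumes "Oe S (Suc m) (\<lambda>\<tau> \<epsilon>. \<epsilon> *\<^sub>R f \<tau> \<epsilon>)"
  shows "Oe S m f"
proof -
  obtain K \<delta> where K: "\<delta> > 0" "\<And>\<tau> \<epsilon>. \<tau> \<in> S \<Longrightarrow> 0 < \<epsilon> \<Longrightarrow> \<epsilon> < \<delta> \<Longrightarrow> norm (\<epsilon> *\<^sub>R f \<tau> \<epsilon>) \<le> K * \<epsilon> ^ Suc m"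
    using OeE[OF assms] by metis
  show ?thesis
  proof (rule OeI[OF K(1), where K=K])
    fix \<tau> \<epsilon> assume "\<tau> \<in> S" "0 < \<epsilon>" "\<epsilon> < \<delta>"
    then have "\<epsilon> * norm (f \<tau> \<epsilon>) \<le> \<epsilon> * (K * \<epsilon> ^ m)" using K(2)[of \<tau> \<epsilon>] by (simp add: ac_simps)
    then show "norm (f \<tau> \<epsilon>) \<le> K * \<epsilon> ^ m" using \<open>0 < \<epsilon>\<close> by simp
  qed
qed

lemma Oe_const_zero:
  assumes "Oe S 1 (\<lambda>\<tau> \<epsilon>. a \<tau>)" "\<tau> \<in> S"
  shows "a \<tau> = 0"
proof (rule ccontr)
  assume "a \<tau> \<noteq> 0"
  obtain K \<delta> where K: "K \<ge> 0" "\<delta> > 0" "\<And>\<tau> \<epsilon>. \<tau> \<in> S \<Longrightarrow> 0 < \<epsilon> \<Longrightarrow> \<epsilon> < \<delta> \<Longrightarrow> norm (a \<tau>) \<le> K * \<epsilon> ^ 1"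
    using OeE[OF assms(1)] by metis
  define \<epsilon> where "\<epsilon> = min (\<delta> / 2) (norm (a \<tau>) / (2 * (K + 1)))"
  have "0 < \<epsilon>" "\<epsilon> < \<delta>" using K \<open>a \<tau> \<noteq> 0\<close> by (auto simp: \<epsilon>_def)
  then have "norm (a \<tau>) \<le> K * \<epsilon>" using K(3)[OF assms(2)] by simp
  also have "\<dots> \<le> (K + 1) * (norm (a \<tau>) / (2 * (K + 1)))"
    using K \<open>0 < \<epsilon>\<close> by (intro mult_mono) (auto simp: \<epsilon>_def)
  also have "\<dots> = norm (a \<tau>) / 2" using K(1) by (simp add: field_simps)
  finally show False using \<open>a \<tau> \<noteq> 0\<close> by simp
qed

text \<open>Uniqueness of asymptotic coefficients: in Horner form the constant term must vanish, one
  factor \<epsilon> is cancelled, and the argument repeats. The singleton set makes the first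
  argument a dummy, so that expansions at one fixed time can be compared.\<close>

lemma Oe_cubic_zero:
  assumes "Oe {t} 4 (\<lambda>_ \<epsilon>. c0 + \<epsilon> *\<^sub>R c1 + \<epsilon> ^ 2 *\<^sub>R c2 + \<epsilon> ^ 3 *\<^sub>R c3)"
  shows "c0 = 0" "c1 = 0" "c2 = 0" "c3 = 0"
proof -
  have step: "c = 0 \<and> Oe {t} m f" if "Oe {t} (Suc m) (\<lambda>\<tau> \<epsilon>. c + \<epsilon> *\<^sub>R f \<tau> \<epsilon>)" "Oe {t} 0 f" for c m f
  proof -
    have "Oe {t} 1 (\<lambda>\<tau> \<epsilon>. (c + \<epsilon> *\<^sub>R f \<tau> \<epsilon>) - \<epsilon> *\<^sub>R f \<tau> \<epsilon>)"
      by (rule Oe_diff[OF Oe_mono[OF that(1)]]) (use Oe_scaleR[OF Oe_id that(2)] in auto)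
    then have "c = 0" using Oe_const_zero[of "{t}" "\<lambda>_. c" t] by simp
    then show ?thesis using that(1) Oe_scaleR_cancel[of "{t}" m f] by simp
  qed
  have b: "Oe {t} 0 (\<lambda>_ \<epsilon>. c3)" by (rule Oe_const)
  have b2: "Oe {t} 0 (\<lambda>_ \<epsilon>. c2 + \<epsilon> *\<^sub>R c3)"
    by (intro Oe_add Oe_const Oe_mono[OF Oe_scaleR[OF Oe_id Oe_const]]) auto
  have b1: "Oe {t} 0 (\<lambda>_ \<epsilon>. c1 + \<epsilon> *\<^sub>R (c2 + \<epsilon> *\<^sub>R c3))"
    by (intro Oe_add Oe_const Oe_mono[OF Oe_scaleR[OF Oe_id b2]]) auto
  have "Oe {t} (Suc 3) (\<lambda>_ \<epsilon>. c0 + \<epsilon> *\<^sub>R (c1 + \<epsilon> *\<^sub>R (c2 + \<epsilon> *\<^sub>R c3)))"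
    using assms by (simp add: scaleR_add_right power2_eq_square power3_eq_cube add.assoc mult.assoc)
  from step[OF this b1] have 0: "c0 = 0" and "Oe {t} (Suc 2) (\<lambda>_ \<epsilon>. c1 + \<epsilon> *\<^sub>R (c2 + \<epsilon> *\<^sub>R c3))" by auto
  from step[OF this(2) b2] have 1: "c1 = 0" and "Oe {t} (Suc 1) (\<lambda>_ \<epsilon>. c2 + \<epsilon> *\<^sub>R c3)" by (auto simp: numeral_2_eq_2)
  from step[OF this(2) b] have 2: "c2 = 0" and "Oe {t} 1 (\<lambda>_ \<epsilon>. c3)" by auto
  then have "c3 = 0" using Oe_const_zero[of "{t}" "\<lambda>_. c3" t] by simp
  with 0 1 2 show "c0 = 0" "c1 = 0" "c2 = 0" "c3 = 0" by auto
qed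

text \<open>A uniform limit of continuous functions is continuous. In this way the expansion
  coefficients inherit continuity from \<open>H\<close>.\<close>

lemma Oe_uniform_limit_continuous:
  assumes "Oe S 1 (\<lambda>\<tau> \<epsilon>. G \<tau> \<epsilon> - f \<tau>)" "\<delta> > 0"
    "\<And>\<epsilon>. 0 < \<epsilon> \<Longrightarrow> \<epsilon> < \<delta> \<Longrightarrow> continuous_on S (\<lambda>\<tau>. G \<tau> \<epsilon>)"
  shows "continuous_on S f"
proof (rule uniform_limit_theorem[where F="at_right (0::real)" and f="\<lambda>\<epsilon> \<tau>. G \<tau> \<epsilon>"])
  have ev: "eventually (\<lambda>\<epsilon>. 0 < \<epsilon> \<and> \<epsilon> < d) (at_right (0::real))" if "d > 0" for d
    using eventually_at_right_real[OF that] by eventually_elim auto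
  show "\<forall>\<^sub>F \<epsilon> in at_right 0. continuous_on S (\<lambda>\<tau>. G \<tau> \<epsilon>)"
    using ev[OF assms(2)] by eventually_elim (simp add: assms(3))
  obtain K d where K: "K \<ge> 0" "d > 0" "\<And>\<tau> \<epsilon>. \<tau> \<in> S \<Longrightarrow> 0 < \<epsilon> \<Longrightarrow> \<epsilon> < d \<Longrightarrow> norm (G \<tau> \<epsilon> - f \<tau>) \<le> K * \<epsilon> ^ 1"
    using OeE[OF assms(1)] by metis
  show "uniform_limit S (\<lambda>\<epsilon> \<tau>. G \<tau> \<epsilon>) f (at_right 0)"
  proof (rule uniform_limitI)
    fix e :: real assume e: "e > 0"
    have "min d (e / (K + 1)) > 0" using K e by simp
    from ev[OF this] show "\<forall>\<^sub>F \<epsilon> in at_right 0. \<forall>\<tau>\<in>S. dist (G \<tau> \<epsilon>) (f \<tau>) < e"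
    proof eventually_elim
      case (elim \<epsilon>)
      show ?case
      proof
        fix \<tau> assume "\<tau> \<in> S"
        then have "dist (G \<tau> \<epsilon>) (f \<tau>) \<le> K * \<epsilon>" using K(3)[of \<tau> \<epsilon>] elim by (simp add: dist_norm)
        also have "\<dots> < (K + 1) * \<epsilon>" using elim by simp
        also have "\<dots> \<le> e" using elim K by (simp add: field_simps)
        finally show "dist (G \<tau> \<epsilon>) (f \<tau>) < e" .
      qed
    qed
  qed
qed simp

text \<open>From 1/(1 + a) = 1 - a + a^2/(1 + a), where a^2 is of order four. As \<open>a\<close>
  starts at order two, the division changes only the coefficients of orders two and three.\<close>

lemma Oe_divide_one_plus:
  fixes N :: "real \<Rightarrow> real \<Rightarrow> 'b::real_normed_vector"
  assumes N: "Oe S 4 (\<lambda>\<tau> \<epsilon>. N \<tau> \<epsilon> - (N0 \<tau> + \<epsilon> *\<^sub>R N1 \<tau> + \<epsilon> ^ 2 *\<^sub>R N2 \<tau> + \<epsilon> ^ 3 *\<^sub>R N3 \<tau>))"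
    and a: "Oe S 4 (\<lambda>\<tau> \<epsilon>. a \<tau> \<epsilon> - (\<epsilon> ^ 2 * A2 + \<epsilon> ^ 3 * A3))"
    and b: "Oe S 0 (\<lambda>\<tau> \<epsilon>. N0 \<tau>)" "Oe S 0 (\<lambda>\<tau> \<epsilon>. N1 \<tau>)" "Oe S 0 (\<lambda>\<tau> \<epsilon>. N2 \<tau>)" "Oe S 0 (\<lambda>\<tau> \<epsilon>. N3 \<tau>)"
  shows "Oe S 4 (\<lambda>\<tau> \<epsilon>. N \<tau> \<epsilon> /\<^sub>R (1 + a \<tau> \<epsilon>) - (N0 \<tau> + \<epsilon> *\<^sub>R N1 \<tau> + \<epsilon> ^ 2 *\<^sub>R (N2 \<tau> - A2 *\<^sub>R N0 \<tau>)
      + \<epsilon> ^ 3 *\<^sub>R (N3 \<tau> - A3 *\<^sub>R N0 \<tau> - A2 *\<^sub>R N1 \<tau>)))"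
    and "\<exists>\<delta>>0. \<forall>\<tau>\<in>S. \<forall>\<epsilon>. 0 < \<epsilon> \<and> \<epsilon> < \<delta> \<longrightarrow> 1 + a \<tau> \<epsilon> > 0"
proof -
  let ?P = "\<lambda>\<tau> \<epsilon>. N0 \<tau> + \<epsilon> *\<^sub>R N1 \<tau> + \<epsilon> ^ 2 *\<^sub>R N2 \<tau> + \<epsilon> ^ 3 *\<^sub>R N3 \<tau>"
  let ?A = "\<lambda>\<epsilon>::real. \<epsilon> ^ 2 * A2 + \<epsilon> ^ 3 * A3"
  have A: "Oe S 2 (\<lambda>\<tau> \<epsilon>. ?A \<epsilon>)"
    using Oe_add[OF Oe_pow_scaleR[OF Oe_const[of S A2], of 2 2] Oe_pow_scaleR[OF Oe_const[of S A3], of 2 3]] by simp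
  have a2: "Oe S 2 a"
    using Oe_add[OF Oe_mono[OF a, of 2] A] by simp
  have tail: "Oe S 2 (\<lambda>\<tau> \<epsilon>. \<epsilon> ^ 2 *\<^sub>R N2 \<tau> + \<epsilon> ^ 3 *\<^sub>R N3 \<tau>)"
    by (intro Oe_add Oe_pow_scaleR b) auto
  have N1': "Oe S 1 (\<lambda>\<tau> \<epsilon>. \<epsilon> *\<^sub>R N1 \<tau>)" using Oe_pow_scaleR[OF b(2), of 1 1] by simp
  have P0: "Oe S 0 ?P"
    using Oe_add[OF Oe_add[OF b(1) Oe_mono[OF N1', of 0]] Oe_mono[OF tail, of 0]] by (simp add: add.assoc)
  have N0': "Oe S 0 N" using Oe_add[OF Oe_mono[OF N, of 0] P0] by simp
  obtain K \<delta> where K: "K \<ge> 0" "\<delta> > 0" "\<delta> \<le> 1" "\<And>\<tau> \<epsilon>. \<tau> \<in> S \<Longrightarrow> 0 < \<epsilon> \<Longrightarrow> \<epsilon> < \<delta> \<Longrightarrow> norm (a \<tau> \<epsilon>) \<le> K * \<epsilon> ^ 2"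
    using OeE[OF a2] by metis
  define d where "d = min \<delta> (1 / (2 * (K + 1)))"
  have d: "d > 0" using K by (simp add: d_def)
  have half: "\<bar>a \<tau> \<epsilon>\<bar> \<le> 1/2" if "\<tau> \<in> S" "0 < \<epsilon>" "\<epsilon> < d" for \<tau> \<epsilon>
  proof -
    have e: "\<epsilon> < \<delta>" "\<epsilon> \<le> 1 / (2 * (K + 1))" using that by (auto simp: d_def)
    have "\<bar>a \<tau> \<epsilon>\<bar> \<le> K * \<epsilon> ^ 2" using K(4)[of \<tau> \<epsilon>] that e by simp
    also have "\<dots> \<le> (K + 1) * \<epsilon> ^ 1" using K e that by (intro mult_mono power_decreasing) auto
    also have "\<dots> \<le> (K + 1) * (1 / (2 * (K + 1)))" using K e by (intro mult_left_mono) auto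
    also have "\<dots> = 1/2" using K(1) by (simp add: field_simps)
    finally show ?thesis .
  qed
  have "1 + a \<tau> \<epsilon> > 0" if "\<tau> \<in> S" "0 < \<epsilon>" "\<epsilon> < d" for \<tau> \<epsilon>
    using half[OF that] by linarith
  then show "\<exists>\<delta>>0. \<forall>\<tau>\<in>S. \<forall>\<epsilon>. 0 < \<epsilon> \<and> \<epsilon> < \<delta> \<longrightarrow> 1 + a \<tau> \<epsilon> > 0" using d by blast
  have inv: "Oe S 0 (\<lambda>\<tau> \<epsilon>. inverse (1 + a \<tau> \<epsilon>))"
  proof (rule OeI[OF d, where K=2])
    fix \<tau> \<epsilon> assume "\<tau> \<in> S" "0 < \<epsilon>" "\<epsilon> < d"
    then have "1 + a \<tau> \<epsilon> \<ge> 1/2" using half[of \<tau> \<epsilon>] by linarith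
    then show "norm (inverse (1 + a \<tau> \<epsilon>)) \<le> 2 * \<epsilon> ^ 0"
      using le_imp_inverse_le[of "1/2" "1 + a \<tau> \<epsilon>"] by simp
  qed
  \<comment> \<open>The five discarded contributions: the term quadratic in \<open>a\<close>; the
    error of \<open>a\<close> times the numerator; the expansion of \<open>a\<close> times the error
    of the numerator; the expansion of \<open>a\<close> times the part of the numerator of order at
    least two; and the single product of the \<open>A3\<close> and \<open>N1\<close> terms.\<close>
  have R1: "Oe S 4 (\<lambda>\<tau> \<epsilon>. (a \<tau> \<epsilon> * a \<tau> \<epsilon> * inverse (1 + a \<tau> \<epsilon>)) *\<^sub>R N \<tau> \<epsilon>)"
    using Oe_scaleR[OF Oe_mult[OF Oe_mult[OF a2 a2] inv] N0'] by simp
  have R2: "Oe S 4 (\<lambda>\<tau> \<epsilon>. (a \<tau> \<epsilon> - ?A \<epsilon>) *\<^sub>R N \<tau> \<epsilon>)"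
    using Oe_scaleR[OF a N0'] by simp
  have R3: "Oe S 4 (\<lambda>\<tau> \<epsilon>. ?A \<epsilon> *\<^sub>R (N \<tau> \<epsilon> - ?P \<tau> \<epsilon>))"
    using Oe_scaleR[OF Oe_mono[OF A, of 0] N] by simp
  have R4: "Oe S 4 (\<lambda>\<tau> \<epsilon>. ?A \<epsilon> *\<^sub>R (\<epsilon> ^ 2 *\<^sub>R N2 \<tau> + \<epsilon> ^ 3 *\<^sub>R N3 \<tau>))"
    using Oe_scaleR[OF A tail] by simp
  have R5: "Oe S 4 (\<lambda>\<tau> \<epsilon>. \<epsilon> ^ 4 *\<^sub>R (A3 *\<^sub>R N1 \<tau>))"
    by (rule Oe_pow_scaleR[OF _ order_refl]) (use Oe_scaleR[OF Oe_const[of S A3] b(2)] in simp)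
  have "Oe S 4 (\<lambda>\<tau> \<epsilon>. (N \<tau> \<epsilon> - ?P \<tau> \<epsilon>) + (a \<tau> \<epsilon> * a \<tau> \<epsilon> * inverse (1 + a \<tau> \<epsilon>)) *\<^sub>R N \<tau> \<epsilon>
      - (a \<tau> \<epsilon> - ?A \<epsilon>) *\<^sub>R N \<tau> \<epsilon> - ?A \<epsilon> *\<^sub>R (N \<tau> \<epsilon> - ?P \<tau> \<epsilon>)
      - ?A \<epsilon> *\<^sub>R (\<epsilon> ^ 2 *\<^sub>R N2 \<tau> + \<epsilon> ^ 3 *\<^sub>R N3 \<tau>) - \<epsilon> ^ 4 *\<^sub>R (A3 *\<^sub>R N1 \<tau>))"
    by (intro Oe_add Oe_diff N R1 R2 R3 R4 R5)
  then show "Oe S 4 (\<lambda>\<tau> \<epsilon>. N \<tau> \<epsilon> /\<^sub>R (1 + a \<tau> \<epsilon>) - (N0 \<tau> + \<epsilon> *\<^sub>R N1 \<tau> + \<epsilon> ^ 2 *\<^sub>R (N2 \<tau> - A2 *\<^sub>R N0 \<tau>)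
      + \<epsilon> ^ 3 *\<^sub>R (N3 \<tau> - A3 *\<^sub>R N0 \<tau> - A2 *\<^sub>R N1 \<tau>)))"
  proof (rule Oe_cong[OF _ d])
    fix \<tau> \<epsilon> assume *: "\<tau> \<in> S" "0 < \<epsilon>" "\<epsilon> < d"
    have ne: "1 + a \<tau> \<epsilon> \<noteq> 0" using half[OF *] by linarith
    have i: "inverse (1 + a \<tau> \<epsilon>) = 1 + a \<tau> \<epsilon> * a \<tau> \<epsilon> * inverse (1 + a \<tau> \<epsilon>) - a \<tau> \<epsilon>"
      using ne by (simp add: field_simps)
    show "N \<tau> \<epsilon> /\<^sub>R (1 + a \<tau> \<epsilon>) - (N0 \<tau> + \<epsilon> *\<^sub>R N1 \<tau> + \<epsilon> ^ 2 *\<^sub>R (N2 \<tau> - A2 *\<^sub>R N0 \<tau>)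
      + \<epsilon> ^ 3 *\<^sub>R (N3 \<tau> - A3 *\<^sub>R N0 \<tau> - A2 *\<^sub>R N1 \<tau>)) = (N \<tau> \<epsilon> - ?P \<tau> \<epsilon>) + (a \<tau> \<epsilon> * a \<tau> \<epsilon> * inverse (1 + a \<tau> \<epsilon>)) *\<^sub>R N \<tau> \<epsilon>
      - (a \<tau> \<epsilon> - ?A \<epsilon>) *\<^sub>R N \<tau> \<epsilon> - ?A \<epsilon> *\<^sub>R (N \<tau> \<epsilon> - ?P \<tau> \<epsilon>)
      - ?A \<epsilon> *\<^sub>R (\<epsilon> ^ 2 *\<^sub>R N2 \<tau> + \<epsilon> ^ 3 *\<^sub>R N3 \<tau>) - \<epsilon> ^ 4 *\<^sub>R (A3 *\<^sub>R N1 \<tau>)"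
      by (subst i) (simp add: algebra_simps power2_eq_square power3_eq_cube power4_eq_xxxx)
  qed
qed

text \<open>Integrating the expansion of \<open>G\<close> gives one of the increment of
  \<open>U\<close>; uniqueness of coefficients identifies each increment of a coefficient of
  \<open>U\<close> with the integral of the corresponding coefficient of \<open>G\<close>.
  Differentiability of \<open>U2\<close> and \<open>U3\<close> is thus a conclusion, by the
  fundamental theorem for continuous integrands.\<close>

lemma has_vector_derivative_of_expansion:
  fixes U :: "real \<Rightarrow> real \<Rightarrow> 'b::euclidean_space"
  assumes U: "Oe {0..T} 4 (\<lambda>\<tau> \<epsilon>. U \<tau> \<epsilon> - (U0 \<tau> + \<epsilon> *\<^sub>R U1 \<tau> + \<epsilon> ^ 2 *\<^sub>R U2 \<tau> + \<epsilon> ^ 3 *\<^sub>R U3 \<tau>))"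
    and G: "Oe {0..T} 4 (\<lambda>\<tau> \<epsilon>. G \<tau> \<epsilon> - (g0 \<tau> + \<epsilon> *\<^sub>R g1 \<tau> + \<epsilon> ^ 2 *\<^sub>R g2 \<tau> + \<epsilon> ^ 3 *\<^sub>R g3 \<tau>))"
    and int: "\<delta> > 0" "\<And>\<epsilon> t. 0 < \<epsilon> \<Longrightarrow> \<epsilon> < \<delta> \<Longrightarrow> t \<in> {0..T} \<Longrightarrow> ((\<lambda>\<tau>. G \<tau> \<epsilon>) has_integral (U t \<epsilon> - U 0 \<epsilon>)) {0..t}"
    and c: "continuous_on {0..T} g0" "continuous_on {0..T} g1" "continuous_on {0..T} g2" "continuous_on {0..T} g3"
    and t: "t \<in> {0..T}"
  shows "(U2 has_vector_derivative g2 t) (at t within {0..T})"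
    and "(U3 has_vector_derivative g3 t) (at t within {0..T})"
proof -
  have *: "U2 t - U2 0 - integral {0..t} g2 = 0 \<and> U3 t - U3 0 - integral {0..t} g3 = 0" if t: "t \<in> {0..T}" for t
  proof -
    let ?I = "\<lambda>g. integral {0..t} g"
    have i: "g integrable_on {0..t}" if "continuous_on {0..T} g" for g :: "real \<Rightarrow> 'b"
      using that t by (intro integrable_continuous_real) (auto intro: continuous_on_subset)
    obtain K d where K: "K \<ge> 0" "d > 0" "\<And>\<tau> \<epsilon>. \<tau> \<in> {0..T} \<Longrightarrow> 0 < \<epsilon> \<Longrightarrow> \<epsilon> < d \<Longrightarrow>
        norm (G \<tau> \<epsilon> - (g0 \<tau> + \<epsilon> *\<^sub>R g1 \<tau> + \<epsilon> ^ 2 *\<^sub>R g2 \<tau> + \<epsilon> ^ 3 *\<^sub>R g3 \<tau>)) \<le> K * \<epsilon> ^ 4"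
      using OeE[OF G] by metis
    have I: "Oe {t} 4 (\<lambda>_ \<epsilon>. (U t \<epsilon> - U 0 \<epsilon>) - (?I g0 + \<epsilon> *\<^sub>R ?I g1 + \<epsilon> ^ 2 *\<^sub>R ?I g2 + \<epsilon> ^ 3 *\<^sub>R ?I g3))"
    proof (rule OeI[where \<delta>="min \<delta> d" and K="K * t"])
      fix \<epsilon> assume e: "0 < \<epsilon>" "\<epsilon> < min \<delta> d"
      have "((\<lambda>\<tau>. G \<tau> \<epsilon> - (g0 \<tau> + \<epsilon> *\<^sub>R g1 \<tau> + \<epsilon> ^ 2 *\<^sub>R g2 \<tau> + \<epsilon> ^ 3 *\<^sub>R g3 \<tau>)) has_integral
          ((U t \<epsilon> - U 0 \<epsilon>) - (?I g0 + \<epsilon> *\<^sub>R ?I g1 + \<epsilon> ^ 2 *\<^sub>R ?I g2 + \<epsilon> ^ 3 *\<^sub>R ?I g3))) {0..t}"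
        using e t c by (intro has_integral_diff has_integral_add has_integral_cmul integrable_integral i int(2)) auto
      then have "norm ((U t \<epsilon> - U 0 \<epsilon>) - (?I g0 + \<epsilon> *\<^sub>R ?I g1 + \<epsilon> ^ 2 *\<^sub>R ?I g2 + \<epsilon> ^ 3 *\<^sub>R ?I g3))
          \<le> (K * \<epsilon> ^ 4) * measure lborel {0..t}"
        using K e t by (intro has_integral_bound_real) auto
      then show "norm ((U t \<epsilon> - U 0 \<epsilon>) - (?I g0 + \<epsilon> *\<^sub>R ?I g1 + \<epsilon> ^ 2 *\<^sub>R ?I g2 + \<epsilon> ^ 3 *\<^sub>R ?I g3)) \<le> K * t * \<epsilon> ^ 4"
        using t by (simp add: ac_simps)
    qed (use int K in auto)
    have U': "Oe {t} 4 (\<lambda>_ \<epsilon>. U s \<epsilon> - (U0 s + \<epsilon> *\<^sub>R U1 s + \<epsilon> ^ 2 *\<^sub>R U2 s + \<epsilon> ^ 3 *\<^sub>R U3 s))"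
      if "s \<in> {0..T}" for s
      using U that unfolding Oe_def by blast
    have s: "t \<in> {0..T}" "0 \<in> {0..T}" using t by auto
    have "Oe {t} 4 (\<lambda>_ \<epsilon>. ((U t \<epsilon> - U 0 \<epsilon>) - (?I g0 + \<epsilon> *\<^sub>R ?I g1 + \<epsilon> ^ 2 *\<^sub>R ?I g2 + \<epsilon> ^ 3 *\<^sub>R ?I g3))
       - ((U t \<epsilon> - (U0 t + \<epsilon> *\<^sub>R U1 t + \<epsilon> ^ 2 *\<^sub>R U2 t + \<epsilon> ^ 3 *\<^sub>R U3 t))
        - (U 0 \<epsilon> - (U0 0 + \<epsilon> *\<^sub>R U1 0 + \<epsilon> ^ 2 *\<^sub>R U2 0 + \<epsilon> ^ 3 *\<^sub>R U3 0))))"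
      by (intro Oe_diff I U' s)
    then have "Oe {t} 4 (\<lambda>_ \<epsilon>. (U0 t - U0 0 - ?I g0) + \<epsilon> *\<^sub>R (U1 t - U1 0 - ?I g1) +
        \<epsilon> ^ 2 *\<^sub>R (U2 t - U2 0 - ?I g2) + \<epsilon> ^ 3 *\<^sub>R (U3 t - U3 0 - ?I g3))"
      by (rule Oe_eq) (simp add: algebra_simps)
    then show ?thesis using Oe_cubic_zero by blast
  qed
  have **: "(V has_vector_derivative g t) (at t within {0..T})"
    if "\<And>t. t \<in> {0..T} \<Longrightarrow> V t - V 0 - integral {0..t} g = 0" "continuous_on {0..T} g" for V g :: "real \<Rightarrow> 'b"
  proof (rule has_vector_derivative_transform[OF t])
    show "V s = V 0 + integral {0..s} g" if "s \<in> {0..T}" for s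
      using \<open>\<And>t. t \<in> {0..T} \<Longrightarrow> V t - V 0 - integral {0..t} g = 0\<close>[OF that] by (simp add: algebra_simps)
    show "((\<lambda>s. V 0 + integral {0..s} g) has_vector_derivative g t) (at t within {0..T})"
      using integral_has_vector_derivative[OF that(2) t] by (auto intro!: derivative_eq_intros)
  qed
  show "(U2 has_vector_derivative g2 t) (at t within {0..T})"
    "(U3 has_vector_derivative g3 t) (at t within {0..T})"
    using ** * c by blast+
qed

section \<open>The invariance equation\<close>

lemma Re_vec_cvec [simp]: "Re_vec (cvec x) = x"
  by (simp add: Re_vec_def cvec_def vec_eq_iff)

text \<open>The value is a real vector kept in complex form: it is fixed by \<open>cnj_vec\<close>,
  so passing through \<open>Re_vec\<close> loses nothing, and the derivative forms can be expanded
  over \<open>v\<close> and its conjugate by complex multilinearity. The dependence on \<xi> is only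
  real linear.\<close>

definition lin_part :: "(real \<Rightarrow> complex^'n) \<Rightarrow> real \<Rightarrow> complex \<Rightarrow> complex^'n" where
  "lin_part v \<tau> \<xi> = \<xi> *s v \<tau> + cnj \<xi> *s cnj_vec (v \<tau>)"

lemma cnj_vec_lin_part [simp]: "cnj_vec (lin_part v \<tau> \<xi>) = lin_part v \<tau> \<xi>"
  by (simp add: lin_part_def cnj_vec_add cnj_vec_smult add.commute)

lemma cm_param_eq: "cm_param u0 v H \<tau> \<xi> = u0 \<tau> + Re_vec (lin_part v \<tau> \<xi>) + H (\<tau>, \<xi>)"
  unfolding cm_param_def lin_part_def add.assoc
  by (simp add: linear_simps[OF bounded_linear_Re_vec] add.assoc)

lemma cvec_cm_param: "cvec (cm_param u0 v H \<tau> \<xi>) = cvec (u0 \<tau>) + lin_part v \<tau> \<xi> + cvec (H (\<tau>, \<xi>))"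
  by (simp add: cm_param_eq linear_simps[OF bounded_linear_cvec] cvec_Re_vec)

text \<open>The velocity is arranged as the \<theta>-speed times the partial derivative in \<tau>,
  plus the contribution of the motion of \<xi>. The formula serves both for a solution of the normal
  form and for a curve with \<xi> frozen; comparing the two isolates the \<tau>-derivative.\<close>

lemma cm_param_chain:
  assumes u0: "(u0 has_vector_derivative u0') (at (\<theta> s))"
    and v: "(v has_vector_derivative v') (at (\<theta> s))"
    and H: "H differentiable (at (\<theta> s, \<xi> s))"
    and \<theta>: "(\<theta> has_real_derivative d) (at s)"
    and \<xi>: "(\<xi> has_vector_derivative g) (at s)"
  shows "((\<lambda>s. cm_param u0 v H (\<theta> s) (\<xi> s)) has_vector_derivative
     d *\<^sub>R (u0' + Re_vec (\<xi> s *s v' + cnj (\<xi> s) *s cnj_vec v') + frechet_derivative H (at (\<theta> s, \<xi> s)) (1, 0))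
       + Re_vec (lin_part v (\<theta> s) g) + frechet_derivative H (at (\<theta> s, \<xi> s)) (0, g)) (at s)"
proof -
  let ?D = "frechet_derivative H (at (\<theta> s, \<xi> s))"
  have H': "(H has_derivative ?D) (at (\<theta> s, \<xi> s))" using H frechet_derivative_works by blast
  have lin: "linear ?D" using H' has_derivative_linear by blast
  have th: "(\<theta> has_vector_derivative d) (at s)" using \<theta> by (simp add: has_real_derivative_iff_has_vector_derivative)
  have 1: "((\<lambda>s. u0 (\<theta> s)) has_vector_derivative d *\<^sub>R u0') (at s)"
    using vector_diff_chain_at[OF th u0] by (simp add: o_def)
  have 2: "((\<lambda>s. v (\<theta> s)) has_vector_derivative d *\<^sub>R v') (at s)"
    using vector_diff_chain_at[OF th v] by (simp add: o_def)
  have "((\<lambda>s. (\<theta> s, \<xi> s)) has_vector_derivative (d, g)) (at s)"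
    using th \<xi> by (rule has_vector_derivative_Pair)
  then have "((\<lambda>s. H (\<theta> s, \<xi> s)) has_derivative (\<lambda>h. ?D (h *\<^sub>R (d, g)))) (at s)"
    unfolding has_vector_derivative_def
    by (rule has_derivative_compose[where f="\<lambda>s. (\<theta> s, \<xi> s)" and g=H, OF _ H'])
  then have 3: "((\<lambda>s. H (\<theta> s, \<xi> s)) has_vector_derivative ?D (d, g)) (at s)"
    unfolding has_vector_derivative_def by (simp add: linear_cmul[OF lin] del: scaleR_Pair)
  have "(d, g) = d *\<^sub>R (1, 0) + (0, g)" by simp
  then have D: "?D (d, g) = d *\<^sub>R ?D (1, 0) + ?D (0, g)"
    by (metis linear_add[OF lin] linear_cmul[OF lin])
  have 4: "((\<lambda>s. \<xi> s *s v (\<theta> s)) has_vector_derivative \<xi> s *s (d *\<^sub>R v') + g *s v (\<theta> s)) (at s)"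
    by (rule bounded_bilinear.has_vector_derivative[OF bounded_bilinear_smult \<xi> 2])
  have 5: "((\<lambda>s. cnj (\<xi> s) *s cnj_vec (v (\<theta> s))) has_vector_derivative
       cnj (\<xi> s) *s cnj_vec (d *\<^sub>R v') + cnj g *s cnj_vec (v (\<theta> s))) (at s)"
    by (rule bounded_bilinear.has_vector_derivative[OF bounded_bilinear_smult
          bounded_linear.has_vector_derivative[OF bounded_linear_cnj \<xi>]
          bounded_linear.has_vector_derivative[OF bounded_linear_cnj_vec 2]])
  have 6: "((\<lambda>s. Re_vec (lin_part v (\<theta> s) (\<xi> s))) has_vector_derivative
      Re_vec ((\<xi> s *s (d *\<^sub>R v') + g *s v (\<theta> s)) + (cnj (\<xi> s) *s cnj_vec (d *\<^sub>R v') + cnj g *s cnj_vec (v (\<theta> s))))) (at s)"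
    unfolding lin_part_def
    by (intro bounded_linear.has_vector_derivative[OF bounded_linear_Re_vec] has_vector_derivative_add 4 5)
  have sm: "z *s (d *\<^sub>R x) = d *\<^sub>R (z *s x)" for z and x :: "complex^'a"
    by (simp add: scaleR_eq_smult vector_smult_assoc mult.commute)
  have "Re_vec ((\<xi> s *s (d *\<^sub>R v') + g *s v (\<theta> s)) + (cnj (\<xi> s) *s cnj_vec (d *\<^sub>R v') + cnj g *s cnj_vec (v (\<theta> s))))
      = d *\<^sub>R Re_vec (\<xi> s *s v' + cnj (\<xi> s) *s cnj_vec v') + Re_vec (lin_part v (\<theta> s) g)"
    by (simp add: lin_part_def linear_simps[OF bounded_linear_Re_vec] linear_simps[OF bounded_linear_cnj_vec] sm
        scaleR_add_right)
  then show ?thesis unfolding cm_param_eq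
    by (rule_tac has_vector_derivative_eq_rhs[OF has_vector_derivative_add[OF has_vector_derivative_add[OF 1 6] 3]])
       (simp add: D scaleR_add_right)
qed

text \<open>The existential witnesses \<open>r\<close>, \<open>p\<close> and \<open>q\<close> of the
  center manifold become fixed parameters. Only the data entering the invariance equation are
  collected here; the adjoint eigenfunctions and normalizations come with
  \<open>R3_normal_form\<close>.\<close>

locale R3_manifold =
  fixes F :: "real^'n \<Rightarrow> real^'n" and u0 :: "real \<Rightarrow> real^'n" and T :: real
    and v :: "real \<Rightarrow> complex^'n" and H :: "real \<times> complex \<Rightarrow> real^'n"
    and h :: "nat \<Rightarrow> nat \<Rightarrow> real \<Rightarrow> complex^'n"
    and \<alpha>1 :: real and \<alpha>2 \<alpha>3 b c :: complex and r :: real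
    and p :: "real \<times> complex \<Rightarrow> real" and q :: "real \<times> complex \<Rightarrow> complex"
  assumes F: "Ck_on 4 UNIV F"
    and per: "periodic_solution F u0 T"
    and v: "eigfun_v F u0 T v"
    and exp: "cm_expansion H h"
    and r: "r > 0"
    and H: "Ck_on 4 (UNIV \<times> ball 0 r) H"
    and sym: "\<And>\<tau> \<xi>. \<xi> \<in> ball 0 r \<Longrightarrow>
      cm_param u0 v H \<tau> \<xi> = cm_param u0 v H (\<tau> + T) (cis (- (2 * pi / 3)) * \<xi>)"
    and p: "Ck_on 1 (UNIV \<times> ball 0 r) p" and q: "Ck_on 1 (UNIV \<times> ball 0 r) q"
    and p4: "bigO4 p" and q4: "bigO4 q"
    and flow: "\<And>J \<theta> \<xi> t. open J \<Longrightarrow> is_interval J \<Longrightarrow> \<xi> ` J \<subseteq> ball 0 r \<Longrightarrow>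
      R3_flow \<alpha>1 \<alpha>2 \<alpha>3 b c p q J \<theta> \<xi> \<Longrightarrow> t \<in> J \<Longrightarrow>
      ((\<lambda>s. cm_param u0 v H (\<theta> s) (\<xi> s)) has_vector_derivative F (cm_param u0 v H (\<theta> t) (\<xi> t))) (at t)"
begin

definition a_rhs :: "real \<Rightarrow> complex \<Rightarrow> real" where
  "a_rhs \<tau> \<xi> = \<alpha>1 * (norm \<xi>)\<^sup>2 + Re (\<alpha>2 * \<xi> ^ 3 + \<alpha>3 * cnj \<xi> ^ 3) + p (\<tau>, \<xi>)"

definition g_rhs :: "real \<Rightarrow> complex \<Rightarrow> complex" where
  "g_rhs \<tau> \<xi> = b * (cnj \<xi>)\<^sup>2 + c * \<xi> * of_real ((norm \<xi>)\<^sup>2) + q (\<tau>, \<xi>)"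

text \<open>The right-hand sides are polynomials in \<xi> and its conjugate plus functions of class
  C^1, hence Lipschitz near the initial point. A local solution exists, and the hypothesis on the
  flow turns it into a solution of the original equation.\<close>

lemma local_flow:
  assumes "norm \<xi>0 < r"
  obtains \<theta> \<xi> where "\<theta> 0 = \<tau>0" "\<xi> 0 = \<xi>0"
    "(\<theta> has_real_derivative 1 + a_rhs \<tau>0 \<xi>0) (at 0)" "(\<xi> has_vector_derivative g_rhs \<tau>0 \<xi>0) (at 0)"
    "((\<lambda>s. cm_param u0 v H (\<theta> s) (\<xi> s)) has_vector_derivative F (cm_param u0 v H \<tau>0 \<xi>0)) (at 0)"
proof -
  \<comment> \<open>Half the distance to the boundary of the disc of radius \<open>r\<close>, so the
    solution stays where the manifold is parametrized.\<close>
  define \<rho> where "\<rho> = (r - norm \<xi>0) / 2"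
  have \<rho>: "\<rho> > 0" using assms by (simp add: \<rho>_def)
  let ?K = "cball (\<tau>0, \<xi>0) \<rho>"
  have K: "norm (snd x) < r" if "x \<in> ?K" for x
  proof -
    have "dist \<xi>0 (snd x) \<le> \<rho>" using that dist_snd_le[of "(\<tau>0, \<xi>0)" x] by simp
    then have "norm (snd x) \<le> norm \<xi>0 + \<rho>"
      using norm_triangle_sub[of "snd x" \<xi>0] by (simp add: dist_norm norm_minus_commute)
    then show ?thesis using assms by (simp add: \<rho>_def field_simps)
  qed
  then have KS: "?K \<subseteq> UNIV \<times> ball 0 r" by (auto simp: mem_Times_iff)
  let ?lip = "\<lambda>f. \<exists>L. L-lipschitz_on ?K f"
  have lm: "?lip (\<lambda>x. f x * g x)" if f: "?lip f" and g: "?lip g" for f g :: "real \<times> complex \<Rightarrow> complex"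
  proof -
    from f obtain C where C: "C-lipschitz_on ?K f" ..
    from g obtain D where "D-lipschitz_on ?K g" ..
    from lipschitz_on_mult_compact[OF C this compact_cball] show ?thesis by blast
  qed
  have la: "?lip (\<lambda>x. f x + g x)" if "?lip f" "?lip g" for f g :: "real \<times> complex \<Rightarrow> 'x::real_normed_vector"
    using that lipschitz_on_add by blast
  have lc: "?lip (\<lambda>x. k)" for k :: "'x::real_normed_vector"
    using lipschitz_on_constant by blast
  have ll: "?lip (\<lambda>x. L (f x))" if f: "?lip f" and L: "bounded_linear L"
    for f :: "real \<times> complex \<Rightarrow> 'x::real_normed_vector" and L :: "'x \<Rightarrow> 'y::real_normed_vector"
  proof -
    from f obtain C where C: "C-lipschitz_on ?K f" ..
    obtain D where "D-lipschitz_on (f ` ?K) L" using bounded_linear.lipschitz_boundE[OF L] by blast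
    from lipschitz_on_compose2[OF C this] show ?thesis by blast
  qed
  have lx: "?lip snd"
    by (rule exI[of _ 1], rule lipschitz_onI) (auto simp: dist_snd_le)
  have lcx: "?lip (\<lambda>x. cnj (snd x))" by (rule ll[OF lx bounded_linear_cnj])
  have lp: "?lip p" using C1_lipschitz_on_compact_convex[OF p compact_cball convex_cball KS] by blast
  have lq: "?lip q" using C1_lipschitz_on_compact_convex[OF q compact_cball convex_cball KS] by blast
  \<comment> \<open>The squared norm is written as \<xi> times its conjugate and powers as products,
    so that the closure rules above suffice.\<close>
  have "?lip (\<lambda>x. Re (1 + \<alpha>1 * (snd x * cnj (snd x)) + (\<alpha>2 * (snd x * snd x * snd x) + \<alpha>3 * (cnj (snd x) * cnj (snd x) * cnj (snd x)))) + p x)"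
    by (intro la lp ll[OF _ bounded_linear_Re] lm lc lx lcx)
  also have "(\<lambda>x. Re (1 + \<alpha>1 * (snd x * cnj (snd x)) + (\<alpha>2 * (snd x * snd x * snd x) + \<alpha>3 * (cnj (snd x) * cnj (snd x) * cnj (snd x)))) + p x)
      = (\<lambda>x. 1 + a_rhs (fst x) (snd x))"
    by (simp add: fun_eq_iff a_rhs_def complex_norm_square[symmetric] power3_eq_cube algebra_simps del: of_real_power)
  finally obtain A where A: "A-lipschitz_on ?K (\<lambda>x. 1 + a_rhs (fst x) (snd x))" ..
  have "?lip (\<lambda>x. b * (cnj (snd x) * cnj (snd x)) + c * snd x * (snd x * cnj (snd x)) + q x)"
    by (intro la lq lm lc lx lcx)
  also have "(\<lambda>x. b * (cnj (snd x) * cnj (snd x)) + c * snd x * (snd x * cnj (snd x)) + q x) = (\<lambda>x. g_rhs (fst x) (snd x))"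
    by (simp only: fun_eq_iff g_rhs_def complex_norm_square power2_eq_square[of "cnj _"] prod.collapse) simp
  finally obtain B where B: "B-lipschitz_on ?K (\<lambda>x. g_rhs (fst x) (snd x))" ..
  show ?thesis
  proof (rule local_solution_exists[OF \<rho> lipschitz_on_Pair[OF A B]])
    fix \<delta> :: real and x :: "real \<Rightarrow> real \<times> complex"
    assume \<delta>: "\<delta> > 0" and x0: "x 0 = (\<tau>0, \<xi>0)"
      and x: "\<And>t. \<bar>t\<bar> < \<delta> \<Longrightarrow> x t \<in> ?K \<and>
        (x has_vector_derivative (1 + a_rhs (fst (x t)) (snd (x t)), g_rhs (fst (x t)) (snd (x t)))) (at t)"
    let ?J = "{-\<delta><..<\<delta>}"
    have th: "((\<lambda>t. fst (x t)) has_real_derivative 1 + a_rhs (fst (x t)) (snd (x t))) (at t)"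
      and xi: "((\<lambda>t. snd (x t)) has_vector_derivative g_rhs (fst (x t)) (snd (x t))) (at t)" if "t \<in> ?J" for t
    proof -
      have "(x has_vector_derivative (1 + a_rhs (fst (x t)) (snd (x t)), g_rhs (fst (x t)) (snd (x t)))) (at t)"
        using x[of t] that by auto
      from bounded_linear.has_vector_derivative[OF bounded_linear_fst this]
        bounded_linear.has_vector_derivative[OF bounded_linear_snd this]
      show "((\<lambda>t. fst (x t)) has_real_derivative 1 + a_rhs (fst (x t)) (snd (x t))) (at t)"
        "((\<lambda>t. snd (x t)) has_vector_derivative g_rhs (fst (x t)) (snd (x t))) (at t)"
        by (simp_all add: has_real_derivative_iff_has_vector_derivative)
    qed
    have "R3_flow \<alpha>1 \<alpha>2 \<alpha>3 b c p q ?J (\<lambda>t. fst (x t)) (\<lambda>t. snd (x t))"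
      unfolding R3_flow_def
    proof (intro ballI conjI)
      fix t assume t: "t \<in> ?J"
      show "((\<lambda>t. fst (x t)) has_real_derivative
          Re (1 + of_real \<alpha>1 * of_real ((norm (snd (x t)))\<^sup>2) + \<alpha>2 * snd (x t) ^ 3 + \<alpha>3 * cnj (snd (x t)) ^ 3)
             + p (fst (x t), snd (x t))) (at t)"
        using th[OF t] unfolding a_rhs_def plus_complex.sel one_complex.sel of_real_mult[symmetric] Re_complex_of_real
        by (simp only: add.assoc)
      show "((\<lambda>t. snd (x t)) has_vector_derivative
           b * (cnj (snd (x t)))\<^sup>2 + c * snd (x t) * of_real ((norm (snd (x t)))\<^sup>2) + q (fst (x t), snd (x t))) (at t)"
        using xi[OF t] unfolding g_rhs_def .
    qed
    moreover have "open ?J" "is_interval ?J" by (auto simp: is_interval_oo)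
    moreover have "(\<lambda>t. snd (x t)) ` ?J \<subseteq> ball 0 r"
    proof
      fix z assume "z \<in> (\<lambda>t. snd (x t)) ` ?J"
      then obtain t where "z = snd (x t)" "\<bar>t\<bar> < \<delta>" by auto
      then show "z \<in> ball 0 r" using K[of "x t"] x[of t] by simp
    qed
    moreover have "0 \<in> ?J" using \<delta> by simp
    ultimately have "((\<lambda>s. cm_param u0 v H (fst (x s)) (snd (x s))) has_vector_derivative
        F (cm_param u0 v H (fst (x 0)) (snd (x 0)))) (at 0)"
      using flow[of ?J "\<lambda>t. snd (x t)" "\<lambda>t. fst (x t)" 0] by blast
    then show ?thesis
      using that[of "\<lambda>t. fst (x t)" "\<lambda>t. snd (x t)"] x0 th[of 0] xi[of 0] \<delta> by simp
  qed
qed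

lemma H_differentiable: "norm \<xi> < r \<Longrightarrow> H differentiable (at (\<tau>, \<xi>))"
  using Ck_on_Suc_differentiable[of 0 "UNIV \<times> ball 0 r" H "(\<tau>, \<xi>)"] Ck_on_mono[of 1 4, OF _ H] by simp

lemma v_derivative:
  assumes "\<tau> \<in> {0..T}"
  shows "(v has_vector_derivative formA F (u0 \<tau>) *v v \<tau>) (at \<tau> within {0..T})"
  using v assms by (simp add: eigfun_v_def)

lemma u0_derivative: "(u0 has_vector_derivative F (u0 \<tau>)) (at \<tau>)"
  using per by (simp add: periodic_solution_def)

lemma T_pos: "T > 0"
  using per by (simp add: periodic_solution_def)

text \<open>The velocity of the image of a normal form solution is computed twice, by the chain rule
  and as a value of \<open>F\<close>; the curve with frozen \<xi> shows that the term multiplied by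
  1 + a is the \<tau>-derivative. Times are interior because the derivative of \<open>v\<close> is
  given only relative to [0, T].\<close>

lemma invariance:
  assumes \<tau>: "\<tau> \<in> {0<..<T}" and \<xi>: "norm \<xi> < r" and pos: "1 + a_rhs \<tau> \<xi> \<noteq> 0"
  shows "((\<lambda>s. cm_param u0 v H s \<xi>) has_vector_derivative
     (F (cm_param u0 v H \<tau> \<xi>) - Re_vec (lin_part v \<tau> (g_rhs \<tau> \<xi>))
        - frechet_derivative H (at (\<tau>, \<xi>)) (0, g_rhs \<tau> \<xi>)) /\<^sub>R (1 + a_rhs \<tau> \<xi>)) (at \<tau>)"
proof -
  let ?v' = "formA F (u0 \<tau>) *v v \<tau>" and ?D = "frechet_derivative H (at (\<tau>, \<xi>))"
  let ?U = "F (u0 \<tau>) + Re_vec (\<xi> *s ?v' + cnj \<xi> *s cnj_vec ?v') + ?D (1, 0)"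
  have v': "(v has_vector_derivative ?v') (at \<tau>)"
    using v_derivative[of \<tau>] \<tau> at_within_Icc_at[of 0 \<tau> T] by auto
  obtain \<theta> z where z: "\<theta> 0 = \<tau>" "z 0 = \<xi>"
    "(\<theta> has_real_derivative 1 + a_rhs \<tau> \<xi>) (at 0)" "(z has_vector_derivative g_rhs \<tau> \<xi>) (at 0)"
    "((\<lambda>s. cm_param u0 v H (\<theta> s) (z s)) has_vector_derivative F (cm_param u0 v H \<tau> \<xi>)) (at 0)"
    using local_flow[OF \<xi>] by blast
  have "((\<lambda>s. cm_param u0 v H (\<theta> s) (z s)) has_vector_derivative
      (1 + a_rhs \<tau> \<xi>) *\<^sub>R ?U + Re_vec (lin_part v \<tau> (g_rhs \<tau> \<xi>)) + ?D (0, g_rhs \<tau> \<xi>)) (at 0)"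
    using cm_param_chain[of u0 "F (u0 \<tau>)" \<theta> 0 v ?v' H z] z v' u0_derivative H_differentiable[OF \<xi>] by simp
  from vector_derivative_unique_at[OF this z(5)]
  have aU: "(1 + a_rhs \<tau> \<xi>) *\<^sub>R ?U = F (cm_param u0 v H \<tau> \<xi>) - Re_vec (lin_part v \<tau> (g_rhs \<tau> \<xi>)) - ?D (0, g_rhs \<tau> \<xi>)"
    by (simp add: algebra_simps)
  have U: "?U = (F (cm_param u0 v H \<tau> \<xi>) - Re_vec (lin_part v \<tau> (g_rhs \<tau> \<xi>)) - ?D (0, g_rhs \<tau> \<xi>)) /\<^sub>R (1 + a_rhs \<tau> \<xi>)"
    unfolding aU[symmetric] scaleR_scaleR left_inverse[OF pos] scaleR_one ..
  have "linear ?D" using H_differentiable[OF \<xi>] by (rule linear_frechet_derivative)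
  then have D0: "?D (0, 0) = 0" unfolding zero_prod_def[symmetric] by (rule linear_0)
  have R0: "Re_vec (lin_part v \<tau> 0) = 0"
    by (simp add: lin_part_def linear_simps[OF bounded_linear_Re_vec])
  have "((\<lambda>s. cm_param u0 v H s \<xi>) has_vector_derivative ?U) (at \<tau>)"
    using cm_param_chain[of u0 "F (u0 \<tau>)" "\<lambda>s. s" \<tau> v ?v' H "\<lambda>_. \<xi>" 1 0] v' u0_derivative H_differentiable[OF \<xi>]
    by (simp add: D0 R0)
  then show ?thesis by (simp only: U)
qed

end

section \<open>Expansion of the invariance equation\<close>

text \<open>The argument \<open>z\<close> may depend on \<tau>: besides the ray \<epsilon> w, the
  displaced point \<epsilon> w + g is inserted.\<close>

lemma bigO4_Oe:
  assumes "bigO4 R" "Oe S 1 z"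
  shows "Oe S 4 (\<lambda>\<tau> \<epsilon>. R (\<tau>, z \<tau> \<epsilon>))"
proof -
  obtain K d where K: "d > 0" "\<And>\<tau> \<xi>. norm \<xi> < d \<Longrightarrow> norm (R (\<tau>, \<xi>)) \<le> K * norm \<xi> ^ 4"
    using assms(1) unfolding bigO4_def by blast
  obtain K' d' where K': "K' \<ge> 0" "d' > 0" "\<And>\<tau> \<epsilon>. \<tau> \<in> S \<Longrightarrow> 0 < \<epsilon> \<Longrightarrow> \<epsilon> < d' \<Longrightarrow> norm (z \<tau> \<epsilon>) \<le> K' * \<epsilon> ^ 1"
    using OeE[OF assms(2)] by metis
  show ?thesis
  proof (rule OeI[where \<delta>="min d' (d / (K' + 1))"])
    fix \<tau> \<epsilon> assume *: "\<tau> \<in> S" "0 < \<epsilon>" "\<epsilon> < min d' (d / (K' + 1))"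
    have z: "norm (z \<tau> \<epsilon>) \<le> K' * \<epsilon>" using K'(3)[of \<tau> \<epsilon>] * by simp
    also have "\<dots> < (K' + 1) * \<epsilon>" using * by simp
    also have "\<dots> < d" using * K' by (simp add: field_simps)
    finally have "norm (R (\<tau>, z \<tau> \<epsilon>)) \<le> K * norm (z \<tau> \<epsilon>) ^ 4" by (rule K(2))
    also have "\<dots> \<le> \<bar>K\<bar> * (K' * \<epsilon>) ^ 4"
      using z by (intro mult_mono power_mono) auto
    finally show "norm (R (\<tau>, z \<tau> \<epsilon>)) \<le> (\<bar>K\<bar> * K' ^ 4) * \<epsilon> ^ 4" by (simp add: power_mult_distrib)
  qed (use K K' in auto)
qed

lemma Oe_ray: "Oe S 1 (\<lambda>\<tau> \<epsilon>. of_real \<epsilon> * (w :: complex))"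
  by (rule OeI[where \<delta>=1 and K="norm w"]) (auto simp: norm_mult)

lemma Oe_small:
  assumes "Oe S 1 f" "e > 0"
  obtains \<delta> where "\<delta> > 0" "\<And>\<tau> \<epsilon>. \<tau> \<in> S \<Longrightarrow> 0 < \<epsilon> \<Longrightarrow> \<epsilon> < \<delta> \<Longrightarrow> norm (f \<tau> \<epsilon>) < e"
proof -
  obtain K d where K: "K \<ge> 0" "d > 0" "\<And>\<tau> \<epsilon>. \<tau> \<in> S \<Longrightarrow> 0 < \<epsilon> \<Longrightarrow> \<epsilon> < d \<Longrightarrow> norm (f \<tau> \<epsilon>) \<le> K * \<epsilon> ^ 1"
    using OeE[OF assms(1)] by metis
  show ?thesis
  proof (rule that[of "min d (e / (K + 1))"])
    fix \<tau> \<epsilon> assume *: "\<tau> \<in> S" "0 < \<epsilon>" "\<epsilon> < min d (e / (K + 1))"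
    have "norm (f \<tau> \<epsilon>) \<le> K * \<epsilon>" using K(3)[of \<tau> \<epsilon>] * by simp
    also have "\<dots> < (K + 1) * \<epsilon>" using * by simp
    also have "\<dots> < e" using * K by (simp add: field_simps)
    finally show "norm (f \<tau> \<epsilon>) < e" .
  qed (use K assms in auto)
qed

text \<open>The quadratic homogeneous part of the expansion of \<open>H\<close>, and below the cubic
  one. The family \<open>h\<close> is an argument so that the same polynomial can be formed from
  time-shifted coefficients and from the right-hand sides of their equations.\<close>

definition Q2 :: "(nat \<Rightarrow> nat \<Rightarrow> real \<Rightarrow> complex^'n) \<Rightarrow> complex \<Rightarrow> real \<Rightarrow> complex^'n" where
  "Q2 h w \<tau> = (w\<^sup>2 / 2) *s h 2 0 \<tau> + (w * cnj w) *s h 1 1 \<tau> + ((cnj w)\<^sup>2 / 2) *s h 0 2 \<tau>"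

definition Q3 :: "(nat \<Rightarrow> nat \<Rightarrow> real \<Rightarrow> complex^'n) \<Rightarrow> complex \<Rightarrow> real \<Rightarrow> complex^'n" where
  "Q3 h w \<tau> = (w ^ 3 / 6) *s h 3 0 \<tau> + (w\<^sup>2 * cnj w / 2) *s h 2 1 \<tau> + (w * (cnj w)\<^sup>2 / 2) *s h 1 2 \<tau>
     + ((cnj w) ^ 3 / 6) *s h 0 3 \<tau>"

lemma Q2_scale: "Q2 h (of_real \<epsilon> * w) \<tau> = \<epsilon>\<^sup>2 *\<^sub>R Q2 h w \<tau>"
  unfolding Q2_def scaleR_eq_smult vec_eq_iff
  by (simp add: power2_eq_square distrib_left mult.assoc mult.left_commute)

lemma Q3_scale: "Q3 h (of_real \<epsilon> * w) \<tau> = \<epsilon> ^ 3 *\<^sub>R Q3 h w \<tau>"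
  unfolding Q3_def scaleR_eq_smult vec_eq_iff
  by (simp add: power2_eq_square power3_eq_cube distrib_left mult.assoc mult.left_commute)

lemma expansion_sum:
  "(\<Sum>(k, l) | 2 \<le> k + l \<and> k + l \<le> 3. (\<xi> ^ k * cnj \<xi> ^ l / (fact k * fact l)) *s h k l \<tau>) = Q2 h \<xi> \<tau> + Q3 h \<xi> \<tau>"
proof -
  have "{(k, l). 2 \<le> k + l \<and> k + l \<le> (3::nat)} = {(2,0), (1,1), (0,2), (3,0), (2,1), (1,2), (0,3)}" (is "?A = ?B")
  proof (rule set_eqI)
    fix x :: "nat \<times> nat"
    obtain k l where x: "x = (k, l)" by (cases x)
    show "x \<in> ?A \<longleftrightarrow> x \<in> ?B" unfolding x by (simp, presburger)
  qed
  then show ?thesis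
    by (simp add: Q2_def Q3_def fact_numeral add.assoc)
qed

lemma jacobian_nth: "jacobian F (at x) $ i $ j = partial j F x $ i"
  by (simp add: jacobian_def matrix_def partial_def)

lemma formA_scaleR: "formA F x *v (r *\<^sub>R y) = r *\<^sub>R (formA F x *v y)"
  unfolding scaleR_eq_smult by (rule vector_scalar_commute)

lemma formB_scaleR: "formB F x (r *\<^sub>R y) z = r *\<^sub>R formB F x y z" "formB F x y (r *\<^sub>R z) = r *\<^sub>R formB F x y z"
  unfolding scaleR_eq_smult by (rule formB_smult_left formB_smult_right)+

lemma formC_scaleR: "formC F x (r *\<^sub>R y) z w = r *\<^sub>R formC F x y z w"
  "formC F x y (r *\<^sub>R z) w = r *\<^sub>R formC F x y z w" "formC F x y z (r *\<^sub>R w) = r *\<^sub>R formC F x y z w"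
  unfolding scaleR_eq_smult by (rule formC_smult1 formC_smult2 formC_smult3)+

lemma lin_part_scaleR: "lin_part v \<tau> (r *\<^sub>R z) = r *\<^sub>R lin_part v \<tau> z"
  by (simp add: lin_part_def vec_eq_iff scaleR_add_right)

lemma lin_part_add: "lin_part v \<tau> (x + y) = lin_part v \<tau> x + lin_part v \<tau> y"
  by (simp add: lin_part_def vec_eq_iff distrib_right)

lemma lin_part_diff: "lin_part v \<tau> (x - y) = lin_part v \<tau> x - lin_part v \<tau> y"
  by (simp add: lin_part_def vec_eq_iff left_diff_distrib)

lemma norm_lin_part_le: "norm (lin_part v \<tau> z) \<le> 2 * (norm z * norm (v \<tau>))"
  unfolding lin_part_def using norm_triangle_ineq[of "z *s v \<tau>" "cnj z *s cnj_vec (v \<tau>)"]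
  by (simp add: norm_vector_smult norm_cnj_vec)

section \<open>Expansion of \<open>H\<close> along rays and continuity of its homogeneous
  parts\<close>

context R3_manifold
begin

lemma h_cnj: "h k l \<tau> = cnj_vec (h l k \<tau>)"
  using exp unfolding cm_expansion_def by blast

lemma H_expansion:
  assumes "Oe S 1 z"
  shows "Oe S 4 (\<lambda>\<tau> \<epsilon>. cvec (H (\<tau>, z \<tau> \<epsilon>)) - (Q2 h (z \<tau> \<epsilon>) \<tau> + Q3 h (z \<tau> \<epsilon>) \<tau>))"
proof -
  have "bigO4 (\<lambda>(\<tau>, \<xi>). cvec (H (\<tau>, \<xi>)) - (Q2 h \<xi> \<tau> + Q3 h \<xi> \<tau>))"
    using exp unfolding cm_expansion_def expansion_sum by (rule conjunct2)
  from bigO4_Oe[OF this assms] show ?thesis by (simp only: prod.case)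
qed

lemma H_ray_expansion: "Oe S 4 (\<lambda>\<tau> \<epsilon>. cvec (H (\<tau>, of_real \<epsilon> * w)) - (\<epsilon> ^ 2 *\<^sub>R Q2 h w \<tau> + \<epsilon> ^ 3 *\<^sub>R Q3 h w \<tau>))"
  using H_expansion[OF Oe_ray, of S w] by (simp add: Q2_scale Q3_scale)

lemma continuous_on_H: "norm \<xi> < r \<Longrightarrow> continuous_on S (\<lambda>\<tau>. cvec (H (\<tau>, \<xi>)))"
proof (rule bounded_linear.continuous_on[OF bounded_linear_cvec])
  assume "norm \<xi> < r"
  then show "continuous_on S (\<lambda>\<tau>. H (\<tau>, \<xi>))"
    by (intro continuous_on_compose2[OF Ck_on_imp_continuous_on[OF H], of S "\<lambda>\<tau>. (\<tau>, \<xi>)"])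
      (auto intro!: continuous_intros)
qed

lemma ray_small: "\<exists>\<delta>>0. \<forall>\<epsilon>. 0 < \<epsilon> \<and> \<epsilon> < \<delta> \<longrightarrow> norm (complex_of_real \<epsilon> * w) < r"
proof (rule Oe_small[OF Oe_ray[of "{0}" w] r])
  fix \<delta> :: real
  assume "\<delta> > 0" "\<And>\<tau> \<epsilon>. \<tau> \<in> {0::real} \<Longrightarrow> 0 < \<epsilon> \<Longrightarrow> \<epsilon> < \<delta> \<Longrightarrow> norm (complex_of_real \<epsilon> * w) < r"
  then show ?thesis by auto
qed

text \<open>The parts of \<open>H\<close> that are even and odd in \<open>w\<close> isolate \<open>Q2\<close> and \<open>Q3\<close>.\<close>

lemma continuous_on_Q2: "continuous_on S (Q2 h w)"
proof -
  have m: "Q2 h (- w) = Q2 h w" "Q3 h (- w) \<tau> = - Q3 h w \<tau>" for \<tau>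
    by (simp_all add: Q2_def Q3_def fun_eq_iff vec_eq_iff)
  obtain \<delta> where \<delta>: "\<delta> > 0" "\<And>\<epsilon>. 0 < \<epsilon> \<Longrightarrow> \<epsilon> < \<delta> \<Longrightarrow> norm (complex_of_real \<epsilon> * w) < r"
    using ray_small[of w] by blast
  let ?G = "\<lambda>\<tau> \<epsilon>. (inverse (2 * \<epsilon> ^ 2)) *\<^sub>R (cvec (H (\<tau>, of_real \<epsilon> * w)) + cvec (H (\<tau>, of_real \<epsilon> * (- w))))"
  have "Oe S 4 (\<lambda>\<tau> \<epsilon>. cvec (H (\<tau>, of_real \<epsilon> * w)) + cvec (H (\<tau>, of_real \<epsilon> * (- w))) - (2 * \<epsilon> ^ 2) *\<^sub>R Q2 h w \<tau>)"
    by (rule Oe_eq[OF Oe_add[OF H_ray_expansion[of S w] H_ray_expansion[of S "- w"]]])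
       (simp add: m scaleR_2[symmetric] algebra_simps)
  then have "Oe S 4 (\<lambda>\<tau> \<epsilon>. \<epsilon> *\<^sub>R (\<epsilon> *\<^sub>R (2 *\<^sub>R (?G \<tau> \<epsilon> - Q2 h w \<tau>))))"
    by (rule Oe_cong[of _ _ _ 1]) (auto simp: algebra_simps power2_eq_square divide_simps)
  then have "Oe S (Suc (Suc 2)) (\<lambda>\<tau> \<epsilon>. \<epsilon> *\<^sub>R (\<epsilon> *\<^sub>R (2 *\<^sub>R (?G \<tau> \<epsilon> - Q2 h w \<tau>))))" by simp
  from Oe_scaleR_cancel[OF Oe_scaleR_cancel[OF this]]
  have "Oe S 1 (\<lambda>\<tau> \<epsilon>. 2 *\<^sub>R (?G \<tau> \<epsilon> - Q2 h w \<tau>))"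
    by (rule Oe_mono) simp
  then have "Oe S 1 (\<lambda>\<tau> \<epsilon>. ?G \<tau> \<epsilon> - Q2 h w \<tau>)"
    by (rule Oe_dominated[where \<delta>=1 and C=1]) auto
  then show ?thesis
    by (rule Oe_uniform_limit_continuous[OF _ \<delta>(1)]) (use \<delta>(2) in \<open>auto intro!: continuous_intros continuous_on_H simp: norm_mult\<close>)
qed

lemma continuous_on_Q3: "continuous_on S (Q3 h w)"
proof -
  have m: "Q2 h (- w) = Q2 h w" "Q3 h (- w) \<tau> = - Q3 h w \<tau>" for \<tau>
    by (simp_all add: Q2_def Q3_def fun_eq_iff vec_eq_iff)
  obtain \<delta> where \<delta>: "\<delta> > 0" "\<And>\<epsilon>. 0 < \<epsilon> \<Longrightarrow> \<epsilon> < \<delta> \<Longrightarrow> norm (complex_of_real \<epsilon> * w) < r"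
    using ray_small[of w] by blast
  let ?G = "\<lambda>\<tau> \<epsilon>. (inverse (2 * \<epsilon> ^ 3)) *\<^sub>R (cvec (H (\<tau>, of_real \<epsilon> * w)) - cvec (H (\<tau>, of_real \<epsilon> * (- w))))"
  have "Oe S 4 (\<lambda>\<tau> \<epsilon>. cvec (H (\<tau>, of_real \<epsilon> * w)) - cvec (H (\<tau>, of_real \<epsilon> * (- w))) - (2 * \<epsilon> ^ 3) *\<^sub>R Q3 h w \<tau>)"
    by (rule Oe_eq[OF Oe_diff[OF H_ray_expansion[of S w] H_ray_expansion[of S "- w"]]])
       (simp add: m scaleR_2[symmetric] algebra_simps)
  then have "Oe S 4 (\<lambda>\<tau> \<epsilon>. \<epsilon> *\<^sub>R (\<epsilon> *\<^sub>R (\<epsilon> *\<^sub>R (2 *\<^sub>R (?G \<tau> \<epsilon> - Q3 h w \<tau>)))))"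
    by (rule Oe_cong[of _ _ _ 1]) (auto simp: algebra_simps power3_eq_cube divide_simps)
  then have "Oe S (Suc (Suc (Suc 1))) (\<lambda>\<tau> \<epsilon>. \<epsilon> *\<^sub>R (\<epsilon> *\<^sub>R (\<epsilon> *\<^sub>R (2 *\<^sub>R (?G \<tau> \<epsilon> - Q3 h w \<tau>)))))"
    by (simp add: eval_nat_numeral)
  \<comment> \<open>Three divisions by \<epsilon> reduce order four to order one, just enough for
    uniform convergence.\<close>
  from Oe_scaleR_cancel[OF Oe_scaleR_cancel[OF Oe_scaleR_cancel[OF this]]]
  have "Oe S 1 (\<lambda>\<tau> \<epsilon>. ?G \<tau> \<epsilon> - Q3 h w \<tau>)"
    by (rule Oe_dominated[where \<delta>=1 and C=1]) auto
  then show ?thesis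
    by (rule Oe_uniform_limit_continuous[OF _ \<delta>(1)]) (use \<delta>(2) in \<open>auto intro!: continuous_intros continuous_on_H simp: norm_mult\<close>)
qed

end

text \<open>Polarization: \<open>Q2\<close> at 1 minus \<open>Q2\<close> at \<i> gives
  \<open>h 2 0 + h 0 2\<close>, while the second difference at 1 + \<i> gives \<i> times
  \<open>h 2 0 - h 0 2\<close>.\<close>

lemma h20_eq_Q2: "h 2 0 \<tau> = (1/2) *s (Q2 h 1 \<tau> - Q2 h \<i> \<tau> - \<i> *s (Q2 h (1 + \<i>) \<tau> - Q2 h 1 \<tau> - Q2 h \<i> \<tau>))"
  and h11_eq_Q2: "h 1 1 \<tau> = (1/2) *s (Q2 h 1 \<tau> + Q2 h \<i> \<tau>)"
  by (simp_all add: Q2_def vec_eq_iff power2_eq_square complex_eq_iff algebra_simps)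

text \<open>The points are real multiples of the eighth roots of unity with arguments \<open>0, \<pi>/2, \<pi>/4, 3\<pi>/4\<close>,
  and the weights average over them.\<close>

lemma h21_eq_Q3: "h 2 1 \<tau> = (1/2) *s (Q3 h 1 \<tau> - \<i> *s Q3 h \<i> \<tau> + ((1 - \<i>) / 4) *s Q3 h (1 + \<i>) \<tau>
    - ((1 + \<i>) / 4) *s Q3 h (- 1 + \<i>) \<tau>)"
  unfolding vec_eq_iff complex_eq_iff
  by (intro allI conjI; simp add: Q3_def power2_eq_square power3_eq_cube; linarith)

lemma h30_eq_Q3: "h 3 0 \<tau> = (3/2) *s (Q3 h 1 \<tau> + \<i> *s Q3 h \<i> \<tau> - ((1 + \<i>) / 4) *s Q3 h (1 + \<i>) \<tau>
    + ((1 - \<i>) / 4) *s Q3 h (- 1 + \<i>) \<tau>)"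
  unfolding vec_eq_iff complex_eq_iff
  by (intro allI conjI; simp add: Q3_def power2_eq_square power3_eq_cube; linarith)

lemma continuous_on_smult:
  fixes g :: "'a::topological_space \<Rightarrow> complex^'n"
  assumes "continuous_on S f" "continuous_on S g"
  shows "continuous_on S (\<lambda>x. f x *s g x)"
  using bounded_bilinear.continuous_on[OF bounded_bilinear_smult assms] .

lemma continuous_on_cnj_vec: "continuous_on S f \<Longrightarrow> continuous_on S (\<lambda>x. cnj_vec (f x))"
  by (rule bounded_linear.continuous_on[OF bounded_linear_cnj_vec])

lemma continuous_on_cvec: "continuous_on S f \<Longrightarrow> continuous_on S (\<lambda>x. cvec (f x))"
  by (rule bounded_linear.continuous_on[OF bounded_linear_cvec])

lemma continuous_on_vec_nth:
  fixes f :: "'a::topological_space \<Rightarrow> 'b::real_normed_vector^'n"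
  shows "continuous_on S f \<Longrightarrow> continuous_on S (\<lambda>x. f x $ i)"
  by (rule bounded_linear.continuous_on[OF bounded_linear_vec_nth])

section \<open>Continuity and uniform bounds along the cycle\<close>

context R3_manifold
begin

abbreviation "I \<equiv> {0..T}"

lemma continuous_on_u0: "continuous_on S u0"
  by (intro continuous_at_imp_continuous_on ballI has_vector_derivative_continuous[OF u0_derivative])

lemma continuous_on_v: "continuous_on I v"
  by (rule continuous_on_vector_derivative[OF v_derivative])

lemma continuous_on_along_u0: "Ck_on k UNIV (G :: real^'n \<Rightarrow> real^'n) \<Longrightarrow> continuous_on S (\<lambda>\<tau>. G (u0 \<tau>))"
  by (rule continuous_on_compose2[OF Ck_on_imp_continuous_on continuous_on_u0]) auto

lemma F_iterated_Ck:
  "Ck_on 3 UNIV (partial j F)" "Ck_on 2 UNIV (partial k (partial j F))" "Ck_on 1 UNIV (partial l (partial k (partial j F)))"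
proof -
  have "(4::nat) = Suc 3" "(3::nat) = Suc 2" "(2::nat) = Suc 1" by auto
  then show "Ck_on 3 UNIV (partial j F)" "Ck_on 2 UNIV (partial k (partial j F))" "Ck_on 1 UNIV (partial l (partial k (partial j F)))"
    using F Ck_on_partial by metis+
qed

lemma F_Ck: "Ck_on 3 UNIV F" "Ck_on 2 UNIV F" "Ck_on 1 UNIV F"
  by (rule Ck_on_mono[OF _ F]; simp)+

lemmas continuous_on_partials =
  F_iterated_Ck[THEN continuous_on_along_u0]

lemma continuous_on_formA: "continuous_on S y \<Longrightarrow> continuous_on S (\<lambda>\<tau>. formA F (u0 \<tau>) *v y \<tau>)"
  unfolding formA_def cmat_def map_matrix_def matrix_vector_mult_def vec_lambda_beta jacobian_nth
  by (intro continuous_on_vec_lambda continuous_intros continuous_on_vec_nth continuous_on_partials)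

lemma continuous_on_formB:
  "continuous_on S y \<Longrightarrow> continuous_on S z \<Longrightarrow> continuous_on S (\<lambda>\<tau>. formB F (u0 \<tau>) (y \<tau>) (z \<tau>))"
  unfolding formB_def
  by (intro continuous_on_sum continuous_on_smult continuous_on_mult continuous_on_vec_nth continuous_on_cvec continuous_on_partials)

lemma continuous_on_formC:
  "continuous_on S y \<Longrightarrow> continuous_on S z \<Longrightarrow> continuous_on S w \<Longrightarrow>
    continuous_on S (\<lambda>\<tau>. formC F (u0 \<tau>) (y \<tau>) (z \<tau>) (w \<tau>))"
  unfolding formC_def
  by (intro continuous_on_sum continuous_on_smult continuous_on_mult continuous_on_vec_nth continuous_on_cvec continuous_on_partials)

lemma continuous_on_lin_part: "continuous_on I (\<lambda>\<tau>. lin_part v \<tau> z)"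
  unfolding lin_part_def
  by (intro continuous_intros continuous_on_smult continuous_on_cnj_vec continuous_on_v)

lemma continuous_on_F0: "continuous_on S (\<lambda>\<tau>. cvec (F (u0 \<tau>)))"
  by (intro continuous_on_cvec continuous_on_along_u0[OF F])

lemma continuous_on_h:
  "continuous_on S (h 2 0)" "continuous_on S (h 1 1)" "continuous_on S (h 0 2)"
  "continuous_on S (h 3 0)" "continuous_on S (h 2 1)" "continuous_on S (h 1 2)" "continuous_on S (h 0 3)"
proof -
  note Q = continuous_on_Q2[of S] continuous_on_Q3[of S]
  have 1: "h 2 0 = (\<lambda>\<tau>. (1/2) *s (Q2 h 1 \<tau> - Q2 h \<i> \<tau> - \<i> *s (Q2 h (1 + \<i>) \<tau> - Q2 h 1 \<tau> - Q2 h \<i> \<tau>)))"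
    and 2: "h 1 1 = (\<lambda>\<tau>. (1/2) *s (Q2 h 1 \<tau> + Q2 h \<i> \<tau>))"
    and 3: "h 2 1 = (\<lambda>\<tau>. (1/2) *s (Q3 h 1 \<tau> - \<i> *s Q3 h \<i> \<tau> + ((1 - \<i>) / 4) *s Q3 h (1 + \<i>) \<tau>
      - ((1 + \<i>) / 4) *s Q3 h (- 1 + \<i>) \<tau>))"
    and 4: "h 3 0 = (\<lambda>\<tau>. (3/2) *s (Q3 h 1 \<tau> + \<i> *s Q3 h \<i> \<tau> - ((1 + \<i>) / 4) *s Q3 h (1 + \<i>) \<tau>
      + ((1 - \<i>) / 4) *s Q3 h (- 1 + \<i>) \<tau>))"
    by (rule ext, rule h20_eq_Q2 h11_eq_Q2 h21_eq_Q3 h30_eq_Q3)+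
  show c20: "continuous_on S (h 2 0)"
    by (subst 1) (intro continuous_intros continuous_on_smult Q)
  show "continuous_on S (h 1 1)"
    by (subst 2) (intro continuous_intros continuous_on_smult Q)
  show c21: "continuous_on S (h 2 1)"
    by (subst 3) (intro continuous_intros continuous_on_smult Q)
  show c30: "continuous_on S (h 3 0)"
    by (subst 4) (intro continuous_intros continuous_on_smult Q)
  have "h l k = (\<lambda>\<tau>. cnj_vec (h k l \<tau>))" for k l using h_cnj by blast
  then show "continuous_on S (h 0 2)" "continuous_on S (h 1 2)" "continuous_on S (h 0 3)"
    using continuous_on_cnj_vec c20 c21 c30 by metis+
qed

lemma Oe_cont: "continuous_on I a \<Longrightarrow> Oe I 0 (\<lambda>\<tau> \<epsilon>. a \<tau>)"
  by (rule Oe_continuous) auto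

lemma bounded_on_I:
  assumes "continuous_on I (a :: real \<Rightarrow> real)"
  obtains M where "\<And>\<tau>. \<tau> \<in> I \<Longrightarrow> a \<tau> \<le> M"
proof -
  have "bounded (a ` I)" using assms by (intro compact_imp_bounded compact_continuous_image) auto
  then obtain M where M: "\<And>x. x \<in> a ` I \<Longrightarrow> norm x \<le> M" by (auto simp: bounded_iff)
  show ?thesis
  proof (rule that)
    fix \<tau> assume "\<tau> \<in> I"
    then show "a \<tau> \<le> M" using M[of "a \<tau>"] by auto
  qed
qed

lemma continuous_formA_entry: "continuous_on S (\<lambda>\<tau>. formA F (u0 \<tau>) $ i $ j)"
  unfolding formA_def cmat_def map_matrix_def vec_lambda_beta jacobian_nth
  by (intro continuous_on_of_real continuous_on_vec_nth continuous_on_partials)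

lemma Oe_formA:
  assumes "Oe I m y"
  shows "Oe I m (\<lambda>\<tau> \<epsilon>. formA F (u0 \<tau>) *v y \<tau> \<epsilon>)"
proof -
  have cont: "continuous_on I (\<lambda>\<tau>. \<Sum>i\<in>UNIV. \<Sum>j\<in>UNIV. norm (formA F (u0 \<tau>) $ i $ j))"
    by (intro continuous_on_sum continuous_on_norm continuous_formA_entry)
  obtain M where M: "\<And>\<tau>. \<tau> \<in> I \<Longrightarrow> (\<Sum>i\<in>UNIV. \<Sum>j\<in>UNIV. norm (formA F (u0 \<tau>) $ i $ j)) \<le> M"
    using bounded_on_I[OF cont] by blast
  show ?thesis
  proof (rule Oe_dominated[OF assms zero_less_one])
    fix \<tau> \<epsilon> :: real assume "\<tau> \<in> I"
    from order_trans[OF norm_matrix_vector_le mult_right_mono[OF M[OF this] norm_ge_zero]]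
    show "norm (formA F (u0 \<tau>) *v y \<tau> \<epsilon>) \<le> M * norm (y \<tau> \<epsilon>)" .
  qed
qed

lemma Oe_formB:
  assumes "Oe I m y" "Oe I k z"
  shows "Oe I (m + k) (\<lambda>\<tau> \<epsilon>. formB F (u0 \<tau>) (y \<tau> \<epsilon>) (z \<tau> \<epsilon>))"
proof -
  have cont: "continuous_on I (\<lambda>\<tau>. \<Sum>j\<in>UNIV. \<Sum>k\<in>UNIV. norm (partial j (partial k F) (u0 \<tau>)))"
    by (intro continuous_intros continuous_on_partials)
  obtain M where M: "\<And>\<tau>. \<tau> \<in> I \<Longrightarrow> (\<Sum>j\<in>UNIV. \<Sum>k\<in>UNIV. norm (partial j (partial k F) (u0 \<tau>))) \<le> M"
    using bounded_on_I[OF cont] by blast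
  show ?thesis
  proof (rule Oe_product[OF assms])
    fix \<tau> \<epsilon> :: real assume "\<tau> \<in> I"
    from order_trans[OF norm_formB_le mult_right_mono[OF M[OF this]]]
    show "norm (formB F (u0 \<tau>) (y \<tau> \<epsilon>) (z \<tau> \<epsilon>)) \<le> M * (norm (y \<tau> \<epsilon>) * norm (z \<tau> \<epsilon>))" by simp
  qed
qed

lemma Oe_formC:
  assumes "Oe I m y" "Oe I k z" "Oe I l w"
  shows "Oe I (m + k + l) (\<lambda>\<tau> \<epsilon>. formC F (u0 \<tau>) (y \<tau> \<epsilon>) (z \<tau> \<epsilon>) (w \<tau> \<epsilon>))"
proof -
  have cont: "continuous_on I (\<lambda>\<tau>. \<Sum>j\<in>UNIV. \<Sum>k\<in>UNIV. \<Sum>l\<in>UNIV. norm (partial j (partial k (partial l F)) (u0 \<tau>)))"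
    by (intro continuous_intros continuous_on_partials)
  obtain M where M: "\<And>\<tau>. \<tau> \<in> I \<Longrightarrow> (\<Sum>j\<in>UNIV. \<Sum>k\<in>UNIV. \<Sum>l\<in>UNIV. norm (partial j (partial k (partial l F)) (u0 \<tau>))) \<le> M"
    using bounded_on_I[OF cont] by blast
  have yz: "Oe I (m + k) (\<lambda>\<tau> \<epsilon>. norm (y \<tau> \<epsilon>) * norm (z \<tau> \<epsilon>))"
    by (rule Oe_product[OF assms(1,2), where C=1]) simp
  show ?thesis
  proof (rule Oe_product[OF yz assms(3)])
    fix \<tau> \<epsilon> :: real assume "\<tau> \<in> I"
    from order_trans[OF norm_formC_le mult_right_mono[OF M[OF this]]]
    show "norm (formC F (u0 \<tau>) (y \<tau> \<epsilon>) (z \<tau> \<epsilon>) (w \<tau> \<epsilon>)) \<le>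
        M * (norm (norm (y \<tau> \<epsilon>) * norm (z \<tau> \<epsilon>)) * norm (w \<tau> \<epsilon>))" by simp
  qed
qed

lemma Oe_lin_part:
  assumes "Oe I m z"
  shows "Oe I m (\<lambda>\<tau> \<epsilon>. lin_part v \<tau> (z \<tau> \<epsilon>))"
proof -
  have "Oe I (m + 0) (\<lambda>\<tau> \<epsilon>. lin_part v \<tau> (z \<tau> \<epsilon>))"
    by (rule Oe_product[OF assms Oe_cont[OF continuous_on_v]]) (rule norm_lin_part_le)
  then show ?thesis by simp
qed

section \<open>Expansion of each term of the invariance equation along a ray\<close>

lemma lin_part_ray: "lin_part v \<tau> (of_real \<epsilon> * w) = \<epsilon> *\<^sub>R lin_part v \<tau> w"
  using lin_part_scaleR[of v \<tau> \<epsilon> w] by (simp add: scaleR_conv_of_real)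

lemma cm_param_expansion:
  "Oe I 4 (\<lambda>\<tau> \<epsilon>. cvec (cm_param u0 v H \<tau> (of_real \<epsilon> * w)) -
     (cvec (u0 \<tau>) + \<epsilon> *\<^sub>R lin_part v \<tau> w + \<epsilon> ^ 2 *\<^sub>R Q2 h w \<tau> + \<epsilon> ^ 3 *\<^sub>R Q3 h w \<tau>))"
  by (rule Oe_eq[OF H_ray_expansion[of I w]]) (simp add: cvec_cm_param lin_part_ray)

text \<open>Taylor's formula at \<open>u0\<close> is applied to the increment \<open>?Y\<close>,
  which is of order one. To reach order four, the linear form needs \<open>?Y\<close> up to order
  four, the quadratic form only up to order three, because its other argument contributes one order,
  and the cubic form only up to order two.\<close>

lemma F_expansion:
  defines "lp \<equiv> \<lambda>w \<tau>. lin_part v \<tau> w"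
  shows "Oe I 4 (\<lambda>\<tau> \<epsilon>. cvec (F (cm_param u0 v H \<tau> (of_real \<epsilon> * w))) -
     (cvec (F (u0 \<tau>)) + \<epsilon> *\<^sub>R (formA F (u0 \<tau>) *v lp w \<tau>)
      + \<epsilon> ^ 2 *\<^sub>R (formA F (u0 \<tau>) *v Q2 h w \<tau> + (1/2) *\<^sub>R formB F (u0 \<tau>) (lp w \<tau>) (lp w \<tau>))
      + \<epsilon> ^ 3 *\<^sub>R (formA F (u0 \<tau>) *v Q3 h w \<tau> + formB F (u0 \<tau>) (lp w \<tau>) (Q2 h w \<tau>)
          + (1/6) *\<^sub>R formC F (u0 \<tau>) (lp w \<tau>) (lp w \<tau>) (lp w \<tau>))))"
proof -
  let ?l = "\<lambda>\<tau>. lin_part v \<tau> w"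
  let ?y = "\<lambda>\<tau> \<epsilon>. cm_param u0 v H \<tau> (of_real \<epsilon> * w) - u0 \<tau>"
  let ?Y = "\<lambda>\<tau> \<epsilon>. cvec (?y \<tau> \<epsilon>)"
  let ?A = "\<lambda>\<tau>. formA F (u0 \<tau>)" and ?B = "\<lambda>\<tau>. formB F (u0 \<tau>)" and ?C = "\<lambda>\<tau>. formC F (u0 \<tau>)"
  have l0: "Oe I 0 (\<lambda>\<tau> \<epsilon>. ?l \<tau>)" by (rule Oe_cont[OF continuous_on_lin_part])
  have q2: "Oe I 0 (\<lambda>\<tau> \<epsilon>. Q2 h w \<tau>)" and q3: "Oe I 0 (\<lambda>\<tau> \<epsilon>. Q3 h w \<tau>)"
    by (rule Oe_cont[OF continuous_on_Q2] Oe_cont[OF continuous_on_Q3])+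
  have l1: "Oe I 1 (\<lambda>\<tau> \<epsilon>. \<epsilon> *\<^sub>R ?l \<tau>)" using Oe_pow_scaleR[OF l0, of 1 1] by simp
  have p2: "Oe I 2 (\<lambda>\<tau> \<epsilon>. \<epsilon> ^ 2 *\<^sub>R Q2 h w \<tau>)" and p3: "Oe I 3 (\<lambda>\<tau> \<epsilon>. \<epsilon> ^ 3 *\<^sub>R Q3 h w \<tau>)"
    by (rule Oe_pow_scaleR[OF q2 order_refl] Oe_pow_scaleR[OF q3 order_refl])+
  have Y4: "Oe I 4 (\<lambda>\<tau> \<epsilon>. ?Y \<tau> \<epsilon> - (\<epsilon> *\<^sub>R ?l \<tau> + \<epsilon> ^ 2 *\<^sub>R Q2 h w \<tau> + \<epsilon> ^ 3 *\<^sub>R Q3 h w \<tau>))"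
    by (rule Oe_eq[OF cm_param_expansion[of w]]) (simp add: linear_simps[OF bounded_linear_cvec] algebra_simps)
  have Y3: "Oe I 3 (\<lambda>\<tau> \<epsilon>. ?Y \<tau> \<epsilon> - (\<epsilon> *\<^sub>R ?l \<tau> + \<epsilon> ^ 2 *\<^sub>R Q2 h w \<tau>))"
    by (rule Oe_eq[OF Oe_add[OF Oe_mono[OF Y4, of 3] p3]]) simp_all
  have Y2: "Oe I 2 (\<lambda>\<tau> \<epsilon>. ?Y \<tau> \<epsilon> - \<epsilon> *\<^sub>R ?l \<tau>)"
    by (rule Oe_eq[OF Oe_add[OF Oe_mono[OF Y3, of 2] p2]]) simp_all
  have Y1: "Oe I 1 ?Y"
    by (rule Oe_eq[OF Oe_add[OF Oe_mono[OF Y2, of 1] l1]]) simp_all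
  have P1: "Oe I 1 (\<lambda>\<tau> \<epsilon>. \<epsilon> *\<^sub>R ?l \<tau> + \<epsilon> ^ 2 *\<^sub>R Q2 h w \<tau>)"
    by (rule Oe_add[OF l1 Oe_mono[OF p2]]) simp
  have y1: "Oe I 1 ?y" by (rule Oe_dominated[OF Y1 zero_less_one, where C=1]) (simp add: norm_cvec)
  obtain M where M: "M \<ge> 0" "\<And>x y. x \<in> u0 ` I \<Longrightarrow> norm y \<le> 1 \<Longrightarrow>
    norm (cvec (F (x + y)) - (cvec (F x) + formA F x *v cvec y + (1/2) *\<^sub>R formB F x (cvec y) (cvec y)
      + (1/6) *\<^sub>R formC F x (cvec y) (cvec y) (cvec y))) \<le> M * norm y ^ 4"
    using taylor3[OF F compact_continuous_image[OF continuous_on_u0 compact_Icc]] by metis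
  obtain \<delta> where \<delta>: "\<delta> > 0" "\<And>\<tau> \<epsilon>. \<tau> \<in> I \<Longrightarrow> 0 < \<epsilon> \<Longrightarrow> \<epsilon> < \<delta> \<Longrightarrow> norm (?y \<tau> \<epsilon>) < 1"
    using Oe_small[OF y1 zero_less_one] by metis
  have y4: "Oe I 4 (\<lambda>\<tau> \<epsilon>. norm (?y \<tau> \<epsilon>) ^ 4)"
  proof -
    have n: "Oe I 1 (\<lambda>\<tau> \<epsilon>. norm (?y \<tau> \<epsilon>))"
      by (rule Oe_dominated[OF y1 zero_less_one, where C=1]) simp
    from Oe_mult[OF Oe_mult[OF n n] Oe_mult[OF n n]] show ?thesis
      by (simp add: power4_eq_xxxx mult.assoc numeral_eq_Suc)
  qed
  let ?R = "\<lambda>\<tau> \<epsilon>. cvec (F (u0 \<tau> + ?y \<tau> \<epsilon>)) - (cvec (F (u0 \<tau>)) + ?A \<tau> *v ?Y \<tau> \<epsilon>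
      + (1/2) *\<^sub>R ?B \<tau> (?Y \<tau> \<epsilon>) (?Y \<tau> \<epsilon>) + (1/6) *\<^sub>R ?C \<tau> (?Y \<tau> \<epsilon>) (?Y \<tau> \<epsilon>) (?Y \<tau> \<epsilon>))"
  have T: "Oe I 4 ?R"
  proof (rule Oe_dominated[OF y4 \<delta>(1)])
    fix \<tau> \<epsilon> assume *: "\<tau> \<in> I" "0 < \<epsilon>" "\<epsilon> < \<delta>"
    have "norm (?R \<tau> \<epsilon>) \<le> M * norm (?y \<tau> \<epsilon>) ^ 4"
      by (rule M(2)) (use * \<delta>(2)[OF *] in auto)
    then show "norm (?R \<tau> \<epsilon>) \<le> M * norm (norm (?y \<tau> \<epsilon>) ^ 4)" by simp
  qed
  let ?a = "\<lambda>\<tau> \<epsilon>. ?A \<tau> *v ?Y \<tau> \<epsilon> - (\<epsilon> *\<^sub>R (?A \<tau> *v ?l \<tau>) + \<epsilon> ^ 2 *\<^sub>R (?A \<tau> *v Q2 h w \<tau>) + \<epsilon> ^ 3 *\<^sub>R (?A \<tau> *v Q3 h w \<tau>))"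
  have a: "Oe I 4 ?a"
    by (rule Oe_eq[OF Oe_formA[OF Y4]]) (simp add: matrix_vector_mult_diff_distrib matrix_vector_right_distrib formA_scaleR)
  \<comment> \<open>Symmetry merges the two mixed terms into twice one of them; this factor cancels
    the 1/2 of Taylor's formula in the \<epsilon>^3 coefficient.\<close>
  have sB: "?B \<tau> y z = ?B \<tau> z y" for \<tau> y z by (rule formB_commute[OF F_Ck(2)])
  let ?b = "\<lambda>\<tau> \<epsilon>. ?B \<tau> (?Y \<tau> \<epsilon>) (?Y \<tau> \<epsilon>) - (\<epsilon> ^ 2 *\<^sub>R ?B \<tau> (?l \<tau>) (?l \<tau>) + \<epsilon> ^ 3 *\<^sub>R (2 *\<^sub>R ?B \<tau> (?l \<tau>) (Q2 h w \<tau>)))"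
  have b: "Oe I 4 ?b"
  proof -
    let ?s = "\<lambda>\<tau> \<epsilon>. ?Y \<tau> \<epsilon> - (\<epsilon> *\<^sub>R ?l \<tau> + \<epsilon> ^ 2 *\<^sub>R Q2 h w \<tau>)"
    let ?P = "\<lambda>\<tau> \<epsilon>. \<epsilon> *\<^sub>R ?l \<tau> + \<epsilon> ^ 2 *\<^sub>R Q2 h w \<tau>"
    have 1: "Oe I 4 (\<lambda>\<tau> \<epsilon>. ?B \<tau> (?s \<tau> \<epsilon>) (?Y \<tau> \<epsilon>))" using Oe_formB[OF Y3 Y1] by simp
    have 2: "Oe I 4 (\<lambda>\<tau> \<epsilon>. ?B \<tau> (?P \<tau> \<epsilon>) (?s \<tau> \<epsilon>))" using Oe_formB[OF P1 Y3] by simp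
    have 3: "Oe I 4 (\<lambda>\<tau> \<epsilon>. ?B \<tau> (\<epsilon> ^ 2 *\<^sub>R Q2 h w \<tau>) (\<epsilon> ^ 2 *\<^sub>R Q2 h w \<tau>))" using Oe_formB[OF p2 p2] by simp
    show ?thesis
    proof (rule Oe_eq[OF Oe_add[OF Oe_add[OF 1 2] 3]])
      fix \<tau> \<epsilon> :: real
      have PP: "?B \<tau> (?P \<tau> \<epsilon>) (?P \<tau> \<epsilon>) = \<epsilon> ^ 2 *\<^sub>R ?B \<tau> (?l \<tau>) (?l \<tau>)
          + \<epsilon> ^ 3 *\<^sub>R (2 *\<^sub>R ?B \<tau> (?l \<tau>) (Q2 h w \<tau>)) + ?B \<tau> (\<epsilon> ^ 2 *\<^sub>R Q2 h w \<tau>) (\<epsilon> ^ 2 *\<^sub>R Q2 h w \<tau>)"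
        unfolding formB_add_left formB_add_right formB_scaleR sB[of \<tau> "Q2 h w \<tau>" "?l \<tau>"]
        by (simp add: scaleR_2 scaleR_add_right power2_eq_square power3_eq_cube mult.assoc)
      show "?b \<tau> \<epsilon> = ?B \<tau> (?s \<tau> \<epsilon>) (?Y \<tau> \<epsilon>) + ?B \<tau> (?P \<tau> \<epsilon>) (?s \<tau> \<epsilon>) + ?B \<tau> (\<epsilon> ^ 2 *\<^sub>R Q2 h w \<tau>) (\<epsilon> ^ 2 *\<^sub>R Q2 h w \<tau>)"
        unfolding formB_diff_left formB_diff_right PP by simp
    qed
  qed
  let ?c = "\<lambda>\<tau> \<epsilon>. ?C \<tau> (?Y \<tau> \<epsilon>) (?Y \<tau> \<epsilon>) (?Y \<tau> \<epsilon>) - \<epsilon> ^ 3 *\<^sub>R ?C \<tau> (?l \<tau>) (?l \<tau>) (?l \<tau>)"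
  have c: "Oe I 4 ?c"
  proof -
    let ?s = "\<lambda>\<tau> \<epsilon>. ?Y \<tau> \<epsilon> - \<epsilon> *\<^sub>R ?l \<tau>"
    let ?P = "\<lambda>\<tau> \<epsilon>. \<epsilon> *\<^sub>R ?l \<tau>"
    have 1: "Oe I 4 (\<lambda>\<tau> \<epsilon>. ?C \<tau> (?s \<tau> \<epsilon>) (?Y \<tau> \<epsilon>) (?Y \<tau> \<epsilon>))" using Oe_formC[OF Y2 Y1 Y1] by simp
    have 2: "Oe I 4 (\<lambda>\<tau> \<epsilon>. ?C \<tau> (?P \<tau> \<epsilon>) (?s \<tau> \<epsilon>) (?Y \<tau> \<epsilon>))" using Oe_formC[OF l1 Y2 Y1] by (simp add: numeral_eq_Suc)
    have 3: "Oe I 4 (\<lambda>\<tau> \<epsilon>. ?C \<tau> (?P \<tau> \<epsilon>) (?P \<tau> \<epsilon>) (?s \<tau> \<epsilon>))" using Oe_formC[OF l1 l1 Y2] by (simp add: numeral_eq_Suc)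
    show ?thesis
    proof (rule Oe_eq[OF Oe_add[OF Oe_add[OF 1 2] 3]])
      fix \<tau> \<epsilon> :: real
      have e: "?Y \<tau> \<epsilon> = ?s \<tau> \<epsilon> + ?P \<tau> \<epsilon>" by simp
      \<comment> \<open>Telescoping: the increment is replaced by its leading term in one argument
        after another, each replacement costing a term of order four.\<close>
      have "?C \<tau> (?Y \<tau> \<epsilon>) (?Y \<tau> \<epsilon>) (?Y \<tau> \<epsilon>) = ?C \<tau> (?s \<tau> \<epsilon>) (?Y \<tau> \<epsilon>) (?Y \<tau> \<epsilon>) + ?C \<tau> (?P \<tau> \<epsilon>) (?Y \<tau> \<epsilon>) (?Y \<tau> \<epsilon>)"
        by (subst (1) e) (rule formC_add1)
      also have "?C \<tau> (?P \<tau> \<epsilon>) (?Y \<tau> \<epsilon>) (?Y \<tau> \<epsilon>) = ?C \<tau> (?P \<tau> \<epsilon>) (?s \<tau> \<epsilon>) (?Y \<tau> \<epsilon>) + ?C \<tau> (?P \<tau> \<epsilon>) (?P \<tau> \<epsilon>) (?Y \<tau> \<epsilon>)"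
        by (subst (1) e) (rule formC_add2)
      also have "?C \<tau> (?P \<tau> \<epsilon>) (?P \<tau> \<epsilon>) (?Y \<tau> \<epsilon>) = ?C \<tau> (?P \<tau> \<epsilon>) (?P \<tau> \<epsilon>) (?s \<tau> \<epsilon>) + ?C \<tau> (?P \<tau> \<epsilon>) (?P \<tau> \<epsilon>) (?P \<tau> \<epsilon>)"
        by (subst (1) e) (rule formC_add3)
      also have "?C \<tau> (?P \<tau> \<epsilon>) (?P \<tau> \<epsilon>) (?P \<tau> \<epsilon>) = \<epsilon> ^ 3 *\<^sub>R ?C \<tau> (?l \<tau>) (?l \<tau>) (?l \<tau>)"
        unfolding formC_scaleR by (simp add: power3_eq_cube)
      finally show "?c \<tau> \<epsilon> = ?C \<tau> (?s \<tau> \<epsilon>) (?Y \<tau> \<epsilon>) (?Y \<tau> \<epsilon>) + ?C \<tau> (?P \<tau> \<epsilon>) (?s \<tau> \<epsilon>) (?Y \<tau> \<epsilon>) + ?C \<tau> (?P \<tau> \<epsilon>) (?P \<tau> \<epsilon>) (?s \<tau> \<epsilon>)"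
        by simp
    qed
  qed
  have s: "Oe I 4 (\<lambda>\<tau> \<epsilon>. k *\<^sub>R f \<tau> \<epsilon>)" if "Oe I 4 f" for k and f :: "real \<Rightarrow> real \<Rightarrow> complex^'n"
    using Oe_linear[OF bounded_linear_scaleR_right that] .
  show ?thesis
    unfolding lp_def
    by (rule Oe_eq[OF Oe_add[OF Oe_add[OF Oe_add[OF T a] s[OF b, of "1/2"]] s[OF c, of "1/6"]]])
       (simp add: scaleR_add_right scaleR_diff_right)
qed

definition "gcoef2 w = b * (cnj w)\<^sup>2"
definition "gcoef3 w = c * w * of_real ((norm w)\<^sup>2)"
definition "acoef2 w = \<alpha>1 * (norm w)\<^sup>2"
definition "acoef3 w = Re (\<alpha>2 * w ^ 3 + \<alpha>3 * cnj w ^ 3)"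

text \<open>The derivative of \<open>Q2 h\<close> at \<open>w\<close> in the real direction
  \<open>gcoef2 w\<close>. It is the \<epsilon>^3 coefficient of the derivative of \<open>H\<close>
  along the motion of \<xi>.\<close>

definition dQ2 :: "complex \<Rightarrow> real \<Rightarrow> complex^'n" where
  "dQ2 w \<tau> = (w * gcoef2 w) *s h 2 0 \<tau> + (w * cnj (gcoef2 w) + cnj w * gcoef2 w) *s h 1 1 \<tau>
     + (cnj w * cnj (gcoef2 w)) *s h 0 2 \<tau>"

lemma g_rhs_expansion:
  "Oe I 4 (\<lambda>\<tau> \<epsilon>. g_rhs \<tau> (of_real \<epsilon> * w) - (\<epsilon> ^ 2 *\<^sub>R gcoef2 w + \<epsilon> ^ 3 *\<^sub>R gcoef3 w))"
  by (rule Oe_eq[OF bigO4_Oe[OF q4 Oe_ray[of I w]]])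
     (simp add: g_rhs_def gcoef2_def gcoef3_def scaleR_conv_of_real norm_mult power_mult_distrib,
      simp add: power2_eq_square power3_eq_cube)

lemma a_rhs_expansion:
  "Oe I 4 (\<lambda>\<tau> \<epsilon>. a_rhs \<tau> (of_real \<epsilon> * w) - (\<epsilon> ^ 2 * acoef2 w + \<epsilon> ^ 3 * acoef3 w))"
proof (rule Oe_eq[OF bigO4_Oe[OF p4 Oe_ray[of I w]]])
  fix \<tau> \<epsilon> :: real
  have "\<alpha>2 * (of_real \<epsilon> * w) ^ 3 + \<alpha>3 * cnj (of_real \<epsilon> * w) ^ 3 = of_real (\<epsilon> ^ 3) * (\<alpha>2 * w ^ 3 + \<alpha>3 * cnj w ^ 3)"
    by (simp add: power_mult_distrib algebra_simps)
  then have "Re (\<alpha>2 * (of_real \<epsilon> * w) ^ 3 + \<alpha>3 * cnj (of_real \<epsilon> * w) ^ 3) = \<epsilon> ^ 3 * acoef3 w"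
    by (simp add: acoef3_def del: of_real_power)
  then show "a_rhs \<tau> (of_real \<epsilon> * w) - (\<epsilon> ^ 2 * acoef2 w + \<epsilon> ^ 3 * acoef3 w) = p (\<tau>, of_real \<epsilon> * w)"
    unfolding a_rhs_def acoef2_def by (simp add: norm_mult power_mult_distrib)
qed

text \<open>The remainder is controlled by the variation of the derivative of \<open>H\<close> along
  the segment. Lipschitz bounds for the two real directions 1 and \<i> of the \<xi>-plane suffice,
  and compactness in \<tau> makes the constant uniform.\<close>

lemma H_second_order:
  obtains L where "\<And>\<tau> \<xi> g. \<tau> \<in> I \<Longrightarrow> norm \<xi> \<le> r / 4 \<Longrightarrow> norm g \<le> r / 4 \<Longrightarrow>
    norm (H (\<tau>, \<xi> + g) - H (\<tau>, \<xi>) - frechet_derivative H (at (\<tau>, \<xi>)) (0, g)) \<le> L * norm g ^ 2"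
proof -
  \<comment> \<open>Points \<xi> + s g with both norms at most r/4 stay in the disc of radius r/2,
    which is compact inside the domain of \<open>H\<close>.\<close>
  let ?K = "I \<times> cball 0 (r / 2) :: (real \<times> complex) set"
  have K: "compact ?K" "convex ?K" "?K \<subseteq> UNIV \<times> ball 0 r"
    using r by (auto intro!: compact_Times convex_Times)
  have "Ck_on (Suc 3) (UNIV \<times> ball 0 r) H" using H by simp
  then have "Ck_on 3 (UNIV \<times> ball 0 r) (\<lambda>x. frechet_derivative H (at x) e)" for e
    unfolding Ck_on.simps(2) by blast
  then have C: "Ck_on 1 (UNIV \<times> ball 0 r) (\<lambda>x. frechet_derivative H (at x) e)" for e
    by (rule Ck_on_mono[rotated]) simp
  obtain L1 where L1: "L1-lipschitz_on ?K (\<lambda>x. frechet_derivative H (at x) (0, 1))"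
    using C1_lipschitz_on_compact_convex[OF C K] by blast
  obtain L2 where L2: "L2-lipschitz_on ?K (\<lambda>x. frechet_derivative H (at x) (0, \<i>))"
    using C1_lipschitz_on_compact_convex[OF C K] by blast
  have L0: "L1 \<ge> 0" "L2 \<ge> 0" using L1 L2 lipschitz_on_nonneg by blast+
  show ?thesis
  proof (rule that[of "L1 + L2"])
    fix \<tau> \<xi> g assume \<tau>: "\<tau> \<in> I" and x: "norm (\<xi>::complex) \<le> r / 4" and g: "norm (g::complex) \<le> r / 4"
    let ?x = "\<lambda>s::real. (\<tau>, \<xi> + s *\<^sub>R g)"
    let ?D = "\<lambda>s. frechet_derivative H (at (?x s))"
    have nb: "norm (\<xi> + s *\<^sub>R g) \<le> r / 2" if "s \<in> {0..1}" for s :: real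
    proof -
      have "norm (\<xi> + s *\<^sub>R g) \<le> norm \<xi> + s * norm g" using norm_triangle_ineq[of \<xi> "s *\<^sub>R g"] that by simp
      also have "\<dots> \<le> r / 4 + 1 * (r / 4)" using that x g r by (intro add_mono mult_mono) auto
      finally show ?thesis by simp
    qed
    have inK: "?x s \<in> ?K" if "s \<in> {0..1}" for s using nb[OF that] \<tau> by simp
    have HD: "(H has_derivative ?D s) (at (?x s))" if "s \<in> {0..1}" for s
      using H_differentiable[of "\<xi> + s *\<^sub>R g" \<tau>] nb[OF that] r frechet_derivative_works by (auto intro: le_less_trans)
    have lin: "linear (?D s)" if "s \<in> {0..1}" for s using HD[OF that] has_derivative_linear by blast
    have split: "?D s (0, g) = Re g *\<^sub>R ?D s (0, 1) + Im g *\<^sub>R ?D s (0, \<i>)" if "s \<in> {0..1}" for s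
    proof -
      have "(0, g) = Re g *\<^sub>R (0::real, 1) + Im g *\<^sub>R (0, \<i>)"
        by (simp add: complex_eq_iff)
      then show ?thesis by (simp only: linear_add[OF lin[OF that]] linear_cmul[OF lin[OF that]])
    qed
    have d: "((\<lambda>s. H (?x s)) has_vector_derivative ?D s (0, g)) (at s within {0..1})" if s: "s \<in> {0..1}" for s
    proof -
      have "((\<lambda>s. H (?x s)) has_derivative (\<lambda>k. ?D s (0, k *\<^sub>R g))) (at s)"
        by (rule has_derivative_compose[where f="?x" and g=H, OF _ HD[OF s]]) (auto intro!: derivative_eq_intros)
      moreover have "(\<lambda>k. ?D s (0, k *\<^sub>R g)) = (\<lambda>k. k *\<^sub>R ?D s (0, g))"
      proof
        fix k
        have "(0, k *\<^sub>R g) = k *\<^sub>R (0::real, g)" by simp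
        then show "?D s (0, k *\<^sub>R g) = k *\<^sub>R ?D s (0, g)" by (simp only: linear_cmul[OF lin[OF s]])
      qed
      ultimately show ?thesis unfolding has_vector_derivative_def by (simp add: has_derivative_at_withinI)
    qed
    have B: "norm (?D s (0, g) - ?D 0 (0, g)) \<le> (L1 + L2) * norm g ^ 2" if s: "s \<in> {0..1}" for s
    proof -
      have dx: "dist (?x s) (?x 0) \<le> norm g"
        using s mult_right_mono[of s 1 "norm g"] by (simp add: dist_Pair_Pair dist_norm)
      have "?D s (0, g) - ?D 0 (0, g) = Re g *\<^sub>R (?D s (0, 1) - ?D 0 (0, 1)) + Im g *\<^sub>R (?D s (0, \<i>) - ?D 0 (0, \<i>))"
        using split[OF s] split[of 0] by (simp add: algebra_simps)
      also have "norm \<dots> \<le> norm g * (L1 * norm g) + norm g * (L2 * norm g)"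
      proof (rule norm_triangle_mono)
        have "norm (?D s (0, 1) - ?D 0 (0, 1)) \<le> L1 * norm g"
          using lipschitz_onD[OF L1 inK[OF s] inK[of 0]] mult_left_mono[OF dx L0(1)] by (simp add: dist_norm)
        then show "norm (Re g *\<^sub>R (?D s (0, 1) - ?D 0 (0, 1))) \<le> norm g * (L1 * norm g)"
          using abs_Re_le_cmod[of g] by (auto intro!: mult_mono)
        have "norm (?D s (0, \<i>) - ?D 0 (0, \<i>)) \<le> L2 * norm g"
          using lipschitz_onD[OF L2 inK[OF s] inK[of 0]] mult_left_mono[OF dx L0(2)] by (simp add: dist_norm)
        then show "norm (Im g *\<^sub>R (?D s (0, \<i>) - ?D 0 (0, \<i>))) \<le> norm g * (L2 * norm g)"
          using abs_Im_le_cmod[of g] by (auto intro!: mult_mono)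
      qed
      finally show ?thesis by (simp add: algebra_simps power2_eq_square)
    qed
    have "norm (H (?x 1) - H (?x 0) - (1 - 0) *\<^sub>R ?D 0 (0, g)) \<le> norm (1 - 0 :: real) * ((L1 + L2) * norm g ^ 2)"
      by (rule vector_differentiable_bound_linearization[where S="{0..1}" and f="\<lambda>s. H (?x s)" and f'="\<lambda>s. ?D s (0, g)"])
         (use d B in \<open>auto simp: closed_segment_eq_real_ivl\<close>)
    then show "norm (H (\<tau>, \<xi> + g) - H (\<tau>, \<xi>) - frechet_derivative H (at (\<tau>, \<xi>)) (0, g)) \<le> (L1 + L2) * norm g ^ 2"
      by simp
  qed
qed

text \<open>In the increment of \<open>H\<close> from \<epsilon> w to \<epsilon> w + g only the
  quadratic part contributes at order three. The cubic part changes by \<open>g\<close>, of order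
  two, times a quadratic factor, hence at order four.\<close>

lemma DH_expansion:
  "Oe I 4 (\<lambda>\<tau> \<epsilon>. cvec (frechet_derivative H (at (\<tau>, of_real \<epsilon> * w)) (0, g_rhs \<tau> (of_real \<epsilon> * w))) - \<epsilon> ^ 3 *\<^sub>R dQ2 w \<tau>)"
proof -
  let ?x = "\<lambda>\<tau> \<epsilon>::real. of_real \<epsilon> * w" and ?g = "\<lambda>\<tau> \<epsilon>. g_rhs \<tau> (of_real \<epsilon> * w)"
  let ?z = "\<lambda>\<tau> \<epsilon>. of_real \<epsilon> * w + g_rhs \<tau> (of_real \<epsilon> * w)"
  let ?e = "\<lambda>\<tau> \<epsilon>. g_rhs \<tau> (of_real \<epsilon> * w) - \<epsilon> ^ 2 *\<^sub>R gcoef2 w"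
  have x: "Oe I 1 ?x" by (rule Oe_ray)
  have e: "Oe I 3 ?e"
    by (rule Oe_eq[OF Oe_add[OF Oe_mono[OF g_rhs_expansion[of w], of 3] Oe_pow_scaleR[OF Oe_const[of I "gcoef3 w"], of 3 3]]]) simp_all
  have g: "Oe I 2 ?g"
    by (rule Oe_eq[OF Oe_add[OF Oe_mono[OF e, of 2] Oe_pow_scaleR[OF Oe_const[of I "gcoef2 w"], of 2 2]]]) simp_all
  have z: "Oe I 1 ?z" by (rule Oe_add[OF x Oe_mono[OF g]]) simp
  note cn = Oe_linear[OF bounded_linear_cnj]
  note xc = cn[OF x] and ec = cn[OF e] and gc = cn[OF g] and zc = cn[OF z]
  have hb: "Oe I 0 (\<lambda>\<tau> \<epsilon>. h k l \<tau>)" if "continuous_on I (h k l)" for k l by (rule Oe_cont[OF that])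
  note hb = continuous_on_h[of I, THEN hb]
  let ?R = "\<lambda>\<tau> \<epsilon>. H (\<tau>, ?z \<tau> \<epsilon>) - H (\<tau>, ?x \<tau> \<epsilon>) - frechet_derivative H (at (\<tau>, ?x \<tau> \<epsilon>)) (0, ?g \<tau> \<epsilon>)"
  obtain L where L: "\<And>\<tau> \<xi> g. \<tau> \<in> I \<Longrightarrow> norm \<xi> \<le> r / 4 \<Longrightarrow> norm g \<le> r / 4 \<Longrightarrow>
    norm (H (\<tau>, \<xi> + g) - H (\<tau>, \<xi>) - frechet_derivative H (at (\<tau>, \<xi>)) (0, g)) \<le> L * norm g ^ 2"
    using H_second_order by blast
  have r4: "r / 4 > 0" using r by simp
  obtain d1 where d1: "d1 > 0" "\<And>\<tau> \<epsilon>. \<tau> \<in> I \<Longrightarrow> 0 < \<epsilon> \<Longrightarrow> \<epsilon> < d1 \<Longrightarrow> norm (?x \<tau> \<epsilon>) < r / 4"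
    using Oe_small[OF x r4] by blast
  have g1: "Oe I 1 ?g" by (rule Oe_mono[OF g]) simp
  obtain d2 where d2: "d2 > 0" "\<And>\<tau> \<epsilon>. \<tau> \<in> I \<Longrightarrow> 0 < \<epsilon> \<Longrightarrow> \<epsilon> < d2 \<Longrightarrow> norm (?g \<tau> \<epsilon>) < r / 4"
    using Oe_small[OF g1 r4] by blast
  have gg: "Oe I 4 (\<lambda>\<tau> \<epsilon>. ?g \<tau> \<epsilon> * ?g \<tau> \<epsilon>)" using Oe_mult[OF g g] by simp
  have R: "Oe I 4 ?R"
  proof (rule Oe_dominated[OF gg, of "min d1 d2"])
    fix \<tau> \<epsilon> assume "\<tau> \<in> I" "0 < \<epsilon>" "\<epsilon> < min d1 d2"
    then show "norm (?R \<tau> \<epsilon>) \<le> L * norm (?g \<tau> \<epsilon> * ?g \<tau> \<epsilon>)"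
      using L[of \<tau> "?x \<tau> \<epsilon>" "?g \<tau> \<epsilon>"] d1(2)[of \<tau> \<epsilon>] d2(2)[of \<tau> \<epsilon>] by (simp add: norm_mult power2_eq_square)
  qed (use d1 d2 in auto)
  have Hz: "Oe I 4 (\<lambda>\<tau> \<epsilon>. cvec (H (\<tau>, ?z \<tau> \<epsilon>)) - (Q2 h (?z \<tau> \<epsilon>) \<tau> + Q3 h (?z \<tau> \<epsilon>) \<tau>))"
    and Hx: "Oe I 4 (\<lambda>\<tau> \<epsilon>. cvec (H (\<tau>, ?x \<tau> \<epsilon>)) - (Q2 h (?x \<tau> \<epsilon>) \<tau> + Q3 h (?x \<tau> \<epsilon>) \<tau>))"
    by (rule H_expansion[OF z] H_expansion[OF x])+
  have m: "Oe I 4 f" if "Oe I (1 + 3) f \<or> Oe I (2 + 2) f \<or> Oe I (2 + (1 + 1)) f" for f :: "real \<Rightarrow> real \<Rightarrow> complex"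
    using that by auto
  have sm: "Oe I 4 (\<lambda>\<tau> \<epsilon>. f \<tau> \<epsilon> *s h k l \<tau>)" if "Oe I 4 f" "Oe I 0 (\<lambda>\<tau> \<epsilon>. h k l \<tau>)" for f k l
    using Oe_smult[OF that] by simp
  \<comment> \<open>With \<open>g\<close> split into its \<epsilon>^2 term and the error
    \<open>?e\<close>, the linear part of the change of \<xi>^2/2 gives the term in
    \<open>dQ2\<close>; what remains is x e + g^2/2. The other two coefficients are handled
    alike.\<close>
  have c2: "Oe I 4 (\<lambda>\<tau> \<epsilon>. ?x \<tau> \<epsilon> * ?e \<tau> \<epsilon> + ?g \<tau> \<epsilon> * ?g \<tau> \<epsilon> / 2)"
    using Oe_add[OF Oe_mult[OF x e, THEN disjI1, THEN m] Oe_mult[OF gg Oe_const[of I "1/2"], simplified]] by simp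
  have c11: "Oe I 4 (\<lambda>\<tau> \<epsilon>. ?x \<tau> \<epsilon> * cnj (?e \<tau> \<epsilon>) + cnj (?x \<tau> \<epsilon>) * ?e \<tau> \<epsilon> + ?g \<tau> \<epsilon> * cnj (?g \<tau> \<epsilon>))"
    by (intro Oe_add m[OF disjI1] m[OF disjI2[OF disjI1]] Oe_mult[OF x ec] Oe_mult[OF xc e] Oe_mult[OF g gc])
  have c02: "Oe I 4 (\<lambda>\<tau> \<epsilon>. cnj (?x \<tau> \<epsilon> * ?e \<tau> \<epsilon> + ?g \<tau> \<epsilon> * ?g \<tau> \<epsilon> / 2))"
    by (rule cn[OF c2])
  have Q2': "Oe I 4 (\<lambda>\<tau> \<epsilon>. Q2 h (?z \<tau> \<epsilon>) \<tau> - Q2 h (?x \<tau> \<epsilon>) \<tau> - \<epsilon> ^ 3 *\<^sub>R dQ2 w \<tau>)"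
    by (rule Oe_eq[OF Oe_add[OF Oe_add[OF sm[OF c2 hb(1)] sm[OF c11 hb(2)]] sm[OF c02 hb(3)]]])
       (simp add: Q2_def dQ2_def vec_eq_iff power2_eq_square power3_eq_cube scaleR_conv_of_real[where 'a=complex] field_simps)
  let ?c3 = "\<lambda>\<tau> \<epsilon>. ?g \<tau> \<epsilon> * (?z \<tau> \<epsilon> * ?z \<tau> \<epsilon> + ?z \<tau> \<epsilon> * ?x \<tau> \<epsilon> + ?x \<tau> \<epsilon> * ?x \<tau> \<epsilon>) * (1/6)"
  have c3: "Oe I 4 ?c3"
  proof -
    have "Oe I (1 + 1) (\<lambda>\<tau> \<epsilon>. ?z \<tau> \<epsilon> * ?z \<tau> \<epsilon> + ?z \<tau> \<epsilon> * ?x \<tau> \<epsilon> + ?x \<tau> \<epsilon> * ?x \<tau> \<epsilon>)"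
      by (intro Oe_add Oe_mult[OF z z] Oe_mult[OF z x] Oe_mult[OF x x])
    from Oe_mult[OF Oe_mult[OF g this] Oe_const[of I "1/6"]] show ?thesis by simp
  qed
  let ?c21 = "\<lambda>\<tau> \<epsilon>. (?g \<tau> \<epsilon> * ((?z \<tau> \<epsilon> + ?x \<tau> \<epsilon>) * cnj (?z \<tau> \<epsilon>)) + cnj (?g \<tau> \<epsilon>) * (?x \<tau> \<epsilon> * ?x \<tau> \<epsilon>)) * (1/2)"
  have c21: "Oe I 4 ?c21"
  proof -
    have "Oe I (2 + (1 + 1)) (\<lambda>\<tau> \<epsilon>. ?g \<tau> \<epsilon> * ((?z \<tau> \<epsilon> + ?x \<tau> \<epsilon>) * cnj (?z \<tau> \<epsilon>)) + cnj (?g \<tau> \<epsilon>) * (?x \<tau> \<epsilon> * ?x \<tau> \<epsilon>))"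
      by (intro Oe_add Oe_mult[OF g Oe_mult[OF Oe_add[OF z x] zc]] Oe_mult[OF gc Oe_mult[OF x x]])
    from Oe_mult[OF this Oe_const[of I "1/2"]] show ?thesis by simp
  qed
  have Q3': "Oe I 4 (\<lambda>\<tau> \<epsilon>. Q3 h (?z \<tau> \<epsilon>) \<tau> - Q3 h (?x \<tau> \<epsilon>) \<tau>)"
    by (rule Oe_eq[OF Oe_add[OF Oe_add[OF Oe_add[OF sm[OF c3 hb(4)] sm[OF c21 hb(5)]] sm[OF cn[OF c21] hb(6)]] sm[OF cn[OF c3] hb(7)]]])
       (simp add: Q3_def vec_eq_iff power2_eq_square power3_eq_cube field_simps)
  show ?thesis
    by (rule Oe_eq[OF Oe_add[OF Oe_diff[OF Oe_diff[OF Hz Hx] Oe_linear[OF bounded_linear_cvec R]] Oe_add[OF Q2' Q3']]])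
       (simp add: linear_simps[OF bounded_linear_cvec])
qed

text \<open>The \<epsilon>^2 coefficient of the \<tau>-derivative of the parametrization at
  \<epsilon> w, and below the \<epsilon>^3 coefficient. The terms with \<open>acoef2\<close> and
  \<open>acoef3\<close> come from dividing by 1 + a.\<close>

definition Q2_rhs :: "complex \<Rightarrow> real \<Rightarrow> complex^'n" where
  "Q2_rhs w \<tau> = formA F (u0 \<tau>) *v Q2 h w \<tau> + (1/2) *\<^sub>R formB F (u0 \<tau>) (lin_part v \<tau> w) (lin_part v \<tau> w)
     - lin_part v \<tau> (gcoef2 w) - acoef2 w *\<^sub>R cvec (F (u0 \<tau>))"

definition Q3_rhs :: "complex \<Rightarrow> real \<Rightarrow> complex^'n" where
  "Q3_rhs w \<tau> = formA F (u0 \<tau>) *v Q3 h w \<tau> + formB F (u0 \<tau>) (lin_part v \<tau> w) (Q2 h w \<tau>)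
     + (1/6) *\<^sub>R formC F (u0 \<tau>) (lin_part v \<tau> w) (lin_part v \<tau> w) (lin_part v \<tau> w)
     - lin_part v \<tau> (gcoef3 w) - dQ2 w \<tau>
     - acoef3 w *\<^sub>R cvec (F (u0 \<tau>)) - acoef2 w *\<^sub>R (formA F (u0 \<tau>) *v lin_part v \<tau> w)"

lemma Q_derivatives:
  assumes t: "t \<in> I"
  shows "(Q2 h w has_vector_derivative Q2_rhs w t) (at t within I)"
    and "(Q3 h w has_vector_derivative Q3_rhs w t) (at t within I)"
proof -
  let ?u = "\<lambda>\<tau> \<epsilon>. cm_param u0 v H \<tau> (of_real \<epsilon> * w)"
  let ?g = "\<lambda>\<tau> \<epsilon>. g_rhs \<tau> (of_real \<epsilon> * w)" and ?a = "\<lambda>\<tau> \<epsilon>. a_rhs \<tau> (of_real \<epsilon> * w)"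
  let ?l = "\<lambda>\<tau>. lin_part v \<tau> w"
  let ?D = "\<lambda>\<tau> \<epsilon>. frechet_derivative H (at (\<tau>, of_real \<epsilon> * w)) (0, ?g \<tau> \<epsilon>)"
  let ?Nu = "\<lambda>\<tau> \<epsilon>. cvec (F (?u \<tau> \<epsilon>)) - lin_part v \<tau> (?g \<tau> \<epsilon>) - cvec (?D \<tau> \<epsilon>)"
  let ?N0 = "\<lambda>\<tau>. cvec (F (u0 \<tau>))" and ?N1 = "\<lambda>\<tau>. formA F (u0 \<tau>) *v ?l \<tau>"
  let ?N2 = "\<lambda>\<tau>. formA F (u0 \<tau>) *v Q2 h w \<tau> + (1/2) *\<^sub>R formB F (u0 \<tau>) (?l \<tau>) (?l \<tau>) - lin_part v \<tau> (gcoef2 w)"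
  let ?N3 = "\<lambda>\<tau>. formA F (u0 \<tau>) *v Q3 h w \<tau> + formB F (u0 \<tau>) (?l \<tau>) (Q2 h w \<tau>)
     + (1/6) *\<^sub>R formC F (u0 \<tau>) (?l \<tau>) (?l \<tau>) (?l \<tau>) - lin_part v \<tau> (gcoef3 w) - dQ2 w \<tau>"
  note cl = continuous_on_lin_part
  have cdQ: "continuous_on I (dQ2 w)"
    unfolding dQ2_def[abs_def] by (intro continuous_intros continuous_on_smult continuous_on_h)
  have c0: "continuous_on I ?N0" by (rule continuous_on_F0)
  have c1: "continuous_on I ?N1" by (intro continuous_on_formA cl)
  have c2: "continuous_on I ?N2"
    by (intro continuous_on_add continuous_on_diff continuous_on_scaleR continuous_on_const continuous_on_formA continuous_on_formB cl continuous_on_Q2)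
  have c3: "continuous_on I ?N3"
    by (intro continuous_on_add continuous_on_diff continuous_on_scaleR continuous_on_const continuous_on_formA continuous_on_formB
        continuous_on_formC cl continuous_on_Q2 continuous_on_Q3 cdQ)
  have N: "Oe I 4 (\<lambda>\<tau> \<epsilon>. ?Nu \<tau> \<epsilon> - (?N0 \<tau> + \<epsilon> *\<^sub>R ?N1 \<tau> + \<epsilon> ^ 2 *\<^sub>R ?N2 \<tau> + \<epsilon> ^ 3 *\<^sub>R ?N3 \<tau>))"
    by (rule Oe_eq[OF Oe_diff[OF Oe_diff[OF F_expansion[of w] Oe_lin_part[OF g_rhs_expansion[of w]]] DH_expansion[of w]]])
       (simp add: lin_part_add lin_part_diff lin_part_scaleR scaleR_add_right scaleR_diff_right)
  note quot = Oe_divide_one_plus[OF N a_rhs_expansion[of w] Oe_cont[OF c0] Oe_cont[OF c1] Oe_cont[OF c2] Oe_cont[OF c3]]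
  obtain d1 where d1: "d1 > 0" "\<And>\<tau> \<epsilon>. \<tau> \<in> I \<Longrightarrow> 0 < \<epsilon> \<Longrightarrow> \<epsilon> < d1 \<Longrightarrow> 1 + ?a \<tau> \<epsilon> > 0"
    using quot(2) by blast
  obtain d2 where d2: "d2 > 0" "\<And>\<epsilon>. 0 < \<epsilon> \<Longrightarrow> \<epsilon> < d2 \<Longrightarrow> norm (complex_of_real \<epsilon> * w) < r"
    using ray_small[of w] by blast
  \<comment> \<open>The invariance equation holds only at interior times, so the fundamental theorem
    is used in the form that asks for continuity on the closed interval and derivatives in its
    interior.\<close>
  have int: "((\<lambda>\<tau>. ?Nu \<tau> \<epsilon> /\<^sub>R (1 + ?a \<tau> \<epsilon>)) has_integral (cvec (?u s \<epsilon>) - cvec (?u 0 \<epsilon>))) {0..s}"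
    if e: "0 < \<epsilon>" "\<epsilon> < min d1 d2" and s: "s \<in> I" for \<epsilon> s
  proof (rule fundamental_theorem_of_calculus_interior)
    show "0 \<le> s" using s by simp
    have sub: "{0..s} \<subseteq> I" using s by auto
    have nr: "norm (complex_of_real \<epsilon> * w) < r" using d2(2) e by simp
    have "continuous_on I (\<lambda>\<tau>. cvec (?u \<tau> \<epsilon>))"
      unfolding cvec_cm_param
      by (intro continuous_on_add continuous_on_cvec[OF continuous_on_u0] cl continuous_on_H nr)
    then show "continuous_on {0..s} (\<lambda>\<tau>. cvec (?u \<tau> \<epsilon>))" using sub by (rule continuous_on_subset)
    fix \<tau> assume "\<tau> \<in> {0<..<s}"
    then have \<tau>: "\<tau> \<in> {0<..<T}" using s by auto
    then have "1 + ?a \<tau> \<epsilon> \<noteq> 0" using d1(2)[of \<tau> \<epsilon>] e by force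
    from bounded_linear.has_vector_derivative[OF bounded_linear_cvec invariance[OF \<tau> nr this]]
    show "((\<lambda>\<tau>. cvec (?u \<tau> \<epsilon>)) has_vector_derivative ?Nu \<tau> \<epsilon> /\<^sub>R (1 + ?a \<tau> \<epsilon>)) (at \<tau>)"
      by (simp only: linear_simps[OF bounded_linear_cvec] cvec_Re_vec[OF cnj_vec_lin_part])
  qed
  have c2': "continuous_on I (\<lambda>\<tau>. ?N2 \<tau> - acoef2 w *\<^sub>R ?N0 \<tau>)"
    by (intro continuous_on_diff[OF c2] continuous_on_scaleR continuous_on_const c0)
  have c3': "continuous_on I (\<lambda>\<tau>. ?N3 \<tau> - acoef3 w *\<^sub>R ?N0 \<tau> - acoef2 w *\<^sub>R ?N1 \<tau>)"
    by (intro continuous_on_diff[OF continuous_on_diff[OF c3]] continuous_on_scaleR continuous_on_const c0 c1)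
  have d: "min d1 d2 > 0" using d1 d2 by simp
  note der = has_vector_derivative_of_expansion[OF cm_param_expansion[of w] quot(1) d int c0 c1 c2' c3' t]
  show "(Q2 h w has_vector_derivative Q2_rhs w t) (at t within I)"
    using der(1) unfolding Q2_rhs_def by simp
  show "(Q3 h w has_vector_derivative Q3_rhs w t) (at t within I)"
    using der(2) unfolding Q3_rhs_def by simp
qed

end

section \<open>The equations for the expansion coefficients\<close>

lemma has_vector_derivative_smult:
  fixes f :: "real \<Rightarrow> complex^'n"
  assumes "(f has_vector_derivative f') G"
  shows "((\<lambda>x. k *s f x) has_vector_derivative k *s f') G"
  by (rule bounded_linear.has_vector_derivative[OF bounded_bilinear.bounded_linear_right[OF bounded_bilinear_smult] assms])

lemma bounded_bilinear_herm: "bounded_bilinear (herm :: complex^'n \<Rightarrow> complex^'n \<Rightarrow> complex)"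
proof (rule bounded_bilinear.intro)
  show "\<exists>K. \<forall>a b. norm (herm a b :: complex) \<le> norm (a :: complex^'n) * norm b * K"
  proof (intro exI allI)
    fix a b :: "complex^'n"
    have "norm (herm a b) \<le> (\<Sum>i\<in>(UNIV::'n set). norm a * norm b)"
      unfolding herm_def
      by (rule sum_norm_le) (auto simp: norm_mult intro!: mult_mono Finite_Cartesian_Product.norm_nth_le)
    then show "norm (herm a b) \<le> norm a * norm b * real CARD('n)" by (simp add: mult.commute)
  qed
qed (auto simp: herm_def algebra_simps sum.distrib scaleR_sum_right)

lemmas herm_simps = bounded_bilinear.add_left[OF bounded_bilinear_herm] bounded_bilinear.add_right[OF bounded_bilinear_herm]
  bounded_bilinear.diff_left[OF bounded_bilinear_herm] bounded_bilinear.diff_right[OF bounded_bilinear_herm]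
  bounded_bilinear.minus_left[OF bounded_bilinear_herm] bounded_bilinear.minus_right[OF bounded_bilinear_herm]

lemma herm_smult: "herm (k *s x) y = cnj k * herm x y" "herm x (k *s y) = k * herm x y"
  by (simp_all add: herm_def sum_distrib_left mult_ac)

lemma herm_cnj_vec: "herm (cnj_vec x) (cnj_vec y) = cnj (herm x y)"
  by (simp add: herm_def cnj_vec_def)

lemma formA_cnj_vec: "formA F x *v cnj_vec y = cnj_vec (formA F x *v y)"
  by (simp add: formA_def cmat_def map_matrix_def matrix_vector_mult_def cnj_vec_def vec_eq_iff)

lemma cnj_vec_sum: "cnj_vec (\<Sum>i\<in>A. f i) = (\<Sum>i\<in>A. cnj_vec (f i))"
  by (rule linear_sum[OF bounded_linear.linear[OF bounded_linear_cnj_vec]])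

lemma formB_cnj_vec: "formB F x (cnj_vec y) (cnj_vec z) = cnj_vec (formB F x y z)"
  unfolding formB_def cnj_vec_sum cnj_vec_smult cnj_vec_cvec by (simp add: cnj_vec_def)

text \<open>The matrix has real entries, so its transpose is its adjoint for the Hermitian
  product.\<close>

lemma herm_transpose_formA: "herm (transpose (formA F x) *v a) y = herm a (formA F x *v y)"
proof -
  have "herm (transpose (formA F x) *v a) y = (\<Sum>i\<in>UNIV. \<Sum>j\<in>UNIV. of_real (jacobian F (at x) $ j $ i) * cnj (a $ j) * y $ i)"
    by (simp add: herm_def formA_def cmat_def map_matrix_def matrix_vector_mult_def transpose_def sum_distrib_right)
  also have "\<dots> = (\<Sum>j\<in>UNIV. \<Sum>i\<in>UNIV. of_real (jacobian F (at x) $ j $ i) * cnj (a $ j) * y $ i)"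
    by (rule sum.swap)
  also have "\<dots> = herm a (formA F x *v y)"
    by (simp add: herm_def formA_def cmat_def map_matrix_def matrix_vector_mult_def sum_distrib_left mult_ac)
  finally show ?thesis .
qed

text \<open>In the derivative of the pairing of \<psi> with \<open>x\<close> the two terms
  containing the Jacobian cancel, leaving the pairing with the forcing \<open>f\<close>.\<close>

lemma adjoint_pairing_integral:
  assumes T: "T \<ge> 0"
    and \<psi>: "\<And>\<tau>. \<tau> \<in> {0..T} \<Longrightarrow> (\<psi> has_vector_derivative - (transpose (formA F (u0 \<tau>)) *v \<psi> \<tau>)) (at \<tau> within {0..T})"
    and x: "\<And>\<tau>. \<tau> \<in> {0..T} \<Longrightarrow> (x has_vector_derivative formA F (u0 \<tau>) *v x \<tau> + f \<tau>) (at \<tau> within {0..T})"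
  shows "((\<lambda>\<tau>. herm (\<psi> \<tau>) (f \<tau>)) has_integral (herm (\<psi> T) (x T) - herm (\<psi> 0) (x 0))) {0..T}"
proof -
  have "((\<lambda>\<tau>. herm (\<psi> \<tau>) (x \<tau>)) has_vector_derivative herm (\<psi> \<tau>) (f \<tau>)) (at \<tau> within {0..T})"
    if "\<tau> \<in> {0..T}" for \<tau>
    using bounded_bilinear.has_vector_derivative[OF bounded_bilinear_herm \<psi>[OF that] x[OF that]]
    unfolding herm_simps herm_transpose_formA by simp
  from fundamental_theorem_of_calculus[OF T this] show ?thesis .
qed

text \<open>The solvability condition: when \<psi> and \<open>x\<close> share a multiplier \<mu> of
  modulus one, \<open>cnj \<mu> * \<mu> = 1\<close> makes the boundary terms cancel, so the forcing
  is orthogonal to \<psi>.\<close>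

lemma adjoint_integral_zero:
  assumes T: "T \<ge> 0"
    and \<psi>: "\<And>\<tau>. \<tau> \<in> {0..T} \<Longrightarrow> (\<psi> has_vector_derivative - (transpose (formA F (u0 \<tau>)) *v \<psi> \<tau>)) (at \<tau> within {0..T})"
    and x: "\<And>\<tau>. \<tau> \<in> {0..T} \<Longrightarrow> (x has_vector_derivative formA F (u0 \<tau>) *v x \<tau> + f \<tau>) (at \<tau> within {0..T})"
    and bc: "\<psi> T = \<mu> *s \<psi> 0" "x T = \<mu> *s x 0" "norm \<mu> = 1"
  shows "((\<lambda>\<tau>. herm (\<psi> \<tau>) (f \<tau>)) has_integral 0) {0..T}"
proof -
  have "cnj \<mu> * \<mu> = 1"
    using bc(3) complex_norm_square[of \<mu>] by (simp add: mult.commute)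
  then have "herm (\<psi> T) (x T) = herm (\<psi> 0) (x 0)"
    unfolding bc(1,2) herm_smult mult.assoc[symmetric] by (simp add: mult.commute)
  then show ?thesis using adjoint_pairing_integral[OF T \<psi> x] by simp
qed

section \<open>Differential equations and boundary conditions of the coefficients\<close>

context R3_manifold
begin

text \<open>The right-hand sides of the equations for the \<open>h k l\<close>, indexed like \<open>h\<close>: the right-hand sides of the equations
  for \<open>Q2 h w\<close> and \<open>Q3 h w\<close> are then \<open>Q2 rhs_coef w\<close> and \<open>Q3 rhs_coef w\<close>, so that formulas recovering \<open>h\<close> from
  \<open>Q2\<close> and \<open>Q3\<close> apply to both sides.\<close>

definition rhs_coef :: "nat \<Rightarrow> nat \<Rightarrow> real \<Rightarrow> complex^'n" where
  "rhs_coef k l \<tau> = (let A = formA F (u0 \<tau>); B = formB F (u0 \<tau>); C = formC F (u0 \<tau>); y = v \<tau>; z = cnj_vec (v \<tau>);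
      F0 = cvec (F (u0 \<tau>)) in
    if (k, l) = (2, 0) then A *v h 2 0 \<tau> + (B y y - (2 * cnj b) *s z)
    else if (k, l) = (1, 1) then A *v h 1 1 \<tau> + (B y z - of_real \<alpha>1 *s F0)
    else if (k, l) = (0, 2) then A *v h 0 2 \<tau> + (B z z - (2 * b) *s y)
    else if (k, l) = (3, 0) then A *v h 3 0 \<tau> + (C y y y + 3 *s B y (h 2 0 \<tau>) - (6 * cnj b) *s h 1 1 \<tau> - (3 * (\<alpha>2 + cnj \<alpha>3)) *s F0)
    else if (k, l) = (2, 1) then A *v h 2 1 \<tau> + (C y y z + 2 *s B y (h 1 1 \<tau>) + B z (h 2 0 \<tau>)
        - (2 * of_real \<alpha>1) *s (A *v y) - (2 * c) *s y - (2 * cnj b) *s h 0 2 \<tau>)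
    else if (k, l) = (1, 2) then A *v h 1 2 \<tau> + (C y z z + 2 *s B z (h 1 1 \<tau>) + B y (h 0 2 \<tau>)
        - (2 * of_real \<alpha>1) *s (A *v z) - (2 * cnj c) *s z - (2 * b) *s h 2 0 \<tau>)
    else A *v h 0 3 \<tau> + (C z z z + 3 *s B z (h 0 2 \<tau>) - (6 * b) *s h 1 1 \<tau> - (3 * (cnj \<alpha>2 + \<alpha>3)) *s F0))"

lemma norm_square_smult: "of_real ((norm w)\<^sup>2) = w * cnj w"
  using complex_norm_square[of w] by simp

lemma Q2_rhs_eq: "Q2_rhs w \<tau> = Q2 rhs_coef w \<tau>"
proof -
  have "Q2_rhs w \<tau> = formA F (u0 \<tau>) *v Q2 h w \<tau>
      + (1/2) *s (w\<^sup>2 *s formB F (u0 \<tau>) (v \<tau>) (v \<tau>) + (2 * (w * cnj w)) *s formB F (u0 \<tau>) (v \<tau>) (cnj_vec (v \<tau>))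
          + (cnj w)\<^sup>2 *s formB F (u0 \<tau>) (cnj_vec (v \<tau>)) (cnj_vec (v \<tau>)))
      - ((b * (cnj w)\<^sup>2) *s v \<tau> + (cnj b * w\<^sup>2) *s cnj_vec (v \<tau>)) - (of_real \<alpha>1 * (w * cnj w)) *s cvec (F (u0 \<tau>))"
    unfolding Q2_rhs_def lin_part_def formB_add_left formB_add_right formB_smult_left formB_smult_right
      formB_commute[OF F_Ck(2), of _ "cnj_vec (v \<tau>)" "v \<tau>"] scaleR_eq_smult acoef2_def gcoef2_def of_real_mult norm_square_smult
    by (simp add: vec_eq_iff power2_eq_square algebra_simps)
  also have "\<dots> = Q2 rhs_coef w \<tau>"
    unfolding Q2_def rhs_coef_def Let_def
    by (simp add: matrix_vector_right_distrib vector_scalar_commute, simp add: vec_eq_iff field_simps)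
  finally show ?thesis .
qed

lemma formC_cube:
  "formC F (u0 \<tau>) (x *s y + x' *s z) (x *s y + x' *s z) (x *s y + x' *s z) =
    x ^ 3 *s formC F (u0 \<tau>) y y y + (3 * (x\<^sup>2 * x')) *s formC F (u0 \<tau>) y y z + (3 * (x * x'\<^sup>2)) *s formC F (u0 \<tau>) y z z
     + x' ^ 3 *s formC F (u0 \<tau>) z z z"
proof -
  have "formC F (u0 \<tau>) y z y = formC F (u0 \<tau>) y y z" "formC F (u0 \<tau>) z y y = formC F (u0 \<tau>) y y z"
     "formC F (u0 \<tau>) z y z = formC F (u0 \<tau>) y z z" "formC F (u0 \<tau>) z z y = formC F (u0 \<tau>) y z z"
    using formC_commute12[OF F_Ck(1)] formC_commute23[OF F_Ck(1)] by metis+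
  then show ?thesis
    unfolding formC_add1 formC_add2 formC_add3 formC_smult1 formC_smult2 formC_smult3
    by (simp add: vec_eq_iff power2_eq_square power3_eq_cube algebra_simps)
qed

lemma Q3_rhs_eq: "Q3_rhs w \<tau> = Q3 rhs_coef w \<tau>"
proof -
  let ?A = "formA F (u0 \<tau>)" and ?B = "formB F (u0 \<tau>)" and ?C = "formC F (u0 \<tau>)" and ?y = "v \<tau>" and ?z = "cnj_vec (v \<tau>)"
  \<comment> \<open>The real part is written as half the sum with the conjugate, a polynomial in
    \<open>w\<close> and \<open>cnj w\<close>. This is the source of the combinations of \<alpha>2
    and \<alpha>3 in \<open>rhs_coef\<close> at (3, 0) and (0, 3).\<close>
  have re: "of_real (acoef3 w) = (1/2) * ((\<alpha>2 + cnj \<alpha>3) * w ^ 3 + (cnj \<alpha>2 + \<alpha>3) * cnj w ^ 3)"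
  proof -
    have "of_real (acoef3 w) = (1/2) * ((\<alpha>2 * w ^ 3 + \<alpha>3 * cnj w ^ 3) + cnj (\<alpha>2 * w ^ 3 + \<alpha>3 * cnj w ^ 3))"
      unfolding acoef3_def complex_add_cnj by simp
    then show ?thesis by (simp add: algebra_simps)
  qed
  have "Q3_rhs w \<tau> = ?A *v Q3 h w \<tau>
      + ((w ^ 3 / 2) *s ?B ?y (h 2 0 \<tau>) + (w\<^sup>2 * cnj w) *s ?B ?y (h 1 1 \<tau>) + (w * (cnj w)\<^sup>2 / 2) *s ?B ?y (h 0 2 \<tau>)
        + (w\<^sup>2 * cnj w / 2) *s ?B ?z (h 2 0 \<tau>) + (w * (cnj w)\<^sup>2) *s ?B ?z (h 1 1 \<tau>) + (cnj w ^ 3 / 2) *s ?B ?z (h 0 2 \<tau>))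
      + (1/6) *s (w ^ 3 *s ?C ?y ?y ?y + (3 * (w\<^sup>2 * cnj w)) *s ?C ?y ?y ?z + (3 * (w * (cnj w)\<^sup>2)) *s ?C ?y ?z ?z
        + cnj w ^ 3 *s ?C ?z ?z ?z)
      - ((c * w * (w * cnj w)) *s ?y + (cnj c * cnj w * (w * cnj w)) *s ?z)
      - ((w * (b * (cnj w)\<^sup>2)) *s h 2 0 \<tau> + (w * (cnj b * w\<^sup>2) + cnj w * (b * (cnj w)\<^sup>2)) *s h 1 1 \<tau> + (cnj w * (cnj b * w\<^sup>2)) *s h 0 2 \<tau>)
      - ((1/2) * ((\<alpha>2 + cnj \<alpha>3) * w ^ 3 + (cnj \<alpha>2 + \<alpha>3) * cnj w ^ 3)) *s cvec (F (u0 \<tau>))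
      - (of_real \<alpha>1 * (w * cnj w)) *s (w *s (?A *v ?y) + cnj w *s (?A *v ?z))"
    unfolding Q3_rhs_def scaleR_eq_smult re
    unfolding lin_part_def formC_cube
    unfolding Q2_def dQ2_def formB_add_left formB_add_right formB_smult_left formB_smult_right
      acoef2_def gcoef2_def gcoef3_def of_real_mult norm_square_smult matrix_vector_right_distrib vector_scalar_commute
    by (simp add: vec_eq_iff power2_eq_square power3_eq_cube algebra_simps)
  also have "\<dots> = Q3 rhs_coef w \<tau>"
    unfolding Q3_def rhs_coef_def Let_def
    by (simp add: matrix_vector_right_distrib vector_scalar_commute,
        simp add: vec_eq_iff power2_eq_square power3_eq_cube field_simps)
  finally show ?thesis .
qed

lemma h_derivatives:
  assumes "t \<in> I"
  shows "(h 2 0 has_vector_derivative rhs_coef 2 0 t) (at t within I)"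
    and "(h 1 1 has_vector_derivative rhs_coef 1 1 t) (at t within I)"
    and "(h 2 1 has_vector_derivative rhs_coef 2 1 t) (at t within I)"
proof -
  note D2 = Q_derivatives(1)[OF assms, unfolded Q2_rhs_eq] and D3 = Q_derivatives(2)[OF assms, unfolded Q3_rhs_eq]
  note rules = has_vector_derivative_smult has_vector_derivative_add has_vector_derivative_diff
  have "((\<lambda>\<tau>. (1/2) *s (Q2 h 1 \<tau> - Q2 h \<i> \<tau> - \<i> *s (Q2 h (1 + \<i>) \<tau> - Q2 h 1 \<tau> - Q2 h \<i> \<tau>))) has_vector_derivative
      (1/2) *s (Q2 rhs_coef 1 t - Q2 rhs_coef \<i> t - \<i> *s (Q2 rhs_coef (1 + \<i>) t - Q2 rhs_coef 1 t - Q2 rhs_coef \<i> t))) (at t within I)"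
    by (intro rules D2)
  then show "(h 2 0 has_vector_derivative rhs_coef 2 0 t) (at t within I)"
    unfolding h20_eq_Q2[symmetric] .
  have "((\<lambda>\<tau>. (1/2) *s (Q2 h 1 \<tau> + Q2 h \<i> \<tau>)) has_vector_derivative
      (1/2) *s (Q2 rhs_coef 1 t + Q2 rhs_coef \<i> t)) (at t within I)"
    by (intro rules D2)
  then show "(h 1 1 has_vector_derivative rhs_coef 1 1 t) (at t within I)"
    unfolding h11_eq_Q2[symmetric] .
  have "((\<lambda>\<tau>. (1/2) *s (Q3 h 1 \<tau> - \<i> *s Q3 h \<i> \<tau> + ((1 - \<i>) / 4) *s Q3 h (1 + \<i>) \<tau>
      - ((1 + \<i>) / 4) *s Q3 h (- 1 + \<i>) \<tau>)) has_vector_derivative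
      (1/2) *s (Q3 rhs_coef 1 t - \<i> *s Q3 rhs_coef \<i> t + ((1 - \<i>) / 4) *s Q3 rhs_coef (1 + \<i>) t
      - ((1 + \<i>) / 4) *s Q3 rhs_coef (- 1 + \<i>) t)) (at t within I)"
    by (intro rules D3)
  then show "(h 2 1 has_vector_derivative rhs_coef 2 1 t) (at t within I)"
    unfolding h21_eq_Q3[symmetric] .
qed

text \<open>The cycle and the linear part are themselves invariant under the simultaneous shift of
  \<tau> and rotation of \<xi>, since the rotation undoes the multiplier of \<open>v\<close>. The
  symmetry of the parametrization therefore passes to \<open>H\<close>.\<close>

lemma H_shift:
  assumes "norm \<xi> < r"
  shows "H (\<tau>, \<xi>) = H (\<tau> + T, cis (- (2 * pi / 3)) * \<xi>)"
proof -
  let ?z = "cis (- (2 * pi / 3))"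
  have vT: "v (\<tau> + T) = cis (2 * pi / 3) *s v \<tau>" using v unfolding eigfun_v_def by blast
  have zz: "?z * cis (2 * pi / 3) = 1" "cnj ?z * cnj (cis (2 * pi / 3)) = 1"
    by (simp_all add: cis_cnj cis_mult )
  have "lin_part v (\<tau> + T) (?z * \<xi>) = (?z * cis (2 * pi / 3) * \<xi>) *s v \<tau>
      + (cnj ?z * cnj (cis (2 * pi / 3)) * cnj \<xi>) *s cnj_vec (v \<tau>)"
    unfolding lin_part_def vT cnj_vec_smult vector_smult_assoc complex_cnj_mult by (simp add: mult_ac)
  also have "\<dots> = lin_part v \<tau> \<xi>" unfolding zz lin_part_def by simp
  finally have "lin_part v (\<tau> + T) (?z * \<xi>) = lin_part v \<tau> \<xi>" .
  moreover have "u0 (\<tau> + T) = u0 \<tau>" using per by (simp add: periodic_solution_def)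
  ultimately show ?thesis
    using sym[of \<xi> \<tau>] assms by (simp add: cm_param_eq)
qed

text \<open>The symmetry of \<open>H\<close> is read at a fixed time: the two expansions in
  \<epsilon> agree along every ray, so all values of \<open>Q2\<close> and \<open>Q3\<close> agree,
  and these determine the coefficients.\<close>

lemma h_shift:
  "h 2 0 \<tau> = (cis (- (2 * pi / 3)))\<^sup>2 *s h 2 0 (\<tau> + T)"
  "h 1 1 \<tau> = h 1 1 (\<tau> + T)"
  "h 2 1 \<tau> = ((cis (- (2 * pi / 3)))\<^sup>2 * cnj (cis (- (2 * pi / 3)))) *s h 2 1 (\<tau> + T)"
proof -
  let ?z = "cis (- (2 * pi / 3))"
  define h' where "h' = (\<lambda>k l \<tau>. (?z ^ k * cnj ?z ^ l) *s h k l (\<tau> + T))"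
  have Q': "Q2 h (?z * w) (\<tau> + T) = Q2 h' w \<tau>" "Q3 h (?z * w) (\<tau> + T) = Q3 h' w \<tau>" for w
    by (simp_all add: Q2_def Q3_def h'_def vec_eq_iff power_mult_distrib algebra_simps)
  have Q: "Q2 h w \<tau> = Q2 h' w \<tau> \<and> Q3 h w \<tau> = Q3 h' w \<tau>" for w
  proof -
    obtain \<delta> where \<delta>: "\<delta> > 0" "\<And>\<epsilon>. 0 < \<epsilon> \<Longrightarrow> \<epsilon> < \<delta> \<Longrightarrow> norm (complex_of_real \<epsilon> * w) < r"
      using ray_small[of w] by blast
    have a: "Oe {\<tau>} 4 (\<lambda>_ \<epsilon>. cvec (H (\<tau>, of_real \<epsilon> * w)) - (\<epsilon> ^ 2 *\<^sub>R Q2 h w \<tau> + \<epsilon> ^ 3 *\<^sub>R Q3 h w \<tau>))"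
      using H_ray_expansion[of "{\<tau>}" w] unfolding Oe_def by simp
    have b: "Oe {\<tau>} 4 (\<lambda>_ \<epsilon>. cvec (H (\<tau> + T, of_real \<epsilon> * (?z * w))) - (\<epsilon> ^ 2 *\<^sub>R Q2 h' w \<tau> + \<epsilon> ^ 3 *\<^sub>R Q3 h' w \<tau>))"
      using H_ray_expansion[of "{\<tau> + T}" "?z * w"] unfolding Oe_def Q'[symmetric] by simp
    have "Oe {\<tau>} 4 (\<lambda>_ \<epsilon>. 0 + \<epsilon> *\<^sub>R 0 + \<epsilon> ^ 2 *\<^sub>R (Q2 h' w \<tau> - Q2 h w \<tau>) + \<epsilon> ^ 3 *\<^sub>R (Q3 h' w \<tau> - Q3 h w \<tau>))"
    proof (rule Oe_cong[OF Oe_diff[OF a b] \<delta>(1)])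
      fix t \<epsilon> :: real assume "0 < \<epsilon>" "\<epsilon> < \<delta>"
      then have "H (\<tau>, of_real \<epsilon> * w) = H (\<tau> + T, of_real \<epsilon> * (?z * w))"
        using H_shift[OF \<delta>(2)[of \<epsilon>], of \<tau>] by (simp add: mult_ac)
      then show "0 + \<epsilon> *\<^sub>R 0 + \<epsilon> ^ 2 *\<^sub>R (Q2 h' w \<tau> - Q2 h w \<tau>) + \<epsilon> ^ 3 *\<^sub>R (Q3 h' w \<tau> - Q3 h w \<tau>) =
        cvec (H (\<tau>, of_real \<epsilon> * w)) - (\<epsilon> ^ 2 *\<^sub>R Q2 h w \<tau> + \<epsilon> ^ 3 *\<^sub>R Q3 h w \<tau>) -
        (cvec (H (\<tau> + T, of_real \<epsilon> * (?z * w))) - (\<epsilon> ^ 2 *\<^sub>R Q2 h' w \<tau> + \<epsilon> ^ 3 *\<^sub>R Q3 h' w \<tau>))"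
        by (simp add: scaleR_diff_right)
    qed
    from Oe_cubic_zero(3,4)[OF this] show ?thesis by simp
  qed
  then have q2: "Q2 h w \<tau> = Q2 h' w \<tau>" and q3: "Q3 h w \<tau> = Q3 h' w \<tau>" for w by auto
  have "h 2 0 \<tau> = h' 2 0 \<tau>" "h 1 1 \<tau> = h' 1 1 \<tau>" "h 2 1 \<tau> = h' 2 1 \<tau>"
    unfolding h20_eq_Q2[of h] h11_eq_Q2[of h] h21_eq_Q3[of h] q2 q3
    unfolding h20_eq_Q2[of h'] h11_eq_Q2[of h'] h21_eq_Q3[of h'] by (rule refl)+
  moreover have "?z * cnj ?z = 1" using complex_norm_square[of ?z] by simp
  ultimately show "h 2 0 \<tau> = ?z\<^sup>2 *s h 2 0 (\<tau> + T)" "h 1 1 \<tau> = h 1 1 (\<tau> + T)"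
    "h 2 1 \<tau> = (?z\<^sup>2 * cnj ?z) *s h 2 1 (\<tau> + T)"
    unfolding h'_def by simp_all
qed

text \<open>The factor over one period is the (k - l)-th power of the multiplier of
  \<open>v\<close>, a cube root of unity. For \<open>h 0 2\<close> the exponent -2 is congruent to 1
  modulo 3: this is the resonance that gives it the multiplier of \<open>v\<close>, like
  \<open>h 2 1\<close>.\<close>

lemma h_boundary:
  "h 2 0 T = cis (4 * pi / 3) *s h 2 0 0" "h 1 1 T = h 1 1 0" "h 2 1 T = cis (2 * pi / 3) *s h 2 1 0"
  "h 0 2 T = cis (2 * pi / 3) *s h 0 2 0"
proof -
  have z2: "cis (4 * pi / 3) * (cis (- (2 * pi / 3)))\<^sup>2 = 1"
    by (simp add: power2_eq_square cis_mult)
  show 20: "h 2 0 T = cis (4 * pi / 3) *s h 2 0 0"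
    using h_shift(1)[of 0] z2 by (simp add: vector_smult_assoc)
  show "h 1 1 T = h 1 1 0" using h_shift(2)[of 0] by simp
  have z1: "cis (2 * pi / 3) * ((cis (- (2 * pi / 3)))\<^sup>2 * cnj (cis (- (2 * pi / 3)))) = 1"
    by (simp add: power2_eq_square cis_mult cis_cnj)
  show "h 2 1 T = cis (2 * pi / 3) *s h 2 1 0"
    using h_shift(3)[of 0] z1 by (simp add: vector_smult_assoc)
  have "cis (4 * pi / 3) = cis (- (2 * pi / 3))"
  proof -
    have "4 * pi / 3 = - (2 * pi / 3) + 2 * pi" by simp
    then show ?thesis by (metis cis_mult cis_2pi mult.right_neutral)
  qed
  then have "cnj (cis (4 * pi / 3)) = cis (2 * pi / 3)" by (simp add: cis_cnj)
  then show "h 0 2 T = cis (2 * pi / 3) *s h 0 2 0"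
    unfolding h_cnj[of 0 2] 20 cnj_vec_smult by simp
qed

end

section \<open>Normal form coefficients and boundary value problems\<close>

lemma cmat_matrix_mult: "cmat (M ** N) = cmat M ** cmat N"
  by (simp add: cmat_def map_matrix_def matrix_matrix_mult_def vec_eq_iff)

lemma linear_cmat_vector: "linear (\<lambda>M. cmat M *v x)"
  by (rule linearI)
     (simp_all add: cmat_def map_matrix_def matrix_vector_mult_def vec_eq_iff sum.distrib[symmetric] sum_distrib_left
       scaleR_conv_of_real[where 'a=complex] algebra_simps)

lemma herm_axis: "herm a (axis j 1) = cnj (a $ j)"
proof -
  have "herm a (axis j 1) = (\<Sum>i\<in>UNIV. if i = j then cnj (a $ i) else 0)"
    unfolding herm_def axis_def by (rule sum.cong) auto
  then show ?thesis by simp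
qed

lemma herm_matrix_axis: "herm a (M *v axis j 1) = (transpose M *v cnj_vec a) $ j"
proof -
  have "M *v axis j 1 = column j M"
    by (simp add: matrix_vector_mult_def axis_def column_def vec_eq_iff if_distrib cong: if_cong)
  then show ?thesis
    by (simp add: herm_def column_def matrix_vector_mult_def transpose_def cnj_vec_def mult.commute)
qed

section \<open>Boundary value problems and the monodromy matrix\<close>

context R3_manifold
begin

lemma linear_ode_zero:
  assumes x: "\<And>\<tau>. \<tau> \<in> I \<Longrightarrow> (x has_vector_derivative M \<tau> *v x \<tau>) (at \<tau> within I)"
    and M: "\<And>i j. continuous_on I (\<lambda>\<tau>. M \<tau> $ i $ j)" and 0: "x 0 = 0" and "\<tau> \<in> I"
  shows "x \<tau> = (0 :: complex^'n)"
proof -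
  have cont: "continuous_on I (\<lambda>\<tau>. \<Sum>i\<in>UNIV. \<Sum>j\<in>UNIV. norm (M \<tau> $ i $ j))"
    by (intro continuous_on_sum continuous_on_norm M)
  obtain L where L: "\<And>\<tau>. \<tau> \<in> I \<Longrightarrow> (\<Sum>i\<in>UNIV. \<Sum>j\<in>UNIV. norm (M \<tau> $ i $ j)) \<le> L"
    using bounded_on_I[OF cont] by blast
  show ?thesis
  proof (rule zero_if_vector_derivative_le_linear[OF x _ 0 assms(4)])
    fix t assume "t \<in> I"
    from order_trans[OF norm_matrix_vector_le mult_right_mono[OF L[OF this] norm_ge_zero]]
    show "norm (M t *v x t) \<le> L * norm (x t)" .
  qed
qed

lemma linearized_zero:
  assumes "\<And>\<tau>. \<tau> \<in> I \<Longrightarrow> (x has_vector_derivative formA F (u0 \<tau>) *v x \<tau>) (at \<tau> within I)" "x 0 = 0" "\<tau> \<in> I"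
  shows "x \<tau> = 0"
  by (rule linear_ode_zero[where x=x and M="\<lambda>\<tau>. formA F (u0 \<tau>)", OF _ continuous_formA_entry assms(2,3)]) (rule assms(1))

lemma adjoint_zero:
  assumes x: "\<And>\<tau>. \<tau> \<in> I \<Longrightarrow> (x has_vector_derivative - (transpose (formA F (u0 \<tau>)) *v x \<tau>)) (at \<tau> within I)"
    and "x 0 = 0" "\<tau> \<in> I"
  shows "x \<tau> = 0"
proof (rule linear_ode_zero[where x=x and M="\<lambda>\<tau>. - transpose (formA F (u0 \<tau>))", OF _ _ assms(2,3)])
  have neg: "(- M) *v y = - (M *v y)" for M :: "complex^'n^'n" and y
    by (simp add: matrix_vector_mult_def vec_eq_iff sum_negf)
  show "(x has_vector_derivative (- transpose (formA F (u0 t))) *v x t) (at t within I)" if "t \<in> I" for t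
    unfolding neg by (rule x[OF that])
  show "continuous_on I (\<lambda>\<tau>. (- transpose (formA F (u0 \<tau>))) $ i $ j)" for i j
    using continuous_formA_entry[of I j i] by (simp add: transpose_def continuous_on_minus)
qed

lemma fundamental_solution:
  assumes Y: "fundamental_matrix F u0 Y"
  shows "((\<lambda>\<tau>. cmat (Y \<tau>) *v x) has_vector_derivative formA F (u0 \<tau>) *v (cmat (Y \<tau>) *v x)) (at \<tau> within S)"
    and "cmat (Y 0) *v x = x"
proof -
  have "(Y has_vector_derivative (jacobian F (at (u0 \<tau>)) ** Y \<tau>)) (at \<tau> within S)"
    using Y by (auto simp: fundamental_matrix_def has_vector_derivative_at_within)
  from bounded_linear.has_vector_derivative[OF linear_conv_bounded_linear[THEN iffD1, OF linear_cmat_vector] this]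
  show "((\<lambda>\<tau>. cmat (Y \<tau>) *v x) has_vector_derivative formA F (u0 \<tau>) *v (cmat (Y \<tau>) *v x)) (at \<tau> within S)"
    by (simp add: cmat_matrix_mult formA_def matrix_vector_mul_assoc)
  have "cmat (Y 0) = mat 1"
    using Y by (simp add: fundamental_matrix_def cmat_def map_matrix_def mat_def vec_eq_iff)
  then show "cmat (Y 0) *v x = x" by simp
qed

lemma linearized_solution:
  assumes Y: "fundamental_matrix F u0 Y"
    and x: "\<And>\<tau>. \<tau> \<in> I \<Longrightarrow> (x has_vector_derivative formA F (u0 \<tau>) *v x \<tau>) (at \<tau> within I)" and \<tau>: "\<tau> \<in> I"
  shows "x \<tau> = cmat (Y \<tau>) *v x 0"
proof -
  have "x \<tau> - cmat (Y \<tau>) *v x 0 = 0"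
  proof (rule linearized_zero[OF _ _ \<tau>])
    fix t assume "t \<in> I"
    from has_vector_derivative_diff[OF x[OF this] fundamental_solution(1)[OF Y]]
    show "((\<lambda>\<tau>. x \<tau> - cmat (Y \<tau>) *v x 0) has_vector_derivative formA F (u0 t) *v (x t - cmat (Y t) *v x 0)) (at t within I)"
      by (simp add: matrix_vector_mult_diff_distrib)
  qed (simp add: fundamental_solution(2)[OF Y])
  then show ?thesis by simp
qed

text \<open>A solution is the fundamental matrix applied to its initial value, so the boundary
  condition says that this value is an eigenvector of \<open>Y T\<close> for \<mu>. The eigenspace
  of a simple root is a line.\<close>

lemma linearized_bvp_1dim:
  assumes Y: "fundamental_matrix F u0 Y" and ord: "order \<mu> (charpoly (cmat (Y T))) = 1"
    and e: "\<And>\<tau>. \<tau> \<in> I \<Longrightarrow> (e has_vector_derivative formA F (u0 \<tau>) *v e \<tau>) (at \<tau> within I)" "e T = \<mu> *s e 0" "e 0 \<noteq> 0"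
    and x: "\<And>\<tau>. \<tau> \<in> I \<Longrightarrow> (x has_vector_derivative formA F (u0 \<tau>) *v x \<tau>) (at \<tau> within I)" "x T = \<mu> *s x 0"
  obtains k where "\<And>\<tau>. \<tau> \<in> I \<Longrightarrow> x \<tau> = k *s e \<tau>"
proof -
  have T: "T \<in> I" using T_pos by simp
  have "cmat (Y T) *v e 0 = \<mu> *s e 0" "cmat (Y T) *v x 0 = \<mu> *s x 0"
    using linearized_solution[OF Y e(1) T] linearized_solution[OF Y x(1) T] e(2) x(2) by auto
  then obtain k where k: "x 0 = k *s e 0"
    using simple_root_imp_eigenspace_1dim[OF ord] e(3) by metis
  show ?thesis
  proof (rule that)
    fix \<tau> assume \<tau>: "\<tau> \<in> I"
    show "x \<tau> = k *s e \<tau>"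
      using linearized_solution[OF Y x(1) \<tau>] linearized_solution[OF Y e(1) \<tau>] by (simp add: k vector_scalar_commute)
  qed
qed

text \<open>The pairing of an adjoint solution with any column of the fundamental matrix is
  constant. Compared at 0 and T, this makes the conjugate of its initial value an eigenvector of the
  transposed monodromy matrix, which has the same characteristic polynomial.\<close>

lemma adjoint_bvp_1dim:
  assumes Y: "fundamental_matrix F u0 Y" and ord: "order \<mu> (charpoly (cmat (Y T))) = 1" and \<mu>: "norm \<mu> = 1"
    and e: "\<And>\<tau>. \<tau> \<in> I \<Longrightarrow> (e has_vector_derivative - (transpose (formA F (u0 \<tau>)) *v e \<tau>)) (at \<tau> within I)" "e T = \<mu> *s e 0" "e 0 \<noteq> 0"
    and x: "\<And>\<tau>. \<tau> \<in> I \<Longrightarrow> (x has_vector_derivative - (transpose (formA F (u0 \<tau>)) *v x \<tau>)) (at \<tau> within I)" "x T = \<mu> *s x 0"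
  obtains k where "\<And>\<tau>. \<tau> \<in> I \<Longrightarrow> x \<tau> = k *s e \<tau>"
proof -
  let ?M = "cmat (Y T)"
  have eig: "transpose ?M *v cnj_vec (y 0) = \<mu> *s cnj_vec (y 0)"
    if y: "\<And>\<tau>. \<tau> \<in> I \<Longrightarrow> (y has_vector_derivative - (transpose (formA F (u0 \<tau>)) *v y \<tau>)) (at \<tau> within I)" "y T = \<mu> *s y 0" for y
  proof -
    have "(transpose ?M *v cnj_vec (y 0)) $ j = \<mu> * cnj (y 0 $ j)" for j
    proof -
      \<comment> \<open>Column \<open>j\<close> of the fundamental matrix, a solution of the
        linearized equation starting at the basis vector.\<close>
      let ?s = "\<lambda>\<tau>. cmat (Y \<tau>) *v axis j 1"
      have "(?s has_vector_derivative formA F (u0 \<tau>) *v ?s \<tau> + 0) (at \<tau> within I)" for \<tau>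
        using fundamental_solution(1)[OF Y] by simp
      from adjoint_pairing_integral[OF less_imp_le[OF T_pos] y(1) this]
      have "((\<lambda>\<tau>. herm (y \<tau>) 0) has_integral herm (y T) (?s T) - herm (y 0) (?s 0)) I" by blast
      moreover have "herm (y \<tau>) 0 = 0" for \<tau> by (simp add: herm_def)
      ultimately have "((\<lambda>\<tau>. 0) has_integral herm (y T) (?s T) - herm (y 0) (?s 0)) I" by simp
      then have "herm (y T) (?s T) = herm (y 0) (?s 0)"
        using has_integral_0_eq by fastforce
      then have "cnj \<mu> * (transpose ?M *v cnj_vec (y 0)) $ j = cnj (y 0 $ j)"
        unfolding y(2) herm_smult(1) fundamental_solution(2)[OF Y] herm_axis
        unfolding herm_matrix_axis .
      then have "\<mu> * cnj (y 0 $ j) = (\<mu> * cnj \<mu>) * (transpose ?M *v cnj_vec (y 0)) $ j" by simp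
      also have "\<mu> * cnj \<mu> = 1" using \<mu> complex_norm_square[of \<mu>] by simp
      finally show ?thesis by simp
    qed
    then show ?thesis by (simp add: vec_eq_iff cnj_vec_def)
  qed
  have "cnj_vec (e 0) \<noteq> 0"
    using e(3) by (metis norm_cnj_vec norm_eq_zero)
  then obtain k where k: "cnj_vec (x 0) = k *s cnj_vec (e 0)"
    using simple_root_imp_eigenspace_1dim[of \<mu> "transpose ?M"] ord eig[OF e(1,2)] eig[OF x(1,2)] charpoly_transpose by metis
  have x0: "x 0 = cnj k *s e 0"
    using arg_cong[OF k, of cnj_vec] by (simp add: cnj_vec_smult)
  show ?thesis
  proof (rule that)
    fix \<tau> assume \<tau>: "\<tau> \<in> I"
    have "x \<tau> - cnj k *s e \<tau> = 0"
    proof (rule adjoint_zero[OF _ _ \<tau>])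
      fix t assume t: "t \<in> I"
      from has_vector_derivative_diff[OF x(1)[OF t] has_vector_derivative_smult[OF e(1)[OF t]]]
      show "((\<lambda>\<tau>. x \<tau> - cnj k *s e \<tau>) has_vector_derivative - (transpose (formA F (u0 t)) *v (x t - cnj k *s e t))) (at t within I)"
        by (rule has_vector_derivative_eq_rhs)
           (simp add: matrix_vector_mult_diff_distrib vector_scalar_commute vec_eq_iff del: transpose_matrix_vector)
    qed (simp add: x0)
    then show "x \<tau> = cnj k *s e \<tau>" by simp
  qed
qed

lemma int_herm:
  "continuous_on I x \<Longrightarrow> continuous_on I y \<Longrightarrow> (\<lambda>\<tau>. herm (x \<tau>) (y \<tau> :: complex^'n)) integrable_on I"
  by (intro integrable_continuous_real bounded_bilinear.continuous_on[OF bounded_bilinear_herm])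

end

section \<open>Solvability conditions and uniqueness for the normal form coefficients\<close>

lemma cis_4_pi_third: "cis (4 * pi / 3) = cnj (cis (2 * pi / 3))" "cis (- (2 * pi / 3)) = cnj (cis (2 * pi / 3))"
proof -
  show 1: "cis (- (2 * pi / 3)) = cnj (cis (2 * pi / 3))" by (simp add: cis_cnj)
  have "4 * pi / 3 = - (2 * pi / 3) + 2 * pi" by simp
  then have "cis (4 * pi / 3) = cis (- (2 * pi / 3)) * cis (2 * pi)" by (simp only: cis_mult)
  then show "cis (4 * pi / 3) = cnj (cis (2 * pi / 3))" by (simp add: 1)
qed

text \<open>The fundamental matrix is a parameter so that the systems for \<open>v\<close> and for
  \<gamma> v can be interpreted over the same monodromy matrix.\<close>

locale R3_normal_form = R3_manifold F u0 T v H h \<alpha>1 \<alpha>2 \<alpha>3 b c r p q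
  for F :: "real^'n \<Rightarrow> real^'n" and u0 T v H h \<alpha>1 \<alpha>2 \<alpha>3 b c r p q +
  fixes \<phi> :: "real \<Rightarrow> real^'n" and vs :: "real \<Rightarrow> complex^'n" and Y :: "real \<Rightarrow> real^'n^'n"
  assumes phi: "adjoint_phi F u0 T \<phi>" and vs: "adjoint_v F u0 T v vs"
    and n20: "integral {0..T} (\<lambda>\<tau>. herm (cnj_vec (vs \<tau>)) (h 2 0 \<tau>)) = 0"
    and n11: "integral {0..T} (\<lambda>\<tau>. herm (cvec (\<phi> \<tau>)) (h 1 1 \<tau>)) = 0"
    and Y: "fundamental_matrix F u0 Y" and mult: "R3_multipliers (Y T)"
begin

lemma vs_derivative: "\<tau> \<in> I \<Longrightarrow> (vs has_vector_derivative - (transpose (formA F (u0 \<tau>)) *v vs \<tau>)) (at \<tau> within I)"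
  and vs_T: "vs T = cis (2 * pi / 3) *s vs 0"
  and vs_v: "integral I (\<lambda>\<tau>. herm (vs \<tau>) (v \<tau>)) = 1"
  using vs unfolding adjoint_v_def by blast+

lemma cphi_derivative:
  assumes "\<tau> \<in> I"
  shows "((\<lambda>\<tau>. cvec (\<phi> \<tau>)) has_vector_derivative - (transpose (formA F (u0 \<tau>)) *v cvec (\<phi> \<tau>))) (at \<tau> within I)"
proof -
  have "(\<phi> has_vector_derivative - (transpose (jacobian F (at (u0 \<tau>))) *v \<phi> \<tau>)) (at \<tau> within I)"
    using phi assms unfolding adjoint_phi_def by blast
  from bounded_linear.has_vector_derivative[OF bounded_linear_cvec this]
  show ?thesis
    by (rule has_vector_derivative_eq_rhs)
       (simp add: formA_def cmat_def map_matrix_def matrix_vector_mult_def cvec_def vec_eq_iff transpose_def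
          del: transpose_matrix_vector)
qed

lemma phi_T: "cvec (\<phi> T) = 1 *s cvec (\<phi> 0)"
  and phi_F: "integral I (\<lambda>\<tau>. herm (cvec (\<phi> \<tau>)) (cvec (F (u0 \<tau>)))) = 1"
  using phi unfolding adjoint_phi_def by auto

lemma continuous_on_vs: "continuous_on I vs" and continuous_on_cphi: "continuous_on I (\<lambda>\<tau>. cvec (\<phi> \<tau>))"
  by (rule continuous_on_vector_derivative[OF vs_derivative] continuous_on_vector_derivative[OF cphi_derivative], assumption)+

text \<open>The conjugate of the equation for \<open>h 2 0\<close>. In this form the unknown has the
  multiplier of \<open>v\<close> and the forcing contains \<open>b\<close> unconjugated.\<close>

lemma h02_derivative:
  assumes "\<tau> \<in> I"
  shows "(h 0 2 has_vector_derivative formA F (u0 \<tau>) *v h 0 2 \<tau> +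
    (formB F (u0 \<tau>) (cnj_vec (v \<tau>)) (cnj_vec (v \<tau>)) - (2 * b) *s v \<tau>)) (at \<tau> within I)"
proof -
  have e: "h 0 2 = (\<lambda>\<tau>. cnj_vec (h 2 0 \<tau>))" using h_cnj by blast
  show ?thesis
    unfolding e using bounded_linear.has_vector_derivative[OF bounded_linear_cnj_vec h_derivatives(1)[OF assms]]
    by (rule has_vector_derivative_eq_rhs)
       (simp add: rhs_coef_def Let_def cnj_vec_add cnj_vec_diff cnj_vec_smult formA_cnj_vec formB_cnj_vec)
qed

text \<open>Solvability of the equation for \<open>h 0 2\<close> against \<open>vs\<close>; the
  normalization of \<open>vs\<close> against \<open>v\<close> turns the resonant term into 2
  b.\<close>

lemma b_eq: "b = 1 / 2 * integral I (\<lambda>\<tau>. herm (vs \<tau>) (formB F (u0 \<tau>) (cnj_vec (v \<tau>)) (cnj_vec (v \<tau>))))"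
proof -
  let ?B = "\<lambda>\<tau>. formB F (u0 \<tau>) (cnj_vec (v \<tau>)) (cnj_vec (v \<tau>))"
  have "((\<lambda>\<tau>. herm (vs \<tau>) (?B \<tau> - (2 * b) *s v \<tau>)) has_integral 0) I"
    by (rule adjoint_integral_zero[OF less_imp_le[OF T_pos] vs_derivative h02_derivative vs_T h_boundary(4)]) auto
  then have "integral I (\<lambda>\<tau>. herm (vs \<tau>) (?B \<tau>) - (2 * b) * herm (vs \<tau>) (v \<tau>)) = 0"
    by (simp add: herm_simps herm_smult integral_unique)
  then have "integral I (\<lambda>\<tau>. herm (vs \<tau>) (?B \<tau>)) - integral I (\<lambda>\<tau>. (2 * b) * herm (vs \<tau>) (v \<tau>)) = 0"
    by (subst (asm) integral_diff)
       (auto intro!: int_herm continuous_on_vs continuous_on_formB continuous_on_cnj_vec continuous_on_v integrable_on_mult_right)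
  then show ?thesis by (simp add: vs_v)
qed

text \<open>Solvability of the equation for \<open>h 1 1\<close>, which is periodic, against \<phi>;
  the normalization of \<phi> against the velocity isolates \<alpha>1.\<close>

lemma \<alpha>1_eq: "complex_of_real \<alpha>1 = integral I (\<lambda>\<tau>. herm (cvec (\<phi> \<tau>)) (formB F (u0 \<tau>) (v \<tau>) (cnj_vec (v \<tau>))))"
proof -
  let ?B = "\<lambda>\<tau>. formB F (u0 \<tau>) (v \<tau>) (cnj_vec (v \<tau>))" and ?F = "\<lambda>\<tau>. cvec (F (u0 \<tau>))"
  have d: "(h 1 1 has_vector_derivative formA F (u0 \<tau>) *v h 1 1 \<tau> + (?B \<tau> - of_real \<alpha>1 *s ?F \<tau>)) (at \<tau> within I)"
    if "\<tau> \<in> I" for \<tau>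
    using h_derivatives(2)[OF that] by (simp add: rhs_coef_def Let_def)
  have "((\<lambda>\<tau>. herm (cvec (\<phi> \<tau>)) (?B \<tau> - of_real \<alpha>1 *s ?F \<tau>)) has_integral 0) I"
    by (rule adjoint_integral_zero[OF less_imp_le[OF T_pos] cphi_derivative d phi_T]) (use h_boundary(2) in auto)
  then have "integral I (\<lambda>\<tau>. herm (cvec (\<phi> \<tau>)) (?B \<tau>) - of_real \<alpha>1 * herm (cvec (\<phi> \<tau>)) (?F \<tau>)) = 0"
    by (simp add: herm_simps herm_smult integral_unique)
  then have "integral I (\<lambda>\<tau>. herm (cvec (\<phi> \<tau>)) (?B \<tau>)) - integral I (\<lambda>\<tau>. of_real \<alpha>1 * herm (cvec (\<phi> \<tau>)) (?F \<tau>)) = 0"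
    by (subst (asm) integral_diff)
       (auto intro!: int_herm continuous_on_cphi continuous_on_formB continuous_on_cnj_vec continuous_on_v continuous_on_F0 integrable_on_mult_right)
  then show ?thesis by (simp add: phi_F)
qed

text \<open>Solvability of the equation for \<open>h 2 1\<close> against \<open>vs\<close>. Its
  forcing contains both 2 c v and a multiple of \<open>h 0 2\<close>; the latter pairs to zero by
  the normalization of \<open>h 2 0\<close>.\<close>

lemma c_eq: "c = 1 / 2 * integral I (\<lambda>\<tau>. herm (vs \<tau>)
    (formC F (u0 \<tau>) (v \<tau>) (v \<tau>) (cnj_vec (v \<tau>)) + 2 *s formB F (u0 \<tau>) (v \<tau>) (h 1 1 \<tau>)
      + formB F (u0 \<tau>) (cnj_vec (v \<tau>)) (h 2 0 \<tau>) - (2 * complex_of_real \<alpha>1) *s (formA F (u0 \<tau>) *v v \<tau>)))"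
proof -
  let ?M = "\<lambda>\<tau>. formC F (u0 \<tau>) (v \<tau>) (v \<tau>) (cnj_vec (v \<tau>)) + 2 *s formB F (u0 \<tau>) (v \<tau>) (h 1 1 \<tau>)
      + formB F (u0 \<tau>) (cnj_vec (v \<tau>)) (h 2 0 \<tau>) - (2 * complex_of_real \<alpha>1) *s (formA F (u0 \<tau>) *v v \<tau>)"
  have d: "(h 2 1 has_vector_derivative formA F (u0 \<tau>) *v h 2 1 \<tau> + (?M \<tau> - (2 * c) *s v \<tau> - (2 * cnj b) *s h 0 2 \<tau>)) (at \<tau> within I)"
    if "\<tau> \<in> I" for \<tau>
    using h_derivatives(3)[OF that] by (simp add: rhs_coef_def Let_def)
  have cM: "continuous_on I ?M"
    by (intro continuous_on_add continuous_on_diff continuous_on_smult continuous_on_const continuous_on_formA continuous_on_formB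
        continuous_on_formC continuous_on_v continuous_on_cnj_vec continuous_on_h)
  have "((\<lambda>\<tau>. herm (vs \<tau>) (?M \<tau> - (2 * c) *s v \<tau> - (2 * cnj b) *s h 0 2 \<tau>)) has_integral 0) I"
    by (rule adjoint_integral_zero[OF less_imp_le[OF T_pos] vs_derivative d vs_T h_boundary(3)]) auto
  then have "integral I (\<lambda>\<tau>. herm (vs \<tau>) (?M \<tau> - (2 * c) *s v \<tau> - (2 * cnj b) *s h 0 2 \<tau>)) = 0"
    by (rule integral_unique)
  moreover have "herm (vs \<tau>) (?M \<tau> - (2 * c) *s v \<tau> - (2 * cnj b) *s h 0 2 \<tau>) =
      herm (vs \<tau>) (?M \<tau>) - (2 * c) * herm (vs \<tau>) (v \<tau>) - (2 * cnj b) * herm (vs \<tau>) (h 0 2 \<tau>)" for \<tau>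
    unfolding bounded_bilinear.diff_right[OF bounded_bilinear_herm, of _ "?M \<tau> - _"]
      bounded_bilinear.diff_right[OF bounded_bilinear_herm, of _ "?M \<tau>"] herm_smult ..
  ultimately have z: "integral I (\<lambda>\<tau>. herm (vs \<tau>) (?M \<tau>) - (2 * c) * herm (vs \<tau>) (v \<tau>) - (2 * cnj b) * herm (vs \<tau>) (h 0 2 \<tau>)) = 0"
    by (simp only:)
  have i1: "(\<lambda>\<tau>. herm (vs \<tau>) (?M \<tau>)) integrable_on I" by (rule int_herm[OF continuous_on_vs cM])
  have i2: "(\<lambda>\<tau>. (2 * c) * herm (vs \<tau>) (v \<tau>)) integrable_on I"
    by (intro integrable_on_mult_right int_herm continuous_on_vs continuous_on_v)
  have i3: "(\<lambda>\<tau>. (2 * cnj b) * herm (vs \<tau>) (h 0 2 \<tau>)) integrable_on I"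
    by (intro integrable_on_mult_right int_herm continuous_on_vs continuous_on_h)
  \<comment> \<open>The pairing of \<open>vs\<close> with \<open>h 0 2\<close> is the conjugate of
    the quantity that the normalization of \<open>h 2 0\<close> sets to zero.\<close>
  have "integral I (\<lambda>\<tau>. herm (vs \<tau>) (h 0 2 \<tau>)) = cnj (integral I (\<lambda>\<tau>. herm (cnj_vec (vs \<tau>)) (h 2 0 \<tau>)))"
    unfolding integral_cnj herm_cnj_vec[symmetric] by (simp add: h_cnj[of 0 2])
  then have 02: "integral I (\<lambda>\<tau>. herm (vs \<tau>) (h 0 2 \<tau>)) = 0" using n20 by simp
  have "integral I (\<lambda>\<tau>. herm (vs \<tau>) (?M \<tau>)) - integral I (\<lambda>\<tau>. (2 * c) * herm (vs \<tau>) (v \<tau>))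
      - integral I (\<lambda>\<tau>. (2 * cnj b) * herm (vs \<tau>) (h 0 2 \<tau>)) = 0"
    using z unfolding integral_diff[OF integrable_diff[OF i1 i2] i3] integral_diff[OF i1 i2] .
  then show ?thesis unfolding integral_mult_right vs_v 02 by simp
qed

lemma h20_solves: "h20_bvp F u0 T v vs b (h 2 0)"
  unfolding h20_bvp_def
proof (intro conjI ballI)
  fix \<tau> assume "\<tau> \<in> I"
  from h_derivatives(1)[OF this]
  show "(h 2 0 has_vector_derivative formA F (u0 \<tau>) *v h 2 0 \<tau> + formB F (u0 \<tau>) (v \<tau>) (v \<tau>) - (2 * cnj b) *s cnj_vec (v \<tau>)) (at \<tau> within I)"
    by (simp add: rhs_coef_def Let_def add_diff_eq)
qed (use h_boundary(1) n20 in auto)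

lemma h11_solves: "h11_bvp F u0 T v \<phi> \<alpha>1 (h 1 1)"
  unfolding h11_bvp_def
proof (intro conjI ballI)
  fix \<tau> assume "\<tau> \<in> I"
  from h_derivatives(2)[OF this]
  show "(h 1 1 has_vector_derivative formA F (u0 \<tau>) *v h 1 1 \<tau> + formB F (u0 \<tau>) (v \<tau>) (cnj_vec (v \<tau>))
      - of_real \<alpha>1 *s cvec (vector_derivative u0 (at \<tau>))) (at \<tau> within I)"
    by (simp add: rhs_coef_def Let_def add_diff_eq vector_derivative_at[OF u0_derivative])
qed (use h_boundary(2) n11 in auto)

lemma v_T: "v T = cis (2 * pi / 3) *s v 0"
  using v unfolding eigfun_v_def by (metis add_0)

lemma v_0: "v 0 \<noteq> 0"
proof
  assume "v 0 = 0"
  then have "v \<tau> = 0" if "\<tau> \<in> I" for \<tau> using linearized_zero[OF v_derivative _ that] by blast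
  then have "integral I (\<lambda>\<tau>. herm (v \<tau>) (v \<tau>)) = integral I (\<lambda>\<tau>. 0)"
    by (intro integral_cong) (simp add: herm_def)
  then show False using v unfolding eigfun_v_def by simp
qed

lemma vs_0: "vs 0 \<noteq> 0"
proof
  assume "vs 0 = 0"
  then have "vs \<tau> = 0" if "\<tau> \<in> I" for \<tau> using adjoint_zero[OF vs_derivative _ that] by blast
  then have "integral I (\<lambda>\<tau>. herm (vs \<tau>) (v \<tau>)) = integral I (\<lambda>\<tau>. 0)"
    by (intro integral_cong) (simp add: herm_def)
  then show False using vs_v by simp
qed

text \<open>The difference of two solutions is a multiple of the conjugate of \<open>v\<close>,
  because cis (4 \<pi> / 3) is the conjugate multiplier and simple; the integral condition makes the
  multiple zero.\<close>

lemma h20_unique: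
  assumes "h20_bvp F u0 T v vs b w" "h20_bvp F u0 T v vs b w'" and t: "t \<in> I"
  shows "w t = w' t"
proof -
  have D: "\<And>\<tau>. \<tau> \<in> I \<Longrightarrow> (y has_vector_derivative formA F (u0 \<tau>) *v y \<tau> + formB F (u0 \<tau>) (v \<tau>) (v \<tau>) - (2 * cnj b) *s cnj_vec (v \<tau>)) (at \<tau> within I)"
    and bc: "y T = cis (4 * pi / 3) *s y 0" and int: "integral I (\<lambda>\<tau>. herm (cnj_vec (vs \<tau>)) (y \<tau>)) = 0"
    if "h20_bvp F u0 T v vs b y" for y
    using that unfolding h20_bvp_def by auto
  have cont: "continuous_on I y" if "h20_bvp F u0 T v vs b y" for y
    by (rule continuous_on_vector_derivative[OF D[OF that]])
  let ?x = "\<lambda>\<tau>. w \<tau> - w' \<tau>" and ?e = "\<lambda>\<tau>. cnj_vec (v \<tau>)"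
  have ord: "order (cis (4 * pi / 3)) (charpoly (cmat (Y T))) = 1"
    using mult unfolding R3_multipliers_def simple_eigval_def cis_4_pi_third by blast
  have e: "(?e has_vector_derivative formA F (u0 \<tau>) *v ?e \<tau>) (at \<tau> within I)" if "\<tau> \<in> I" for \<tau>
    using bounded_linear.has_vector_derivative[OF bounded_linear_cnj_vec v_derivative[OF that]] by (simp add: formA_cnj_vec)
  have eT: "?e T = cis (4 * pi / 3) *s ?e 0" unfolding v_T cnj_vec_smult cis_4_pi_third ..
  have e0: "?e 0 \<noteq> 0" using v_0 by (metis norm_cnj_vec norm_eq_zero)
  have x: "(?x has_vector_derivative formA F (u0 \<tau>) *v ?x \<tau>) (at \<tau> within I)" if "\<tau> \<in> I" for \<tau>
    using has_vector_derivative_diff[OF D[OF assms(1) that] D[OF assms(2) that]] by (simp add: matrix_vector_mult_diff_distrib)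
  have xT: "?x T = cis (4 * pi / 3) *s ?x 0"
    using bc[OF assms(1)] bc[OF assms(2)] by (simp add: vector_ssub_ldistrib)
  obtain k where k: "\<And>\<tau>. \<tau> \<in> I \<Longrightarrow> ?x \<tau> = k *s ?e \<tau>"
    using linearized_bvp_1dim[OF Y ord e eT e0 x xT] by blast
  have cvs: "continuous_on I (\<lambda>\<tau>. cnj_vec (vs \<tau>))" by (rule continuous_on_cnj_vec[OF continuous_on_vs])
  have "integral I (\<lambda>\<tau>. herm (cnj_vec (vs \<tau>)) (?x \<tau>)) = 0"
    unfolding herm_simps
    by (subst integral_diff) (use int assms cont int_herm[OF cvs] in auto)
  also have "integral I (\<lambda>\<tau>. herm (cnj_vec (vs \<tau>)) (?x \<tau>)) = integral I (\<lambda>\<tau>. k * cnj (herm (vs \<tau>) (v \<tau>)))"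
    by (rule integral_cong) (simp add: k herm_smult herm_cnj_vec)
  also have "\<dots> = k" by (simp add: integral_cnj[symmetric] vs_v)
  finally show ?thesis using k[OF t] by simp
qed

text \<open>Differentiating the equation along the cycle: the velocity solves the linearized
  equation and is the eigenfunction for the multiplier 1.\<close>

lemma F0_linearized:
  "((\<lambda>\<tau>. cvec (F (u0 \<tau>))) has_vector_derivative formA F (u0 \<tau>) *v cvec (F (u0 \<tau>))) (at \<tau> within S)"
proof -
  have F': "F differentiable (at (u0 \<tau>))" using F_Ck(3) by simp
  have "((\<lambda>\<tau>. F (u0 \<tau>)) has_derivative (\<lambda>s. frechet_derivative F (at (u0 \<tau>)) (s *\<^sub>R F (u0 \<tau>)))) (at \<tau>)"
    using u0_derivative F' unfolding has_vector_derivative_def frechet_derivative_works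
    by (rule has_derivative_compose)
  then have "((\<lambda>\<tau>. F (u0 \<tau>)) has_vector_derivative frechet_derivative F (at (u0 \<tau>)) (F (u0 \<tau>))) (at \<tau>)"
    unfolding has_vector_derivative_def by (simp add: linear_cmul[OF linear_frechet_derivative[OF F']])
  from bounded_linear.has_vector_derivative[OF bounded_linear_cvec this]
  show ?thesis unfolding formA_cvec[OF F'] by (rule has_vector_derivative_at_within)
qed

lemma h11_unique:
  assumes "h11_bvp F u0 T v \<phi> \<alpha>1 w" "h11_bvp F u0 T v \<phi> \<alpha>1 w'" and t: "t \<in> I"
  shows "w t = w' t"
proof -
  have D: "\<And>\<tau>. \<tau> \<in> I \<Longrightarrow> (y has_vector_derivative formA F (u0 \<tau>) *v y \<tau> + formB F (u0 \<tau>) (v \<tau>) (cnj_vec (v \<tau>))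
      - of_real \<alpha>1 *s cvec (vector_derivative u0 (at \<tau>))) (at \<tau> within I)"
    and bc: "y T = y 0" and int: "integral I (\<lambda>\<tau>. herm (cvec (\<phi> \<tau>)) (y \<tau>)) = 0"
    if "h11_bvp F u0 T v \<phi> \<alpha>1 y" for y
    using that unfolding h11_bvp_def by auto
  have cont: "continuous_on I y" if "h11_bvp F u0 T v \<phi> \<alpha>1 y" for y
    by (rule continuous_on_vector_derivative[OF D[OF that]])
  let ?x = "\<lambda>\<tau>. w \<tau> - w' \<tau>" and ?e = "\<lambda>\<tau>. cvec (F (u0 \<tau>))"
  have ord: "order 1 (charpoly (cmat (Y T))) = 1"
    using mult unfolding R3_multipliers_def simple_eigval_def by blast
  have "u0 (0 + T) = u0 0" using per unfolding periodic_solution_def by blast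
  then have eT: "?e T = 1 *s ?e 0" by simp
  \<comment> \<open>If the velocity vanished at time 0, uniqueness would make it vanish on the whole
    period, against the normalization of \<phi>.\<close>
  have e0: "?e 0 \<noteq> 0"
  proof
    assume "?e 0 = 0"
    then have "?e \<tau> = 0" if "\<tau> \<in> I" for \<tau> using linearized_zero[OF F0_linearized _ that] by blast
    then have "integral I (\<lambda>\<tau>. herm (cvec (\<phi> \<tau>)) (?e \<tau>)) = integral I (\<lambda>\<tau>. 0)"
      by (intro integral_cong) (simp add: herm_def)
    then show False using phi_F by simp
  qed
  have x: "(?x has_vector_derivative formA F (u0 \<tau>) *v ?x \<tau>) (at \<tau> within I)" if "\<tau> \<in> I" for \<tau>
    using has_vector_derivative_diff[OF D[OF assms(1) that] D[OF assms(2) that]] by (simp add: matrix_vector_mult_diff_distrib)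
  have xT: "?x T = 1 *s ?x 0"
    using bc[OF assms(1)] bc[OF assms(2)] by simp
  obtain k where k: "\<And>\<tau>. \<tau> \<in> I \<Longrightarrow> ?x \<tau> = k *s ?e \<tau>"
    using linearized_bvp_1dim[OF Y ord F0_linearized eT e0 x xT] by blast
  have "integral I (\<lambda>\<tau>. herm (cvec (\<phi> \<tau>)) (?x \<tau>)) = 0"
    unfolding herm_simps
    by (subst integral_diff) (use int assms cont int_herm[OF continuous_on_cphi] in auto)
  also have "integral I (\<lambda>\<tau>. herm (cvec (\<phi> \<tau>)) (?x \<tau>)) = integral I (\<lambda>\<tau>. k * herm (cvec (\<phi> \<tau>)) (?e \<tau>))"
    by (rule integral_cong) (simp add: k herm_smult)
  also have "\<dots> = k" by (simp add: phi_F)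
  finally show ?thesis using k[OF t] by simp
qed

text \<open>By simplicity \<open>vs'\<close> is a multiple k of \<open>vs\<close>; the normalization
  against \<gamma> v gives \<open>\<gamma> * cnj k = 1\<close>, so k = \<gamma> because \<gamma> has
  modulus one.\<close>

lemma adjoint_v_unique:
  assumes vs': "adjoint_v F u0 T (\<lambda>\<tau>. \<gamma> *s v \<tau>) vs'" and \<gamma>: "norm \<gamma> = 1" and t: "t \<in> I"
  shows "vs' t = \<gamma> *s vs t"
proof -
  have D: "\<And>\<tau>. \<tau> \<in> I \<Longrightarrow> (vs' has_vector_derivative - (transpose (formA F (u0 \<tau>)) *v vs' \<tau>)) (at \<tau> within I)"
    and bc: "vs' T = cis (2 * pi / 3) *s vs' 0" and int: "integral I (\<lambda>\<tau>. herm (vs' \<tau>) (\<gamma> *s v \<tau>)) = 1"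
    using vs' unfolding adjoint_v_def by blast+
  have ord: "order (cis (2 * pi / 3)) (charpoly (cmat (Y T))) = 1"
    using mult unfolding R3_multipliers_def simple_eigval_def by blast
  obtain k where k: "\<And>\<tau>. \<tau> \<in> I \<Longrightarrow> vs' \<tau> = k *s vs \<tau>"
    using adjoint_bvp_1dim[OF Y ord _ vs_derivative vs_T vs_0 D bc] by auto
  have "1 = integral I (\<lambda>\<tau>. (\<gamma> * cnj k) * herm (vs \<tau>) (v \<tau>))"
    unfolding int[symmetric] by (rule integral_cong) (simp add: k herm_smult)
  also have "\<dots> = \<gamma> * cnj k" by (simp add: vs_v)
  finally have "cnj (\<gamma> * cnj k) = 1" by simp
  then have "cnj \<gamma> * k = 1" by simp
  then have "\<gamma> * cnj \<gamma> * k = \<gamma>" by (simp add: mult.assoc)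
  moreover have "\<gamma> * cnj \<gamma> = 1" using \<gamma> complex_norm_square[of \<gamma>] by simp
  ultimately show ?thesis using k[OF t] by simp
qed

end

section \<open>Dependence of the coefficients on the phase of the eigenfunction\<close>

context R3_normal_form
begin

text \<open>The primed system is arbitrary, so it is compared through the formulas and uniqueness
  results rather than by substitution. In the formula for \<open>b\<close> the adjoint and the two
  conjugate eigenfunctions each contribute \<open>cnj \<gamma>\<close>; in that for \<open>c\<close>
  the argument scales by \<gamma>, cancelling the factor of the adjoint.\<close>

lemma rescaled_coefficients:
  assumes \<gamma>: "norm \<gamma> = 1"
    and G: "R3_normal_form F u0 T (\<lambda>\<tau>. \<gamma> *s v \<tau>) H' h' \<alpha>1' \<alpha>2' \<alpha>3' b' c' r' p' q' \<phi> vs' Y"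
  shows "c' = c \<and> b' = cnj \<gamma> ^ 3 * b"
proof -
  interpret G: R3_normal_form F u0 T "\<lambda>\<tau>. \<gamma> *s v \<tau>" H' h' \<alpha>1' \<alpha>2' \<alpha>3' b' c' r' p' q' \<phi> vs' Y
    by (rule G)
  have gg: "\<gamma> * cnj \<gamma> = 1" using \<gamma> complex_norm_square[of \<gamma>] by simp
  then have gg': "cnj \<gamma> * \<gamma> = 1" "cnj \<gamma> * (\<gamma> * x) = x" "\<gamma> * (cnj \<gamma> * x) = x" for x
    by (simp_all add: mult.commute mult.assoc[symmetric])
  have vs': "vs' t = \<gamma> *s vs t" if "t \<in> I" for t
    by (rule adjoint_v_unique[OF G.vs \<gamma> that])
  have "b' = 1 / 2 * integral I (\<lambda>\<tau>. cnj \<gamma> ^ 3 * herm (vs \<tau>) (formB F (u0 \<tau>) (cnj_vec (v \<tau>)) (cnj_vec (v \<tau>))))"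
    unfolding G.b_eq
    by (intro arg_cong[where f="\<lambda>x. 1 / 2 * x"] integral_cong)
       (simp add: vs' herm_smult cnj_vec_smult formB_smult_left formB_smult_right power3_eq_cube)
  then have b': "b' = cnj \<gamma> ^ 3 * b"
    by (subst b_eq) (simp only: integral_mult_right mult.left_commute)
  have "complex_of_real \<alpha>1' = complex_of_real \<alpha>1"
    unfolding G.\<alpha>1_eq \<alpha>1_eq
    by (rule integral_cong) (simp add: cnj_vec_smult formB_smult_left formB_smult_right vector_smult_assoc gg gg')
  then have \<alpha>1': "\<alpha>1' = \<alpha>1" by simp
  have h11': "h' 1 1 t = h 1 1 t" if "t \<in> I" for t
  proof (rule h11_unique[OF _ h11_solves that])
    show "h11_bvp F u0 T v \<phi> \<alpha>1 (h' 1 1)"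
      using G.h11_solves unfolding h11_bvp_def \<alpha>1'
      by (simp add: cnj_vec_smult formB_smult_left formB_smult_right vector_smult_assoc gg gg')
  qed
  \<comment> \<open>Multiplying \<open>h' 2 0\<close> by the square of \<open>cnj \<gamma>\<close>
    turns its boundary value problem into the original one, which has only one solution.\<close>
  have h20': "h' 2 0 t = \<gamma>\<^sup>2 *s h 2 0 t" if t: "t \<in> I" for t
  proof -
    have "(cnj \<gamma>)\<^sup>2 *s h' 2 0 t = h 2 0 t"
    proof (rule h20_unique[OF _ h20_solves t])
      show "h20_bvp F u0 T v vs b (\<lambda>\<tau>. (cnj \<gamma>)\<^sup>2 *s h' 2 0 \<tau>)"
        unfolding h20_bvp_def
      proof (intro conjI ballI)
        fix \<tau> assume "\<tau> \<in> I"
        then have "(h' 2 0 has_vector_derivative formA F (u0 \<tau>) *v h' 2 0 \<tau> + formB F (u0 \<tau>) (\<gamma> *s v \<tau>) (\<gamma> *s v \<tau>)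
            - (2 * cnj b') *s cnj_vec (\<gamma> *s v \<tau>)) (at \<tau> within I)"
          using G.h20_solves unfolding h20_bvp_def by blast
        from has_vector_derivative_smult[OF this, of "(cnj \<gamma>)\<^sup>2"]
        show "((\<lambda>\<tau>. (cnj \<gamma>)\<^sup>2 *s h' 2 0 \<tau>) has_vector_derivative formA F (u0 \<tau>) *v ((cnj \<gamma>)\<^sup>2 *s h' 2 0 \<tau>)
            + formB F (u0 \<tau>) (v \<tau>) (v \<tau>) - (2 * cnj b) *s cnj_vec (v \<tau>)) (at \<tau> within I)"
        proof (rule has_vector_derivative_eq_rhs)
          have 1: "(cnj \<gamma>)\<^sup>2 * (\<gamma> * \<gamma>) = 1" by (simp add: power2_eq_square gg' mult.assoc)
          have 2: "(cnj \<gamma>)\<^sup>2 * (2 * cnj b' * cnj \<gamma>) = 2 * cnj b"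
            unfolding b' by (simp add: power2_eq_square power3_eq_cube gg gg' mult.assoc mult.left_commute)
          show "(cnj \<gamma>)\<^sup>2 *s (formA F (u0 \<tau>) *v h' 2 0 \<tau> + formB F (u0 \<tau>) (\<gamma> *s v \<tau>) (\<gamma> *s v \<tau>)
              - (2 * cnj b') *s cnj_vec (\<gamma> *s v \<tau>)) = formA F (u0 \<tau>) *v ((cnj \<gamma>)\<^sup>2 *s h' 2 0 \<tau>)
            + formB F (u0 \<tau>) (v \<tau>) (v \<tau>) - (2 * cnj b) *s cnj_vec (v \<tau>)"
            unfolding vector_add_ldistrib vector_ssub_ldistrib formB_smult_left formB_smult_right cnj_vec_smult
              vector_smult_assoc vector_scalar_commute 1 2 by simp
        qed
      next
        have "h' 2 0 T = cis (4 * pi / 3) *s h' 2 0 0" using G.h20_solves unfolding h20_bvp_def by simp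
        then show "(cnj \<gamma>)\<^sup>2 *s h' 2 0 T - cis (4 * pi / 3) *s ((cnj \<gamma>)\<^sup>2 *s h' 2 0 0) = 0"
          by (simp add: vector_smult_assoc mult.commute)
        have "integral I (\<lambda>\<tau>. herm (cnj_vec (vs \<tau>)) ((cnj \<gamma>)\<^sup>2 *s h' 2 0 \<tau>))
            = integral I (\<lambda>\<tau>. ((cnj \<gamma>)\<^sup>2 * cnj \<gamma>) * herm (cnj_vec (vs' \<tau>)) (h' 2 0 \<tau>))"
          by (rule integral_cong) (simp add: vs' cnj_vec_smult herm_smult mult.assoc gg')
        also have "\<dots> = 0" by (simp add: G.n20)
        finally show "integral I (\<lambda>\<tau>. herm (cnj_vec (vs \<tau>)) ((cnj \<gamma>)\<^sup>2 *s h' 2 0 \<tau>)) = 0" .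
      qed
    qed
    then have "\<gamma>\<^sup>2 *s ((cnj \<gamma>)\<^sup>2 *s h' 2 0 t) = \<gamma>\<^sup>2 *s h 2 0 t" by simp
    moreover have "\<gamma>\<^sup>2 * (cnj \<gamma>)\<^sup>2 = 1" by (simp add: power2_eq_square gg gg' mult.assoc)
    ultimately show ?thesis by (simp add: vector_smult_assoc)
  qed
  have k: "\<gamma> * \<gamma> * cnj \<gamma> = \<gamma>" "\<gamma> * (\<gamma> * cnj \<gamma>) = \<gamma>" "cnj \<gamma> * \<gamma>\<^sup>2 = \<gamma>" "cnj \<gamma> * (\<gamma> * \<gamma>) = \<gamma>"
    "\<gamma>\<^sup>2 * cnj \<gamma> = \<gamma>" "2 * \<gamma> = \<gamma> * 2"
    "2 * complex_of_real \<alpha>1 * \<gamma> = \<gamma> * (2 * complex_of_real \<alpha>1)"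
    by (simp_all add: power2_eq_square gg gg' mult.assoc)
  have "c' = c"
    unfolding G.c_eq \<alpha>1' c_eq
  proof (intro arg_cong[where f="\<lambda>x. 1 / 2 * x"] integral_cong)
    fix \<tau> assume t: "\<tau> \<in> I"
    have "formC F (u0 \<tau>) (\<gamma> *s v \<tau>) (\<gamma> *s v \<tau>) (cnj_vec (\<gamma> *s v \<tau>)) +
        2 *s formB F (u0 \<tau>) (\<gamma> *s v \<tau>) (h' 1 1 \<tau>) + formB F (u0 \<tau>) (cnj_vec (\<gamma> *s v \<tau>)) (h' 2 0 \<tau>) -
        (2 * complex_of_real \<alpha>1) *s (formA F (u0 \<tau>) *v (\<gamma> *s v \<tau>)) =
      \<gamma> *s (formC F (u0 \<tau>) (v \<tau>) (v \<tau>) (cnj_vec (v \<tau>)) + 2 *s formB F (u0 \<tau>) (v \<tau>) (h 1 1 \<tau>)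
        + formB F (u0 \<tau>) (cnj_vec (v \<tau>)) (h 2 0 \<tau>) - (2 * complex_of_real \<alpha>1) *s (formA F (u0 \<tau>) *v v \<tau>))"
      unfolding h11'[OF t] h20'[OF t]
      unfolding cnj_vec_smult formB_smult_left formB_smult_right formC_smult1 formC_smult2 formC_smult3 vector_scalar_commute
        vector_add_ldistrib vector_ssub_ldistrib vector_smult_assoc
      by (simp only: k)
    then show "herm (vs' \<tau>) (formC F (u0 \<tau>) (\<gamma> *s v \<tau>) (\<gamma> *s v \<tau>) (cnj_vec (\<gamma> *s v \<tau>)) +
        2 *s formB F (u0 \<tau>) (\<gamma> *s v \<tau>) (h' 1 1 \<tau>) + formB F (u0 \<tau>) (cnj_vec (\<gamma> *s v \<tau>)) (h' 2 0 \<tau>) -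
        (2 * complex_of_real \<alpha>1) *s (formA F (u0 \<tau>) *v (\<gamma> *s v \<tau>))) =
      herm (vs \<tau>) (formC F (u0 \<tau>) (v \<tau>) (v \<tau>) (cnj_vec (v \<tau>)) + 2 *s formB F (u0 \<tau>) (v \<tau>) (h 1 1 \<tau>)
        + formB F (u0 \<tau>) (cnj_vec (v \<tau>)) (h 2 0 \<tau>) - (2 * complex_of_real \<alpha>1) *s (formA F (u0 \<tau>) *v v \<tau>))"
      by (simp only: vs'[OF t] herm_smult gg')
  qed
  with b' show ?thesis by simp
qed

end

section \<open>Rescaling the eigenfunction\<close>

lemma bigO4_rotate:
  assumes "bigO4 R" "norm \<gamma> = 1"
  shows "bigO4 (\<lambda>(\<tau>, \<xi>). R (\<tau>, \<gamma> * \<xi>))"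
proof -
  obtain K \<delta> where K: "\<delta> > 0" "\<And>\<tau> \<xi>. norm \<xi> < \<delta> \<Longrightarrow> norm (R (\<tau>, \<xi>)) \<le> K * norm \<xi> ^ 4"
    using assms(1) unfolding bigO4_def by blast
  have "norm (R (\<tau>, \<gamma> * \<xi>)) \<le> K * norm \<xi> ^ 4" if "norm \<xi> < \<delta>" for \<tau> \<xi>
    using K(2)[of "\<gamma> * \<xi>" \<tau>] that assms(2) by (simp add: norm_mult)
  then show ?thesis unfolding bigO4_def using K(1) by auto
qed

lemma rescaled_adjoint:
  assumes "adjoint_v F u0 T v vs" "norm \<gamma> = 1"
  shows "adjoint_v F u0 T (\<lambda>\<tau>. \<gamma> *s v \<tau>) (\<lambda>\<tau>. \<gamma> *s vs \<tau>)"
proof -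
  have gg: "cnj \<gamma> * \<gamma> = 1" using assms(2) complex_norm_square[of \<gamma>] by (simp add: mult.commute)
  have neg: "\<gamma> *s (- (M *v x)) = - (M *v (\<gamma> *s x))" for M and x :: "complex^'n"
    unfolding vector_scalar_commute by (simp add: vec_eq_iff)
  have d: "\<And>\<tau>. \<tau> \<in> {0..T} \<Longrightarrow> (vs has_vector_derivative - (transpose (formA F (u0 \<tau>)) *v vs \<tau>)) (at \<tau> within {0..T})"
    and T: "vs T = cis (2 * pi / 3) *s vs 0" and i: "integral {0..T} (\<lambda>\<tau>. herm (vs \<tau>) (v \<tau>)) = 1"
    using assms(1) unfolding adjoint_v_def by blast+
  show ?thesis
    unfolding adjoint_v_def
  proof (intro conjI ballI)
    fix \<tau> assume "\<tau> \<in> {0..T}"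
    from has_vector_derivative_smult[OF d[OF this], of \<gamma>]
    show "((\<lambda>\<tau>. \<gamma> *s vs \<tau>) has_vector_derivative - (transpose (formA F (u0 \<tau>)) *v (\<gamma> *s vs \<tau>))) (at \<tau> within {0..T})"
      unfolding neg .
  next
    show "\<gamma> *s vs T = cis (2 * pi / 3) *s (\<gamma> *s vs 0)"
      unfolding T by (simp add: vector_smult_assoc mult.commute)
    show "integral {0..T} (\<lambda>\<tau>. herm (\<gamma> *s vs \<tau>) (\<gamma> *s v \<tau>)) = 1"
      unfolding herm_smult mult.assoc[symmetric] by (simp add: gg[simplified mult.commute] gg mult.commute i)
  qed
qed

lemma rescaled_eigfun:
  assumes "eigfun_v F u0 T v" "norm \<gamma> = 1"
  shows "eigfun_v F u0 T (\<lambda>\<tau>. \<gamma> *s v \<tau>)"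
proof -
  have gg: "cnj \<gamma> * \<gamma> = 1" using assms(2) complex_norm_square[of \<gamma>] by (simp add: mult.commute)
  have d: "\<And>\<tau>. \<tau> \<in> {0..T} \<Longrightarrow> (v has_vector_derivative formA F (u0 \<tau>) *v v \<tau>) (at \<tau> within {0..T})"
    and T: "\<And>\<tau>. v (\<tau> + T) = cis (2 * pi / 3) *s v \<tau>" and i: "integral {0..T} (\<lambda>\<tau>. herm (v \<tau>) (v \<tau>)) = 1"
    using assms(1) unfolding eigfun_v_def by blast+
  show ?thesis
    unfolding eigfun_v_def
  proof (intro conjI ballI allI)
    fix \<tau> assume "\<tau> \<in> {0..T}"
    from has_vector_derivative_smult[OF d[OF this], of \<gamma>]
    show "((\<lambda>\<tau>. \<gamma> *s v \<tau>) has_vector_derivative formA F (u0 \<tau>) *v (\<gamma> *s v \<tau>)) (at \<tau> within {0..T})"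
      unfolding vector_scalar_commute .
  next
    fix \<tau>
    show "\<gamma> *s v (\<tau> + T) = cis (2 * pi / 3) *s (\<gamma> *s v \<tau>)"
      unfolding T by (simp add: vector_smult_assoc mult.commute)
    have "herm (\<gamma> *s v \<tau>) (\<gamma> *s v \<tau>) = herm (v \<tau>) (v \<tau>)" for \<tau>
      unfolding herm_smult mult.assoc[symmetric] using gg by (simp add: mult.commute)
    then show "integral {0..T} (\<lambda>\<tau>. herm (\<gamma> *s v \<tau>) (\<gamma> *s v \<tau>)) = 1" using i by simp
  qed
qed

lemma rescaled_cm_param:
  "cm_param u0 (\<lambda>\<tau>. \<gamma> *s v \<tau>) (\<lambda>(\<tau>, \<xi>). H (\<tau>, \<gamma> * \<xi>)) \<tau> \<xi> = cm_param u0 v H \<tau> (\<gamma> * \<xi>)"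
  by (simp add: cm_param_def cnj_vec_smult vector_smult_assoc mult.commute)

text \<open>Put \<zeta> = \<gamma> \<xi>. The cubic terms in the time equation move \<gamma>^3 and
  its conjugate into \<alpha>2 and \<alpha>3, and multiplying the \<xi>-equation by \<gamma>
  reproduces the one for \<zeta> because
  \<open>\<gamma> * cnj \<gamma> ^ 3 = (cnj \<gamma>)\<^sup>2\<close>.\<close>

lemma rescaled_flow:
  assumes \<gamma>: "norm \<gamma> = 1"
    and flow: "R3_flow \<alpha>1 (\<gamma> ^ 3 * \<alpha>2) (cnj \<gamma> ^ 3 * \<alpha>3) (cnj \<gamma> ^ 3 * b) c
      (\<lambda>(\<tau>, \<xi>). p (\<tau>, \<gamma> * \<xi>)) (\<lambda>(\<tau>, \<xi>). cnj \<gamma> * q (\<tau>, \<gamma> * \<xi>)) J \<theta> \<xi>"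
  shows "R3_flow \<alpha>1 \<alpha>2 \<alpha>3 b c p q J \<theta> (\<lambda>t. \<gamma> * \<xi> t)"
  unfolding R3_flow_def
proof (intro ballI conjI)
  have gg: "\<gamma> * cnj \<gamma> = 1" using \<gamma> complex_norm_square[of \<gamma>] by simp
  then have g3: "\<gamma> * (cnj \<gamma>) ^ 3 = (cnj \<gamma>)\<^sup>2" by (simp add: power3_eq_cube power2_eq_square mult.assoc[symmetric])
  fix t assume t: "t \<in> J"
  have n: "norm (\<gamma> * \<xi> t) = norm (\<xi> t)" using \<gamma> by (simp add: norm_mult)
  have "(\<theta> has_real_derivative Re (1 + of_real \<alpha>1 * of_real ((norm (\<xi> t))\<^sup>2) + (\<gamma> ^ 3 * \<alpha>2) * \<xi> t ^ 3
      + (cnj \<gamma> ^ 3 * \<alpha>3) * cnj (\<xi> t) ^ 3) + p (\<theta> t, \<gamma> * \<xi> t)) (at t)"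
    using flow t unfolding R3_flow_def by auto
  moreover have "\<alpha>2 * (\<gamma> * \<xi> t) ^ 3 = (\<gamma> ^ 3 * \<alpha>2) * \<xi> t ^ 3" "\<alpha>3 * cnj (\<gamma> * \<xi> t) ^ 3 = (cnj \<gamma> ^ 3 * \<alpha>3) * cnj (\<xi> t) ^ 3"
    by (simp_all add: power_mult_distrib mult_ac)
  ultimately show "(\<theta> has_real_derivative Re (1 + of_real \<alpha>1 * of_real ((norm (\<gamma> * \<xi> t))\<^sup>2) + \<alpha>2 * (\<gamma> * \<xi> t) ^ 3
      + \<alpha>3 * cnj (\<gamma> * \<xi> t) ^ 3) + p (\<theta> t, \<gamma> * \<xi> t)) (at t)"
    unfolding n by (simp only:)
  have "(\<xi> has_vector_derivative (cnj \<gamma> ^ 3 * b) * (cnj (\<xi> t))\<^sup>2 + c * \<xi> t * of_real ((norm (\<xi> t))\<^sup>2)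
      + cnj \<gamma> * q (\<theta> t, \<gamma> * \<xi> t)) (at t)"
    using flow t unfolding R3_flow_def by auto
  from bounded_linear.has_vector_derivative[OF bounded_linear_mult_right[of \<gamma>] this]
  show "((\<lambda>t. \<gamma> * \<xi> t) has_vector_derivative b * (cnj (\<gamma> * \<xi> t))\<^sup>2 + c * (\<gamma> * \<xi> t) * of_real ((norm (\<gamma> * \<xi> t))\<^sup>2)
      + q (\<theta> t, \<gamma> * \<xi> t)) (at t)"
  proof (rule has_vector_derivative_eq_rhs)
    have "\<gamma> * ((cnj \<gamma> ^ 3 * b) * (cnj (\<xi> t))\<^sup>2 + c * \<xi> t * of_real ((norm (\<xi> t))\<^sup>2) + cnj \<gamma> * q (\<theta> t, \<gamma> * \<xi> t))
      = (\<gamma> * cnj \<gamma> ^ 3) * b * (cnj (\<xi> t))\<^sup>2 + c * (\<gamma> * \<xi> t) * of_real ((norm (\<xi> t))\<^sup>2) + (\<gamma> * cnj \<gamma>) * q (\<theta> t, \<gamma> * \<xi> t)"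
      by (simp add: algebra_simps)
    then show "\<gamma> * ((cnj \<gamma> ^ 3 * b) * (cnj (\<xi> t))\<^sup>2 + c * \<xi> t * of_real ((norm (\<xi> t))\<^sup>2) + cnj \<gamma> * q (\<theta> t, \<gamma> * \<xi> t))
      = b * (cnj (\<gamma> * \<xi> t))\<^sup>2 + c * (\<gamma> * \<xi> t) * of_real ((norm (\<gamma> * \<xi> t))\<^sup>2) + q (\<theta> t, \<gamma> * \<xi> t)"
      unfolding g3 gg n by (simp add: power_mult_distrib mult_ac)
  qed
qed

lemma rescaled_expansion:
  assumes "cm_expansion H h" "norm \<gamma> = 1"
  shows "cm_expansion (\<lambda>(\<tau>, \<xi>). H (\<tau>, \<gamma> * \<xi>)) (\<lambda>k l \<tau>. (\<gamma> ^ k * cnj \<gamma> ^ l) *s h k l \<tau>)"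
proof -
  have h: "\<And>k l \<tau>. h k l \<tau> = cnj_vec (h l k \<tau>)"
    and R: "bigO4 (\<lambda>(\<tau>, \<xi>). cvec (H (\<tau>, \<xi>)) -
       (\<Sum>(k, l) | 2 \<le> k + l \<and> k + l \<le> 3. (\<xi> ^ k * cnj \<xi> ^ l / (fact k * fact l)) *s h k l \<tau>))"
    using assms(1) unfolding cm_expansion_def by blast+
  have summand: "(\<xi> ^ k * cnj \<xi> ^ l / (fact k * fact l)) *s ((\<gamma> ^ k * cnj \<gamma> ^ l) *s h k l \<tau>) =
      ((\<gamma> * \<xi>) ^ k * cnj (\<gamma> * \<xi>) ^ l / (fact k * fact l)) *s h k l \<tau>" for k l \<tau> \<xi>
    by (simp add: vector_smult_assoc power_mult_distrib mult_ac)
  show ?thesis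
    unfolding cm_expansion_def
  proof (intro conjI allI)
    show "(\<gamma> ^ k * cnj \<gamma> ^ l) *s h k l \<tau> = cnj_vec ((\<gamma> ^ l * cnj \<gamma> ^ k) *s h l k \<tau>)" for k l \<tau>
      by (subst h) (simp add: cnj_vec_smult mult.commute)
    show "bigO4 (\<lambda>(\<tau>, \<xi>). cvec ((\<lambda>(\<tau>, \<xi>). H (\<tau>, \<gamma> * \<xi>)) (\<tau>, \<xi>)) -
       (\<Sum>(k, l) | 2 \<le> k + l \<and> k + l \<le> 3. (\<xi> ^ k * cnj \<xi> ^ l / (fact k * fact l)) *s ((\<gamma> ^ k * cnj \<gamma> ^ l) *s h k l \<tau>)))"
      using bigO4_rotate[OF R assms(2)] by (simp only: prod.case summand)
  qed
qed

lemma R3_center_manifoldE: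
  assumes "R3_center_manifold F u0 T v \<phi> vs H h \<alpha>1 \<alpha>2 \<alpha>3 b c"
  obtains r p q where "\<alpha>3 = cnj \<alpha>2" "cm_expansion H h"
    "integral {0..T} (\<lambda>\<tau>. herm (cnj_vec (vs \<tau>)) (h 2 0 \<tau>)) = 0"
    "integral {0..T} (\<lambda>\<tau>. herm (cvec (\<phi> \<tau>)) (h 1 1 \<tau>)) = 0"
    "r > 0" "Ck_on 4 (UNIV \<times> ball 0 r) H"
    "\<forall>\<tau>. \<forall>\<xi>\<in>ball 0 r. H (\<tau> + 3 * T, \<xi>) = H (\<tau>, \<xi>)"
    "\<forall>\<tau>. \<forall>\<xi>\<in>ball 0 r. cm_param u0 v H \<tau> \<xi> = cm_param u0 v H (\<tau> + T) (cis (- (2 * pi / 3)) * \<xi>)"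
    "Ck_on 1 (UNIV \<times> ball 0 r) p" "Ck_on 1 (UNIV \<times> ball 0 r) q"
    "\<forall>\<tau>. \<forall>\<xi>\<in>ball 0 r. p (\<tau> + 3 * T, \<xi>) = p (\<tau>, \<xi>) \<and> q (\<tau> + 3 * T, \<xi>) = q (\<tau>, \<xi>)"
    "bigO4 p" "bigO4 q"
    "\<forall>J \<theta> \<xi>. open J \<and> is_interval J \<and> \<xi> ` J \<subseteq> ball 0 r \<and> R3_flow \<alpha>1 \<alpha>2 \<alpha>3 b c p q J \<theta> \<xi> \<longrightarrow>
       (\<forall>t\<in>J. ((\<lambda>s. cm_param u0 v H (\<theta> s) (\<xi> s)) has_vector_derivative F (cm_param u0 v H (\<theta> t) (\<xi> t))) (at t))"
  using assms unfolding R3_center_manifold_def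
  apply (elim conjE exE)
  subgoal for r p q by (rule that[of r p q])
  done

lemma R3_center_manifoldI:
  assumes "\<alpha>3 = cnj \<alpha>2" "cm_expansion H h"
    "integral {0..T} (\<lambda>\<tau>. herm (cnj_vec (vs \<tau>)) (h 2 0 \<tau>)) = 0"
    "integral {0..T} (\<lambda>\<tau>. herm (cvec (\<phi> \<tau>)) (h 1 1 \<tau>)) = 0"
    "r > 0" "Ck_on 4 (UNIV \<times> ball 0 r) H"
    "\<And>\<tau> \<xi>. \<xi> \<in> ball 0 r \<Longrightarrow> H (\<tau> + 3 * T, \<xi>) = H (\<tau>, \<xi>)"
    "\<And>\<tau> \<xi>. \<xi> \<in> ball 0 r \<Longrightarrow> cm_param u0 v H \<tau> \<xi> = cm_param u0 v H (\<tau> + T) (cis (- (2 * pi / 3)) * \<xi>)"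
    "Ck_on 1 (UNIV \<times> ball 0 r) p" "Ck_on 1 (UNIV \<times> ball 0 r) q"
    "\<And>\<tau> \<xi>. \<xi> \<in> ball 0 r \<Longrightarrow> p (\<tau> + 3 * T, \<xi>) = p (\<tau>, \<xi>)"
    "\<And>\<tau> \<xi>. \<xi> \<in> ball 0 r \<Longrightarrow> q (\<tau> + 3 * T, \<xi>) = q (\<tau>, \<xi>)"
    "bigO4 p" "bigO4 q"
    "\<And>J \<theta> \<xi> t. open J \<and> is_interval J \<and> \<xi> ` J \<subseteq> ball 0 r \<and> R3_flow \<alpha>1 \<alpha>2 \<alpha>3 b c p q J \<theta> \<xi> \<Longrightarrow> t \<in> J \<Longrightarrow>
       ((\<lambda>s. cm_param u0 v H (\<theta> s) (\<xi> s)) has_vector_derivative F (cm_param u0 v H (\<theta> t) (\<xi> t))) (at t)"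
  shows "R3_center_manifold F u0 T v \<phi> vs H h \<alpha>1 \<alpha>2 \<alpha>3 b c"
  unfolding R3_center_manifold_def
  by (intro conjI exI[of _ r] exI[of _ p] exI[of _ q] allI ballI impI; rule assms; assumption)

text \<open>The same surface parametrized by the rotated coordinate. Its use is to exhibit a normal
  form for \<gamma> v, so that the comparison of coefficients is not vacuous.\<close>

lemma rescaled_manifold:
  assumes M: "R3_center_manifold F u0 T v \<phi> vs H h \<alpha>1 \<alpha>2 \<alpha>3 b c" and \<gamma>: "norm \<gamma> = 1"
  shows "R3_center_manifold F u0 T (\<lambda>\<tau>. \<gamma> *s v \<tau>) \<phi> (\<lambda>\<tau>. \<gamma> *s vs \<tau>) (\<lambda>(\<tau>, \<xi>). H (\<tau>, \<gamma> * \<xi>))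
    (\<lambda>k l \<tau>. (\<gamma> ^ k * cnj \<gamma> ^ l) *s h k l \<tau>) \<alpha>1 (\<gamma> ^ 3 * \<alpha>2) (cnj \<gamma> ^ 3 * \<alpha>3) (cnj \<gamma> ^ 3 * b) c"
proof -
  let ?U = "\<lambda>r. UNIV \<times> ball 0 r :: (real \<times> complex) set"
  let ?L = "\<lambda>x :: real \<times> complex. (fst x, \<gamma> * snd x)"
  let ?H = "\<lambda>(\<tau>, \<xi>). H (\<tau>, \<gamma> * \<xi>)"
  have gg: "\<gamma> * cnj \<gamma> = 1" using \<gamma> complex_norm_square[of \<gamma>] by simp
  have L: "bounded_linear ?L"
    by (intro bounded_linear_Pair bounded_linear_fst bounded_linear_compose[OF bounded_linear_mult_right bounded_linear_snd])
  have LU: "?L ` ?U r \<subseteq> ?U r" for r using \<gamma> by (auto simp: norm_mult)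
  have U: "open (?U r)" for r by (intro open_Times) auto
  obtain r p q where \<alpha>: "\<alpha>3 = cnj \<alpha>2" and ex: "cm_expansion H h"
    and n20: "integral {0..T} (\<lambda>\<tau>. herm (cnj_vec (vs \<tau>)) (h 2 0 \<tau>)) = 0"
    and n11: "integral {0..T} (\<lambda>\<tau>. herm (cvec (\<phi> \<tau>)) (h 1 1 \<tau>)) = 0"
    and r: "r > 0" and CH: "Ck_on 4 (?U r) H"
    and HT: "\<forall>\<tau>. \<forall>\<xi>\<in>ball 0 r. H (\<tau> + 3 * T, \<xi>) = H (\<tau>, \<xi>)"
    and cm: "\<forall>\<tau>. \<forall>\<xi>\<in>ball 0 r. cm_param u0 v H \<tau> \<xi> = cm_param u0 v H (\<tau> + T) (cis (- (2 * pi / 3)) * \<xi>)"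
    and Cp: "Ck_on 1 (?U r) p" and Cq: "Ck_on 1 (?U r) q"
    and pqT: "\<forall>\<tau>. \<forall>\<xi>\<in>ball 0 r. p (\<tau> + 3 * T, \<xi>) = p (\<tau>, \<xi>) \<and> q (\<tau> + 3 * T, \<xi>) = q (\<tau>, \<xi>)"
    and p4: "bigO4 p" and q4: "bigO4 q"
    and fl: "\<forall>J \<theta> \<xi>. open J \<and> is_interval J \<and> \<xi> ` J \<subseteq> ball 0 r \<and> R3_flow \<alpha>1 \<alpha>2 \<alpha>3 b c p q J \<theta> \<xi> \<longrightarrow>
       (\<forall>t\<in>J. ((\<lambda>s. cm_param u0 v H (\<theta> s) (\<xi> s)) has_vector_derivative F (cm_param u0 v H (\<theta> t) (\<xi> t))) (at t))"
    by (rule R3_center_manifoldE[OF M])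
  let ?p = "\<lambda>(\<tau>, \<xi>). p (\<tau>, \<gamma> * \<xi>)" and ?q = "\<lambda>(\<tau>, \<xi>). cnj \<gamma> * q (\<tau>, \<gamma> * \<xi>)"
  have ball: "\<gamma> * \<xi> \<in> ball 0 r" if "\<xi> \<in> ball 0 r" for \<xi> using that \<gamma> by (simp add: norm_mult)
  have q4': "bigO4 ?q"
  proof -
    have "bigO4 (\<lambda>(\<tau>, \<xi>). q (\<tau>, \<gamma> * \<xi>))" by (rule bigO4_rotate[OF q4 \<gamma>])
    then show ?thesis using \<gamma> unfolding bigO4_def by (simp add: norm_mult)
  qed
  show ?thesis
  proof (rule R3_center_manifoldI[where r=r and p="?p" and q="?q"])
    show "cnj \<gamma> ^ 3 * \<alpha>3 = cnj (\<gamma> ^ 3 * \<alpha>2)" using \<alpha> by simp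
    show "cm_expansion ?H (\<lambda>k l \<tau>. (\<gamma> ^ k * cnj \<gamma> ^ l) *s h k l \<tau>)" by (rule rescaled_expansion[OF ex \<gamma>])
    \<comment> \<open>The first argument of \<open>herm\<close> is conjugated twice in all,
      contributing \<gamma>, and \<open>h 2 0\<close> contributes \<gamma>^2.\<close>
    have "herm (cnj_vec (\<gamma> *s vs \<tau>)) ((\<gamma>\<^sup>2 * cnj \<gamma> ^ 0) *s h 2 0 \<tau>) = \<gamma> ^ 3 * herm (cnj_vec (vs \<tau>)) (h 2 0 \<tau>)" for \<tau>
      by (simp add: cnj_vec_smult herm_smult power2_eq_square power3_eq_cube)
    then show "integral {0..T} (\<lambda>\<tau>. herm (cnj_vec (\<gamma> *s vs \<tau>)) ((\<gamma>\<^sup>2 * cnj \<gamma> ^ 0) *s h 2 0 \<tau>)) = 0"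
      using n20 by (simp only: integral_mult_right mult_zero_right)
    show "integral {0..T} (\<lambda>\<tau>. herm (cvec (\<phi> \<tau>)) ((\<gamma> ^ 1 * cnj \<gamma> ^ 1) *s h 1 1 \<tau>)) = 0"
      using n11 by (simp only: power_one_right gg vector_smult_lid)
    show "r > 0" by (rule r)
    have e: "?H = (\<lambda>x. H (?L x))" "?p = (\<lambda>x. p (?L x))" "?q = (\<lambda>x. cnj \<gamma> * q (?L x))" by auto
    show "Ck_on 4 (?U r) ?H" unfolding e(1) by (rule Ck_on_compose_linear[OF U L LU CH])
    show "Ck_on 1 (?U r) ?p" unfolding e(2) by (rule Ck_on_compose_linear[OF U L LU Cp])
    show "Ck_on 1 (?U r) ?q"
      unfolding e(3) by (rule Ck_on_linear_compose[OF U bounded_linear_mult_right Ck_on_compose_linear[OF U L LU Cq]])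
    show "bigO4 ?p" by (rule bigO4_rotate[OF p4 \<gamma>])
    show "bigO4 ?q" by (rule q4')
  next
    fix \<tau> \<xi> assume x: "\<xi> \<in> ball (0 :: complex) r"
    show "?H (\<tau> + 3 * T, \<xi>) = ?H (\<tau>, \<xi>)" using HT ball[OF x] by simp
    show "?p (\<tau> + 3 * T, \<xi>) = ?p (\<tau>, \<xi>)" "?q (\<tau> + 3 * T, \<xi>) = ?q (\<tau>, \<xi>)" using pqT ball[OF x] by simp_all
    show "cm_param u0 (\<lambda>\<tau>. \<gamma> *s v \<tau>) ?H \<tau> \<xi> = cm_param u0 (\<lambda>\<tau>. \<gamma> *s v \<tau>) ?H (\<tau> + T) (cis (- (2 * pi / 3)) * \<xi>)"
      unfolding rescaled_cm_param using bspec[OF spec[OF cm, of \<tau>] ball[OF x]] by (simp only: mult.left_commute)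
  next
    fix J \<theta> \<xi> t
    assume a: "open J \<and> is_interval J \<and> \<xi> ` J \<subseteq> ball 0 r \<and>
      R3_flow \<alpha>1 (\<gamma> ^ 3 * \<alpha>2) (cnj \<gamma> ^ 3 * \<alpha>3) (cnj \<gamma> ^ 3 * b) c ?p ?q J \<theta> \<xi>" and t: "t \<in> J"
    have "R3_flow \<alpha>1 \<alpha>2 \<alpha>3 b c p q J \<theta> (\<lambda>t. \<gamma> * \<xi> t)" using a by (intro rescaled_flow[OF \<gamma>]) blast
    moreover have "(\<lambda>t. \<gamma> * \<xi> t) ` J \<subseteq> ball 0 r" using a ball by blast
    ultimately show "((\<lambda>s. cm_param u0 (\<lambda>\<tau>. \<gamma> *s v \<tau>) ?H (\<theta> s) (\<xi> s)) has_vector_derivative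
        F (cm_param u0 (\<lambda>\<tau>. \<gamma> *s v \<tau>) ?H (\<theta> t) (\<xi> t))) (at t)"
      unfolding rescaled_cm_param using spec[OF spec[OF spec[OF fl, of J], of \<theta>], of "\<lambda>t. \<gamma> * \<xi> t"] a t by blast
  qed
qed

lemma R3_center_manifold_imp_locale:
  assumes "Ck_on 4 UNIV F" "periodic_solution F u0 T" "fundamental_matrix F u0 Y" "R3_multipliers (Y T)"
    "eigfun_v F u0 T v" "adjoint_phi F u0 T \<phi>" "adjoint_v F u0 T v vs"
    and M: "R3_center_manifold F u0 T v \<phi> vs H h \<alpha>1 \<alpha>2 \<alpha>3 b c"
  obtains r p q where "R3_normal_form F u0 T v H h \<alpha>1 \<alpha>2 \<alpha>3 b c r p q \<phi> vs Y"
proof -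
  obtain r p q where "cm_expansion H h"
    "integral {0..T} (\<lambda>\<tau>. herm (cnj_vec (vs \<tau>)) (h 2 0 \<tau>)) = 0"
    "integral {0..T} (\<lambda>\<tau>. herm (cvec (\<phi> \<tau>)) (h 1 1 \<tau>)) = 0"
    "r > 0" "Ck_on 4 (UNIV \<times> ball 0 r) H"
    and cm: "\<forall>\<tau>. \<forall>\<xi>\<in>ball 0 r. cm_param u0 v H \<tau> \<xi> = cm_param u0 v H (\<tau> + T) (cis (- (2 * pi / 3)) * \<xi>)"
    and "Ck_on 1 (UNIV \<times> ball 0 r) p" "Ck_on 1 (UNIV \<times> ball 0 r) q" "bigO4 p" "bigO4 q"
    and fl: "\<forall>J \<theta> \<xi>. open J \<and> is_interval J \<and> \<xi> ` J \<subseteq> ball 0 r \<and> R3_flow \<alpha>1 \<alpha>2 \<alpha>3 b c p q J \<theta> \<xi> \<longrightarrow>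
       (\<forall>t\<in>J. ((\<lambda>s. cm_param u0 v H (\<theta> s) (\<xi> s)) has_vector_derivative F (cm_param u0 v H (\<theta> t) (\<xi> t))) (at t))"
    by (rule R3_center_manifoldE[OF M])
  note facts = this(1-5) this(7-10)
  have "R3_normal_form F u0 T v H h \<alpha>1 \<alpha>2 \<alpha>3 b c r p q \<phi> vs Y"
  proof
    show "cm_param u0 v H \<tau> \<xi> = cm_param u0 v H (\<tau> + T) (cis (- (2 * pi / 3)) * \<xi>)" if "\<xi> \<in> ball 0 r" for \<tau> \<xi>
      using cm that by blast
    show "((\<lambda>s. cm_param u0 v H (\<theta> s) (\<xi> s)) has_vector_derivative F (cm_param u0 v H (\<theta> t) (\<xi> t))) (at t)"
      if "open J" "is_interval J" "\<xi> ` J \<subseteq> ball 0 r" "R3_flow \<alpha>1 \<alpha>2 \<alpha>3 b c p q J \<theta> \<xi>" "t \<in> J" for J \<theta> \<xi> t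
      using fl that by blast
  qed (fact assms facts)+
  then show ?thesis by (rule that)
qed

text \<open>Replacing \<open>v\<close> by \<gamma> v is expressed in two halves: a normal form for
  \<gamma> v with the predicted coefficients exists, and every normal form for \<gamma> v has these
  coefficients.\<close>

theorem mainTheorem6:
  fixes F :: "real^'n \<Rightarrow> real^'n" and u0 :: "real \<Rightarrow> real^'n" and T :: real
    and Y :: "real \<Rightarrow> real^'n^'n"
    and v vs :: "real \<Rightarrow> complex^'n" and \<phi> :: "real \<Rightarrow> real^'n"
    and H :: "real \<times> complex \<Rightarrow> real^'n" and h :: "nat \<Rightarrow> nat \<Rightarrow> real \<Rightarrow> complex^'n"
    and \<alpha>1 :: real and \<alpha>2 \<alpha>3 b c :: complex
  assumes "Ck_on 4 UNIV F"
    and "periodic_solution F u0 T"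
    and "fundamental_matrix F u0 Y"
    and "R3_multipliers (Y T)"
    and "eigfun_v F u0 T v"
    and "adjoint_phi F u0 T \<phi>"
    and "adjoint_v F u0 T v vs"
    and "R3_center_manifold F u0 T v \<phi> vs H h \<alpha>1 \<alpha>2 \<alpha>3 b c"
  shows "b = 1 / 2 * integral {0..T}
           (\<lambda>\<tau>. herm (vs \<tau>) (formB F (u0 \<tau>) (cnj_vec (v \<tau>)) (cnj_vec (v \<tau>))))
    \<and> complex_of_real \<alpha>1 = integral {0..T}
           (\<lambda>\<tau>. herm (cvec (\<phi> \<tau>)) (formB F (u0 \<tau>) (v \<tau>) (cnj_vec (v \<tau>))))
    \<and> h20_bvp F u0 T v vs b (h 2 0)
    \<and> (\<forall>w. h20_bvp F u0 T v vs b w \<longrightarrow> (\<forall>\<tau>\<in>{0..T}. w \<tau> = h 2 0 \<tau>))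
    \<and> h11_bvp F u0 T v \<phi> \<alpha>1 (h 1 1)
    \<and> (\<forall>w. h11_bvp F u0 T v \<phi> \<alpha>1 w \<longrightarrow> (\<forall>\<tau>\<in>{0..T}. w \<tau> = h 1 1 \<tau>))
    \<and> c = 1 / 2 * integral {0..T}
           (\<lambda>\<tau>. herm (vs \<tau>)
              (formC F (u0 \<tau>) (v \<tau>) (v \<tau>) (cnj_vec (v \<tau>))
               + 2 *s formB F (u0 \<tau>) (v \<tau>) (h 1 1 \<tau>)
               + formB F (u0 \<tau>) (cnj_vec (v \<tau>)) (h 2 0 \<tau>)
               - (2 * complex_of_real \<alpha>1) *s (formA F (u0 \<tau>) *v v \<tau>)))
    \<and> (\<forall>\<gamma>::complex. norm \<gamma> = 1 \<longrightarrow>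
         (\<exists>vs' H' h' \<alpha>1' \<alpha>2' \<alpha>3'.
            adjoint_v F u0 T (\<lambda>\<tau>. \<gamma> *s v \<tau>) vs' \<and>
            R3_center_manifold F u0 T (\<lambda>\<tau>. \<gamma> *s v \<tau>) \<phi> vs' H' h' \<alpha>1' \<alpha>2' \<alpha>3' (cnj \<gamma> ^ 3 * b) c) \<and>
         (\<forall>vs' H' h' \<alpha>1' \<alpha>2' \<alpha>3' b' c'.
            adjoint_v F u0 T (\<lambda>\<tau>. \<gamma> *s v \<tau>) vs' \<and>
            R3_center_manifold F u0 T (\<lambda>\<tau>. \<gamma> *s v \<tau>) \<phi> vs' H' h' \<alpha>1' \<alpha>2' \<alpha>3' b' c' \<longrightarrow>
            c' = c \<and> b' = cnj \<gamma> ^ 3 * b))"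
proof -
  obtain r p q where L: "R3_normal_form F u0 T v H h \<alpha>1 \<alpha>2 \<alpha>3 b c r p q \<phi> vs Y"
    using R3_center_manifold_imp_locale[OF assms] by blast
  interpret R3_normal_form F u0 T v H h \<alpha>1 \<alpha>2 \<alpha>3 b c r p q \<phi> vs Y by (rule L)
  have exists: "\<exists>vs' H' h' \<alpha>1' \<alpha>2' \<alpha>3'. adjoint_v F u0 T (\<lambda>\<tau>. \<gamma> *s v \<tau>) vs' \<and>
      R3_center_manifold F u0 T (\<lambda>\<tau>. \<gamma> *s v \<tau>) \<phi> vs' H' h' \<alpha>1' \<alpha>2' \<alpha>3' (cnj \<gamma> ^ 3 * b) c"
    if "norm \<gamma> = 1" for \<gamma>
    using rescaled_adjoint[OF assms(7) that] rescaled_manifold[OF assms(8) that] by blast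
  have unique: "c' = c \<and> b' = cnj \<gamma> ^ 3 * b"
    if "norm \<gamma> = 1" and a: "adjoint_v F u0 T (\<lambda>\<tau>. \<gamma> *s v \<tau>) vs'"
      and M: "R3_center_manifold F u0 T (\<lambda>\<tau>. \<gamma> *s v \<tau>) \<phi> vs' H' h' \<alpha>1' \<alpha>2' \<alpha>3' b' c'"
    for \<gamma> vs' H' h' \<alpha>1' \<alpha>2' \<alpha>3' b' c'
  proof -
    obtain r' p' q' where "R3_normal_form F u0 T (\<lambda>\<tau>. \<gamma> *s v \<tau>) H' h' \<alpha>1' \<alpha>2' \<alpha>3' b' c' r' p' q' \<phi> vs' Y"
      using R3_center_manifold_imp_locale[OF assms(1-4) rescaled_eigfun[OF assms(5) \<open>norm \<gamma> = 1\<close>] assms(6) a M] by blast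
    then show ?thesis by (rule rescaled_coefficients[OF \<open>norm \<gamma> = 1\<close>])
  qed
  show ?thesis
    using b_eq \<alpha>1_eq h20_solves h20_unique h11_solves h11_unique c_eq exists unique by blast
qed

end
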